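(* Let $(\Omega,\mu)$ be a measure space, $1<p<\infty$, let $T=(T_t)_{t\ge0}$ be a strongly continuous semigroup of contractively regular operators on $L^p(\Omega)$ with infinitesimal generator $A$, and let $x\in L^p(\Omega)$. Then for almost every $\lambda\in\Omega$, $$[M_t(T)x](\lambda)\longrightarrow[P_A(x)](\lambda)\quad\text{when } t\to\infty$$ and $$[M_t(T)x](\lambda)\longrightarrow x(\lambda)\quad\text{when } t\to0^+ .$$
   Context: $L^p$-spaces are complex. A bounded linear operator $S$ on $L^p(\Omega)$ is regular if there is $C\ge 0$ with $\Vert \sup_k |S(x_k)|\Vert_p\le C\Vert \sup_k|x_k|\Vert_p$ for all finite sequences $(x_k)_{k\ge1}$ in $L^p(\Omega)$; the least such $C$ is $\Vert S\Vert_r$, and $S$ is contractively regular if $\Vert S\Vert_r\le 1$. For $t>0$, $M_t(T)=\frac1t\int_0^tT_s\,ds$ in the strong sense. For fixed $x$, representatives of the classes $M_t(T)x$ are chosen so that $t\mapsto[M_t(T)x](\lambda)$ is continuous on $(0,\infty)$ for a.e. $\lambda$ (such a choice is known to exist). For a strongly continuous semigroup of contractions on $L^p(\Omega)$ one has $L^p(\Omega)=N(A)\oplus\overline{R(A)}$ ($N$ = kernel, $R$ = range); $P_A$ denotes the corresponding projection onto $N(A)$. *)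

theory Defs
  imports "HOL-Analysis.Analysis"
begin

text \<open>
  Elements of the complex space \<open>L\<^sup>p(M)\<close> are represented by functions; two functions denote
  the same element iff they agree almost everywhere. The measure space is arbitrary.
\<close>

definition Lp :: "'a measure \<Rightarrow> real \<Rightarrow> ('a \<Rightarrow> complex) set" where
  "Lp M p = {f \<in> borel_measurable M. integrable M (\<lambda>\<omega>. norm (f \<omega>) powr p)}"

definition Lp_norm :: "'a measure \<Rightarrow> real \<Rightarrow> ('a \<Rightarrow> 'b::real_normed_vector) \<Rightarrow> real" where
  "Lp_norm M p f = (\<integral>\<omega>. norm (f \<omega>) powr p \<partial>M) powr (1 / p)"

text \<open>
  An operator acts on representatives, so linearity is required up to null sets, and almost
  everywhere equal functions must have almost everywhere equal images.
\<close>

definition Lp_bounded_linear ::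
    "'a measure \<Rightarrow> real \<Rightarrow> (('a \<Rightarrow> complex) \<Rightarrow> 'a \<Rightarrow> complex) \<Rightarrow> bool" where
  "Lp_bounded_linear M p S \<longleftrightarrow>
     (\<forall>f\<in>Lp M p. S f \<in> Lp M p) \<and>
     (\<forall>f\<in>Lp M p. \<forall>g\<in>Lp M p. (AE \<omega> in M. f \<omega> = g \<omega>) \<longrightarrow> (AE \<omega> in M. S f \<omega> = S g \<omega>)) \<and>
     (\<forall>f\<in>Lp M p. \<forall>g\<in>Lp M p. AE \<omega> in M. S (\<lambda>\<omega>. f \<omega> + g \<omega>) \<omega> = S f \<omega> + S g \<omega>) \<and>
     (\<forall>c. \<forall>f\<in>Lp M p. AE \<omega> in M. S (\<lambda>\<omega>. c * f \<omega>) \<omega> = c * S f \<omega>) \<and>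
     (\<exists>B. \<forall>f\<in>Lp M p. Lp_norm M p (S f) \<le> B * Lp_norm M p f)"

definition regular_bound ::
    "'a measure \<Rightarrow> real \<Rightarrow> (('a \<Rightarrow> complex) \<Rightarrow> 'a \<Rightarrow> complex) \<Rightarrow> real \<Rightarrow> bool" where
  "regular_bound M p S C \<longleftrightarrow> 0 \<le> C \<and>
     (\<forall>(n::nat) x. (\<forall>k\<le>n. x k \<in> Lp M p) \<longrightarrow>
        Lp_norm M p (\<lambda>\<omega>. MAX k\<in>{..n}. cmod (S (x k) \<omega>))
          \<le> C * Lp_norm M p (\<lambda>\<omega>. MAX k\<in>{..n}. cmod (x k \<omega>)))"

definition regular_operator ::
    "'a measure \<Rightarrow> real \<Rightarrow> (('a \<Rightarrow> complex) \<Rightarrow> 'a \<Rightarrow> complex) \<Rightarrow> bool" where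
  "regular_operator M p S \<longleftrightarrow> Lp_bounded_linear M p S \<and> (\<exists>C. regular_bound M p S C)"

definition regular_norm ::
    "'a measure \<Rightarrow> real \<Rightarrow> (('a \<Rightarrow> complex) \<Rightarrow> 'a \<Rightarrow> complex) \<Rightarrow> real" where
  "regular_norm M p S = Inf {C. regular_bound M p S C}"

definition contractively_regular ::
    "'a measure \<Rightarrow> real \<Rightarrow> (('a \<Rightarrow> complex) \<Rightarrow> 'a \<Rightarrow> complex) \<Rightarrow> bool" where
  "contractively_regular M p S \<longleftrightarrow> regular_operator M p S \<and> regular_norm M p S \<le> 1"

text \<open>Only the operators \<open>T t\<close> with \<open>0 \<le> t\<close> are relevant.\<close>

definition Lp_C0_semigroup ::
    "'a measure \<Rightarrow> real \<Rightarrow> (real \<Rightarrow> ('a \<Rightarrow> complex) \<Rightarrow> 'a \<Rightarrow> complex) \<Rightarrow> bool" where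
  "Lp_C0_semigroup M p T \<longleftrightarrow>
     (\<forall>t\<ge>0. Lp_bounded_linear M p (T t)) \<and>
     (\<forall>f\<in>Lp M p. AE \<omega> in M. T 0 f \<omega> = f \<omega>) \<and>
     (\<forall>s\<ge>0. \<forall>t\<ge>0. \<forall>f\<in>Lp M p. AE \<omega> in M. T (s + t) f \<omega> = T s (T t f) \<omega>) \<and>
     (\<forall>f\<in>Lp M p. ((\<lambda>t. Lp_norm M p (\<lambda>\<omega>. T t f \<omega> - f \<omega>)) \<longlongrightarrow> 0) (at_right 0))"

text \<open>
  Unbounded operators are represented by their graphs, as relations closed under almost
  everywhere equality: \<open>Lp_generator M p T f g\<close> says that \<open>f\<close> is in the domain of the
  infinitesimal generator \<open>A\<close> of \<open>T\<close> and that \<open>g\<close> represents \<open>A f\<close>.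
\<close>

definition Lp_generator ::
    "'a measure \<Rightarrow> real \<Rightarrow> (real \<Rightarrow> ('a \<Rightarrow> complex) \<Rightarrow> 'a \<Rightarrow> complex)
       \<Rightarrow> ('a \<Rightarrow> complex) \<Rightarrow> ('a \<Rightarrow> complex) \<Rightarrow> bool" where
  "Lp_generator M p T f g \<longleftrightarrow> f \<in> Lp M p \<and> g \<in> Lp M p \<and>
     ((\<lambda>t. Lp_norm M p (\<lambda>\<omega>. (T t f \<omega> - f \<omega>) /\<^sub>R t - g \<omega>)) \<longlongrightarrow> 0) (at_right 0)"

definition op_kernel :: "(('a \<Rightarrow> complex) \<Rightarrow> ('a \<Rightarrow> complex) \<Rightarrow> bool) \<Rightarrow> ('a \<Rightarrow> complex) set" where
  "op_kernel A = {f. A f (\<lambda>_. 0)}"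

definition op_range :: "(('a \<Rightarrow> complex) \<Rightarrow> ('a \<Rightarrow> complex) \<Rightarrow> bool) \<Rightarrow> ('a \<Rightarrow> complex) set" where
  "op_range A = {g. \<exists>f. A f g}"

definition Lp_closure :: "'a measure \<Rightarrow> real \<Rightarrow> ('a \<Rightarrow> complex) set \<Rightarrow> ('a \<Rightarrow> complex) set" where
  "Lp_closure M p V =
     {g \<in> Lp M p. \<forall>e>0. \<exists>h\<in>V. Lp_norm M p (\<lambda>\<omega>. g \<omega> - h \<omega>) < e}"

text \<open>
  A representative of the component of \<open>x\<close> in the kernel of \<open>A\<close>, for the decomposition of
  \<open>L\<^sup>p(M)\<close> as the direct sum of the kernel of \<open>A\<close> and the closure of the range of \<open>A\<close>. When this
  decomposition holds, the value is determined up to a null set for every \<open>x\<close> in \<open>L\<^sup>p(M)\<close>.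
\<close>

definition kernel_projection ::
    "'a measure \<Rightarrow> real \<Rightarrow> (('a \<Rightarrow> complex) \<Rightarrow> ('a \<Rightarrow> complex) \<Rightarrow> bool)
       \<Rightarrow> ('a \<Rightarrow> complex) \<Rightarrow> 'a \<Rightarrow> complex" where
  "kernel_projection M p A x =
     (SOME y. y \<in> op_kernel A \<and> (\<lambda>\<omega>. x \<omega> - y \<omega>) \<in> Lp_closure M p (op_range A))"

text \<open>
  The \<open>L\<^sup>p\<close>-valued Riemann integral over \<open>{a..b}\<close>: Riemann sums of tagged divisions converge
  in norm as the mesh tends to \<open>0\<close>. The library integrals need a normed target type, which
  \<open>L\<^sup>p(M)\<close> is not here. For a strongly continuous semigroup the orbits \<open>\<lambda>s. T s x\<close> are
  norm continuous, so this is the integral in the strong sense.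
\<close>

definition has_Lp_integral ::
    "'a measure \<Rightarrow> real \<Rightarrow> (real \<Rightarrow> 'a \<Rightarrow> complex) \<Rightarrow> ('a \<Rightarrow> complex) \<Rightarrow> real \<Rightarrow> real \<Rightarrow> bool" where
  "has_Lp_integral M p F y a b \<longleftrightarrow> y \<in> Lp M p \<and>
     (\<forall>e>0. \<exists>d>0. \<forall>D. D tagged_division_of {a..b} \<and> (\<lambda>s. ball s d) fine D \<longrightarrow>
        Lp_norm M p (\<lambda>\<omega>. (\<Sum>(s, K)\<in>D. measure lborel K *\<^sub>R F s \<omega>) - y \<omega>) < e)"

text \<open>\<open>y\<close> is a representative of \<open>M\<^sub>t(T)x = (1/t) \<integral>\<^sub>0\<^sup>t T\<^sub>s x ds\<close>.\<close>

definition represents_mean ::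
    "'a measure \<Rightarrow> real \<Rightarrow> (real \<Rightarrow> ('a \<Rightarrow> complex) \<Rightarrow> 'a \<Rightarrow> complex)
       \<Rightarrow> real \<Rightarrow> ('a \<Rightarrow> complex) \<Rightarrow> ('a \<Rightarrow> complex) \<Rightarrow> bool" where
  "represents_mean M p T t x y \<longleftrightarrow>
     (\<exists>z. has_Lp_integral M p (\<lambda>s. T s x) z 0 t \<and> y \<in> borel_measurable M \<and>
          (AE \<omega> in M. y \<omega> = (1 / t) *\<^sub>R z \<omega>))"

end

(*
  For a sequence a let M be its maximal average and b(a) its norm dual to
  l^q restricted to weights of decreasing modulus. Abel summation and Young's inequality give the
  pointwise bound (p - 1) M^p + b(a)^p <= b(shift a)^p + p |a_0| M^(p-1). A contractively regular S
  does not increase the integral of b^p when applied termwise, since b is a supremum of moduli of linear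
  combinations; so along the orbit a_k = S^k x the bound telescopes to the maximal inequality for
  the averages of S.

  The maximal inequality passes to the means of a semigroup by Riemann sums over dyadic grids.
  Almost everywhere convergence at infinity reduces, via t M_t(T)x = n M_n(T)x + T_n (s M_s(T)x)
  with t = n + s, to the discrete averages of T_1 applied to M_1(T)x. These converge by
  Banach's principle once M_1(T)x is approximated by fixed points plus coboundaries. Convergence at 0
  follows by approximating x by M_u(T)x.
*)
theory Submission imports Defs begin

text \<open>Pointwise, regularity controls nothing but suprema of moduli of countably many
  functions, so whatever is telescoped along an orbit must be such a supremum of linear functionals.
  The full l^p norm of a sequence has this form but does not see averages. With decreasing dual
  weights it becomes the l^p norm of Halperin's level function, the slopes of the least concave
  majorant of the partial sums of |a|, and the first of these slopes is exactly the maximal average.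
  This is why the weights decrease.

  Elements of L^p are functions here, and every operator identity holds off a null set that depends
  on the functions and times involved. Hence maximal inequalities are phrased as domination by one
  function in L^p, index sets are kept countable, and continuity of \<open>m t w\<close> in t
  extends estimates from dyadic times to all times. Norm limits are obtained from pointwise limits
  with a common majorant, and the maximal inequality supplies that majorant. It therefore serves the
  identification of the limit as well as the convergence itself.\<close>

lemma powr_convex_combination:
  fixes p u v a b :: real
  assumes "1 \<le> p" "0 \<le> u" "0 \<le> v" "0 \<le> a" "0 \<le> b" "a + b = 1"
  shows "(a * u + b * v) powr p \<le> a * u powr p + b * v powr p"
proof -
  \<comment> \<open>When one of the two arguments is zero, the claim reduces to c^p \<le> c for c in
    [0,1]; these cases are treated apart from convexity on positive arguments.\<close>
  have shrink: "(c * v) powr p \<le> c * v powr p" if "0 \<le> c" "c \<le> 1" "0 \<le> v" for c v :: real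
  proof (cases "c = 0")
    case False
    have "c powr p \<le> c powr 1"
      using that assms False by (intro powr_mono') auto
    then show ?thesis
      using that False by (simp add: powr_mult mult_right_mono)
  qed simp
  show ?thesis
  proof (cases "u = 0 \<or> v = 0")
    case True
    then show ?thesis
      using assms shrink[of a u] shrink[of b v] by auto
  next
    case False
    then show ?thesis
      using convex_onD[OF powr_convex[OF assms(1)], of b u v] assms
      by (simp add: eq_diff_eq[symmetric])
  qed
qed

lemma AE_all_countable_set:
  assumes "countable I" "\<And>i. i \<in> I \<Longrightarrow> AE x in M. P i x"
  shows "AE x in M. \<forall>i\<in>I. P i x"
  using assms by (subst AE_ball_countable) auto

section \<open>p-integrable functions and their seminorm\<close>

locale Lp_space =
  fixes M :: "'a measure" and p :: real
  assumes p_gt_1: "1 < p"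
begin

text \<open>The target type is left open because majorants are real valued, whereas
  \<open>Lp\<close> consists of complex functions.\<close>

definition in_Lp :: "('a \<Rightarrow> 'b::real_normed_vector) \<Rightarrow> bool" where
  "in_Lp f \<longleftrightarrow> f \<in> borel_measurable M \<and> integrable M (\<lambda>w. norm (f w) powr p)"

abbreviation nrm :: "('a \<Rightarrow> 'b::real_normed_vector) \<Rightarrow> real" where
  "nrm \<equiv> Lp_norm M p"

lemma in_Lp_iff: "in_Lp f \<longleftrightarrow> f \<in> Lp M p"
  by (simp add: in_Lp_def Lp_def)

lemma p_pos: "0 < p"
  using p_gt_1 by simp

lemma in_Lp_measurable [measurable_dest]: "in_Lp f \<Longrightarrow> f \<in> borel_measurable M"
  by (simp add: in_Lp_def)

lemma in_Lp_integrable: "in_Lp f \<Longrightarrow> integrable M (\<lambda>w. norm (f w) powr p)"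
  by (simp add: in_Lp_def)

lemma nrm_nonneg [simp]: "0 \<le> nrm f"
  by (simp add: Lp_norm_def)

lemma nrm_powr: "nrm f powr p = (\<integral>w. norm (f w) powr p \<partial>M)"
  using p_gt_1 by (simp add: Lp_norm_def powr_powr)

lemma nrm_le_iff: "0 \<le> K \<Longrightarrow> nrm f \<le> K \<longleftrightarrow> (\<integral>w. norm (f w) powr p \<partial>M) \<le> K powr p"
  unfolding nrm_powr[symmetric] using p_pos
  by (metis nrm_nonneg powr_less_mono2 powr_mono2 less_le_not_le linorder_not_le order_less_imp_le)

lemma in_Lp_bound:
  assumes "f \<in> borel_measurable M" "in_Lp g" "AE w in M. norm (f w) \<le> norm (g w)"
  shows "in_Lp f" "nrm f \<le> nrm g"
proof -
  have *: "AE w in M. norm (f w) powr p \<le> norm (g w) powr p"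
    using assms(3) by eventually_elim (use p_gt_1 in \<open>auto intro: powr_mono2\<close>)
  have "integrable M (\<lambda>w. norm (f w) powr p)"
    using * assms(1) by (intro Bochner_Integration.integrable_bound[OF in_Lp_integrable[OF assms(2)]]) auto
  then show f: "in_Lp f"
    using assms(1) by (simp add: in_Lp_def)
  have "(\<integral>w. norm (f w) powr p \<partial>M) \<le> (\<integral>w. norm (g w) powr p \<partial>M)"
    using * by (intro integral_mono_AE in_Lp_integrable f assms)
  then show "nrm f \<le> nrm g"
    by (simp add: nrm_le_iff nrm_powr)
qed

lemma nrm_cong: "AE w in M. norm (f w) = norm (g w) \<Longrightarrow>
    f \<in> borel_measurable M \<Longrightarrow> g \<in> borel_measurable M \<Longrightarrow> nrm f = nrm g"
  unfolding Lp_norm_def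
  by (rule arg_cong[where f="\<lambda>x. x powr (1/p)"], rule integral_cong_AE) auto

lemma in_Lp_cong: "AE w in M. f w = g w \<Longrightarrow> f \<in> borel_measurable M \<Longrightarrow> in_Lp g \<Longrightarrow> in_Lp f"
  by (rule in_Lp_bound(1)[of f g]) auto

lemma in_Lp_zero [simp]: "in_Lp (\<lambda>_. 0)"
  by (simp add: in_Lp_def)

lemma nrm_zero [simp]: "nrm (\<lambda>_. 0) = 0"
  by (simp add: Lp_norm_def)

lemma nrm_norm [simp]: "nrm (\<lambda>w. norm (f w)) = nrm f"
  by (simp add: Lp_norm_def)

lemma in_Lp_norm: "in_Lp f \<Longrightarrow> in_Lp (\<lambda>w. norm (f w))"
  by (auto simp: in_Lp_def)

lemma in_Lp_add:
  fixes f g :: "'a \<Rightarrow> 'b::{second_countable_topology, real_normed_vector}"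
  assumes "in_Lp f" "in_Lp g"
  shows "in_Lp (\<lambda>w. f w + g w)"
proof -
  note [measurable] = assms[THEN in_Lp_measurable]
  have *: "norm (f w + g w) powr p \<le> 2 powr p * (norm (f w) powr p + norm (g w) powr p)" for w
  proof -
    have "norm (f w + g w) powr p \<le> (2 * max (norm (f w)) (norm (g w))) powr p"
      using p_gt_1 norm_triangle_ineq[of "f w" "g w"] by (intro powr_mono2) auto
    also have "\<dots> = 2 powr p * max (norm (f w)) (norm (g w)) powr p"
      by (subst powr_mult) auto
    also have "\<dots> \<le> 2 powr p * (norm (f w) powr p + norm (g w) powr p)"
      by (intro mult_left_mono) (auto simp: max_def)
    finally show ?thesis .
  qed
  have "integrable M (\<lambda>w. 2 powr p * (norm (f w) powr p + norm (g w) powr p))"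
    using assms[THEN in_Lp_integrable] by auto
  then have "integrable M (\<lambda>w. norm (f w + g w) powr p)"
    by (rule Bochner_Integration.integrable_bound) (use * in \<open>auto simp: intro!: order_trans[OF *]\<close>)
  then show ?thesis
    by (simp add: in_Lp_def)
qed

lemma in_Lp_scaleR: "in_Lp f \<Longrightarrow> in_Lp (\<lambda>w. c *\<^sub>R f w)"
  by (auto simp: in_Lp_def powr_mult)

lemma nrm_scaleR: "nrm (\<lambda>w. c *\<^sub>R f w) = \<bar>c\<bar> * nrm f"
  using p_gt_1 by (simp add: Lp_norm_def powr_mult powr_powr)

lemma in_Lp_mult: "in_Lp (f :: 'a \<Rightarrow> 'b::{real_normed_div_algebra}) \<Longrightarrow> in_Lp (\<lambda>w. c * f w)"
  by (auto simp: in_Lp_def powr_mult norm_mult intro!: borel_measurable_continuous_onI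
      measurable_compose[of f M borel "\<lambda>x. c * x"] continuous_intros)

lemma in_Lp_diff:
  fixes f g :: "'a \<Rightarrow> 'b::{second_countable_topology, real_normed_vector}"
  assumes "in_Lp f" "in_Lp g"
  shows "in_Lp (\<lambda>w. f w - g w)"
  using in_Lp_add[OF assms(1) in_Lp_scaleR[OF assms(2), of "-1"]] by simp

lemma in_Lp_sum:
  fixes f :: "'i \<Rightarrow> 'a \<Rightarrow> 'b::{second_countable_topology, real_normed_vector}"
  assumes "\<And>i. i \<in> I \<Longrightarrow> in_Lp (f i)"
  shows "in_Lp (\<lambda>w. \<Sum>i\<in>I. f i w)"
  using assms by (induction I rule: infinite_finite_induct) (auto intro: in_Lp_add)

lemma nrm_minus_commute:
  "nrm (\<lambda>w. f w - g w) = nrm (\<lambda>w. g w - f w)"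
  by (simp add: Lp_norm_def norm_minus_commute)

lemma nrm_eq_0_iff:
  assumes "in_Lp f"
  shows "nrm f = 0 \<longleftrightarrow> (AE w in M. f w = 0)"
proof -
  have "nrm f = 0 \<longleftrightarrow> (\<integral>w. norm (f w) powr p \<partial>M) = 0"
    by (simp add: Lp_norm_def)
  also have "\<dots> \<longleftrightarrow> (AE w in M. norm (f w) powr p = 0)"
    by (rule integral_nonneg_eq_0_iff_AE[OF in_Lp_integrable[OF assms]]) simp
  finally show ?thesis
    by simp
qed

text \<open>Minkowski's inequality from convexity of the p-th power: with f normalised by its norm a
  and g by its norm b, the convex combination with weights a/(a+b) and b/(a+b) integrates to
  (a+b)^p. Vanishing norms are treated apart.\<close>

lemma nrm_triangle:
  fixes f g :: "'a \<Rightarrow> 'b::{second_countable_topology, real_normed_vector}"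
  assumes f: "in_Lp f" and g: "in_Lp g"
  shows "nrm (\<lambda>w. f w + g w) \<le> nrm f + nrm g"
proof -
  have fg: "in_Lp (\<lambda>w. f w + g w)"
    by (rule in_Lp_add[OF f g])
  show ?thesis
  proof (cases "nrm f = 0 \<or> nrm g = 0")
    case True
    then show ?thesis
    proof
      assume "nrm f = 0"
      then have "AE w in M. f w = 0" using nrm_eq_0_iff[OF f] by simp
      then have "nrm (\<lambda>w. f w + g w) = nrm g"
        by (intro nrm_cong in_Lp_measurable fg g) auto
      then show ?thesis by simp
    next
      assume "nrm g = 0"
      then have "AE w in M. g w = 0" using nrm_eq_0_iff[OF g] by simp
      then have "nrm (\<lambda>w. f w + g w) = nrm f"
        by (intro nrm_cong in_Lp_measurable fg f) auto
      then show ?thesis by simp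
    qed
  next
    case False
    define a b where "a = nrm f" and "b = nrm g"
    have ab: "a > 0" "b > 0"
      using False nrm_nonneg[of f] nrm_nonneg[of g] unfolding a_def b_def by linarith+
    have *: "norm (f w + g w) powr p \<le> (a + b) powr p * (a / (a+b) * (norm (f w) powr p / a powr p)
           + b / (a+b) * (norm (g w) powr p / b powr p))" for w
    proof -
      have "norm (f w + g w) powr p \<le> (norm (f w) + norm (g w)) powr p"
        using p_gt_1 by (intro powr_mono2 norm_triangle_ineq) auto
      also have "norm (f w) + norm (g w)
          = (a + b) * (a / (a+b) * (norm (f w) / a) + b / (a+b) * (norm (g w) / b))"
      proof -
        have "a / (a+b) * (norm (f w) / a) = norm (f w) / (a+b)"
          "b / (a+b) * (norm (g w) / b) = norm (g w) / (a+b)"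
          using ab by auto
        then show ?thesis
          using ab by (simp add: add_divide_distrib[symmetric])
      qed
      also have "\<dots> powr p = (a + b) powr p *
          (a / (a+b) * (norm (f w) / a) + b / (a+b) * (norm (g w) / b)) powr p"
        using ab by (subst powr_mult) auto
      also have "\<dots> \<le> (a + b) powr p * (a / (a+b) * (norm (f w) / a) powr p
          + b / (a+b) * (norm (g w) / b) powr p)"
        using ab p_gt_1 by (intro mult_left_mono powr_convex_combination)
          (auto simp: add_divide_distrib[symmetric])
      finally show ?thesis
        using ab by (simp add: powr_divide)
    qed
    have "(\<integral>w. norm (f w + g w) powr p \<partial>M) \<le>
        (\<integral>w. (a + b) powr p * (a / (a+b) * (norm (f w) powr p / a powr p)
           + b / (a+b) * (norm (g w) powr p / b powr p)) \<partial>M)"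
      using * in_Lp_integrable[OF fg] in_Lp_integrable[OF f] in_Lp_integrable[OF g]
      by (intro integral_mono) auto
    also have "\<dots> = (a + b) powr p * (a / (a+b) * (a powr p / a powr p)
           + b / (a+b) * (b powr p / b powr p))"
      using in_Lp_integrable[OF f] in_Lp_integrable[OF g] by (simp add: a_def b_def nrm_powr)
    also have "\<dots> = (a + b) powr p"
      using ab by (simp add: add_divide_distrib[symmetric])
    finally show ?thesis
      using ab by (subst nrm_le_iff) (auto simp: a_def b_def)
  qed
qed

lemma nrm_triangle_diff:
  fixes f g h :: "'a \<Rightarrow> 'b::{second_countable_topology, real_normed_vector}"
  assumes "in_Lp f" "in_Lp g" "in_Lp h"
  shows "nrm (\<lambda>w. f w - h w) \<le> nrm (\<lambda>w. f w - g w) + nrm (\<lambda>w. g w - h w)"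
  using nrm_triangle[OF in_Lp_diff[OF assms(1,2)] in_Lp_diff[OF assms(2,3)]] by simp

lemma nrm_sum:
  fixes f :: "'i \<Rightarrow> 'a \<Rightarrow> 'b::{second_countable_topology, real_normed_vector}"
  assumes "\<And>i. i \<in> I \<Longrightarrow> in_Lp (f i)"
  shows "nrm (\<lambda>w. \<Sum>i\<in>I. f i w) \<le> (\<Sum>i\<in>I. nrm (f i))"
  using assms
proof (induction I rule: infinite_finite_induct)
  case (insert x F)
  have "nrm (\<lambda>w. f x w + (\<Sum>i\<in>F. f i w)) \<le> nrm (f x) + nrm (\<lambda>w. \<Sum>i\<in>F. f i w)"
    using insert by (intro nrm_triangle in_Lp_sum) auto
  then show ?case
    using insert by auto
qed auto

text \<open>The sum of the functions |f n|^p has finite integral, so it converges almost everywhere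
  and its terms tend to zero.\<close>

lemma summable_nrm_powr_imp_AE_tendsto:
  fixes f :: "nat \<Rightarrow> 'a \<Rightarrow> 'b::real_normed_vector"
  assumes f: "\<And>n. in_Lp (f n)" and s: "summable (\<lambda>n. nrm (f n) powr p)"
  shows "AE w in M. (\<lambda>n. f n w) \<longlonglongrightarrow> 0"
proof -
  note [measurable] = in_Lp_measurable[OF f]
  have "(\<integral>\<^sup>+w. (\<Sum>n. ennreal (norm (f n w) powr p)) \<partial>M)
      = (\<Sum>n. \<integral>\<^sup>+w. ennreal (norm (f n w) powr p) \<partial>M)"
    by (rule nn_integral_suminf) simp
  also have "\<dots> = (\<Sum>n. ennreal (nrm (f n) powr p))"
    by (simp add: nrm_powr nn_integral_eq_integral[OF in_Lp_integrable[OF f]])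
  also have "\<dots> \<noteq> \<infinity>"
    using suminf_ennreal_eq[of "\<lambda>n. nrm (f n) powr p"] s by (simp add: suminf_ennreal2)
  finally have "AE w in M. (\<Sum>n. ennreal (norm (f n w) powr p)) \<noteq> \<infinity>"
    by (intro nn_integral_PInf_AE) auto
  then show ?thesis
  proof eventually_elim
    case (elim w)
    then have "summable (\<lambda>n. norm (f n w) powr p)"
      by (intro summable_suminf_not_top) auto
    then have "(\<lambda>n. norm (f n w) powr p) \<longlonglongrightarrow> 0"
      by (rule summable_LIMSEQ_zero)
    then have "(\<lambda>n. (norm (f n w) powr p) powr (1/p)) \<longlonglongrightarrow> 0 powr (1/p)"
      using p_gt_1 by (intro tendsto_powr') auto
    then show ?case
      using p_gt_1 by (simp add: powr_powr tendsto_norm_zero_iff)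
  qed
qed

lemma nrm_tendsto_imp_AE_subseq:
  fixes f :: "nat \<Rightarrow> 'a \<Rightarrow> 'b::real_normed_vector"
  assumes f: "\<And>n. in_Lp (f n)" and s: "(\<lambda>n. nrm (f n)) \<longlonglongrightarrow> 0"
  obtains r where "strict_mono r" "AE w in M. (\<lambda>n. f (r n) w) \<longlonglongrightarrow> 0"
proof -
  have "\<exists>r. strict_mono r \<and> (\<forall>n. nrm (f (r n)) powr p < (1/2)^n)"
  proof -
    have s': "(\<lambda>n. nrm (f n) powr p) \<longlonglongrightarrow> 0"
      using tendsto_powr'[OF s tendsto_const[of p]] p_gt_1 by auto
    have ex: "\<exists>k>m. nrm (f k) powr p < (1/2)^n" for n m
    proof -
      have "eventually (\<lambda>k. nrm (f k) powr p < (1/2)^n) sequentially"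
        using order_tendstoD(2)[OF s'] by simp
      then obtain N where "\<forall>k\<ge>N. nrm (f k) powr p < (1/2)^n"
        unfolding eventually_sequentially by blast
      then show ?thesis
        by (intro exI[of _ "max N (Suc m)"]) auto
    qed
    have "\<exists>r. \<forall>n. nrm (f (r n)) powr p < (1/2)^n \<and> r n < r (Suc n)"
    proof (rule dependent_nat_choice)
      show "\<exists>x. nrm (f x) powr p < (1/2)^0"
        using ex[of 0 0] by blast
      show "\<exists>y. nrm (f y) powr p < (1/2) ^ Suc n \<and> x < y" for x n
        using ex[of x "Suc n"] by blast
    qed
    then show ?thesis
      by (auto simp: strict_mono_Suc_iff)
  qed
  then obtain r where r: "strict_mono r" "\<And>n. nrm (f (r n)) powr p < (1/2)^n"
    by blast
  have "summable (\<lambda>n. nrm (f (r n)) powr p)"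
    by (rule summable_comparison_test'[of "\<lambda>n. (1/2)^n" 0])
      (use r(2) in \<open>auto intro: less_imp_le summable_geometric\<close>)
  then have "AE w in M. (\<lambda>n. f (r n) w) \<longlonglongrightarrow> 0"
    by (rule summable_nrm_powr_imp_AE_tendsto[OF f])
  with r(1) show thesis
    by (rule that)
qed

lemma nrm_tendsto_AE_unique:
  fixes f :: "nat \<Rightarrow> 'a \<Rightarrow> 'b::{second_countable_topology, real_normed_vector}"
  assumes f: "\<And>n. in_Lp (f n)" "in_Lp g"
    and s: "(\<lambda>n. nrm (\<lambda>w. f n w - g w)) \<longlonglongrightarrow> 0"
    and ae: "AE w in M. (\<lambda>n. f n w) \<longlonglongrightarrow> h w"
  shows "AE w in M. h w = g w"
proof -
  obtain r :: "nat \<Rightarrow> nat" where r: "strict_mono r" "AE w in M. (\<lambda>n. f (r n) w - g w) \<longlonglongrightarrow> 0"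
    using nrm_tendsto_imp_AE_subseq[OF in_Lp_diff[OF f] s] by blast
  from r(2) ae show ?thesis
  proof eventually_elim
    case (elim w)
    have "(\<lambda>n. f (r n) w) \<longlonglongrightarrow> g w"
      using elim(1) by (simp add: LIM_zero_iff)
    moreover have "(\<lambda>n. f (r n) w) \<longlonglongrightarrow> h w"
      using LIMSEQ_subseq_LIMSEQ[OF elim(2) r(1)] by (simp add: o_def)
    ultimately show ?case
      by (rule LIMSEQ_unique[symmetric])
  qed
qed

lemma nrm_tendsto_unique:
  fixes f :: "nat \<Rightarrow> 'a \<Rightarrow> 'b::{second_countable_topology, real_normed_vector}"
  assumes f: "\<And>n. in_Lp (f n)" and g: "in_Lp g" and h: "in_Lp h"
    and "(\<lambda>n. nrm (\<lambda>w. f n w - g w)) \<longlonglongrightarrow> 0"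
    and "(\<lambda>n. nrm (\<lambda>w. f n w - h w)) \<longlonglongrightarrow> 0"
  shows "AE w in M. g w = h w"
proof -
  have "nrm (\<lambda>w. g w - h w) \<le> nrm (\<lambda>w. f n w - g w) + nrm (\<lambda>w. f n w - h w)" for n
    using nrm_triangle_diff[OF g f h, of n] by (simp add: nrm_minus_commute[of g])
  then have "nrm (\<lambda>w. g w - h w) \<le> 0"
    using tendsto_add[OF assms(4,5)] by (intro tendsto_lowerbound[of _ 0 sequentially]) auto
  then have "nrm (\<lambda>w. g w - h w) = 0"
    using nrm_nonneg by (rule order_antisym)
  then show ?thesis
    using nrm_eq_0_iff[OF in_Lp_diff[OF g h]] by simp
qed

text \<open>Limits in L^p are always constructed through this lemma: a pointwise limit and one
  common majorant G give convergence in norm, by dominated convergence with majorant (2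
  G)^p.\<close>

lemma dominated_nrm_tendsto:
  fixes f :: "nat \<Rightarrow> 'a \<Rightarrow> 'b::{second_countable_topology, real_normed_vector}" and G :: "'a \<Rightarrow> real"
  assumes f: "\<And>n. f n \<in> borel_measurable M" and g: "g \<in> borel_measurable M" and G: "in_Lp G"
    and dom: "\<And>n. AE w in M. norm (f n w) \<le> G w"
    and ae: "AE w in M. (\<lambda>n. f n w) \<longlonglongrightarrow> g w"
  shows "in_Lp g" "(\<lambda>n. nrm (\<lambda>w. f n w - g w)) \<longlonglongrightarrow> 0"
proof -
  note [measurable] = f g in_Lp_measurable[OF G]
  have all: "AE w in M. \<forall>n. norm (f n w) \<le> G w"
    using dom by (simp add: AE_all_countable)
  have domg: "AE w in M. norm (g w) \<le> G w"
    using all ae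
  proof eventually_elim
    case (elim w)
    then show ?case
      by (intro tendsto_upperbound[OF tendsto_norm[OF elim(2)]]) auto
  qed
  show "in_Lp g"
    by (rule in_Lp_bound(1)[OF g G]) (use domg in eventually_elim, auto)
  have "(\<lambda>n. \<integral>w. norm (f n w - g w) powr p \<partial>M) \<longlonglongrightarrow> (\<integral>w. (0::real) \<partial>M)"
  proof (rule integral_dominated_convergence[where w="\<lambda>w. norm (2 *\<^sub>R G w) powr p"])
    show "integrable M (\<lambda>w. norm (2 *\<^sub>R G w) powr p)"
      by (rule in_Lp_integrable[OF in_Lp_scaleR[OF G]])
    show "AE w in M. (\<lambda>n. norm (f n w - g w) powr p) \<longlonglongrightarrow> 0"
      using ae
    proof eventually_elim
      case (elim w)
      then have "(\<lambda>n. norm (f n w - g w)) \<longlonglongrightarrow> 0"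
        by (simp add: LIM_zero tendsto_norm_zero)
      then have "(\<lambda>n. norm (f n w - g w) powr p) \<longlonglongrightarrow> 0 powr p"
        using p_gt_1 by (intro tendsto_powr') auto
      then show ?case by simp
    qed
    show "AE w in M. norm (norm (f n w - g w) powr p) \<le> norm (2 *\<^sub>R G w) powr p" for n
      using all domg
    proof eventually_elim
      case (elim w)
      have "norm (f n w - g w) \<le> norm (2 *\<^sub>R G w)"
        using norm_triangle_ineq4[of "f n w" "g w"] elim(1)[rule_format, of n] elim(2) by auto
      then show ?case
        using p_gt_1 by (simp add: powr_mono2)
    qed
  qed auto
  then have "(\<lambda>n. (\<integral>w. norm (f n w - g w) powr p \<partial>M) powr (1/p)) \<longlonglongrightarrow> 0 powr (1/p)"
    using p_gt_1 by (intro tendsto_powr') auto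
  then show "(\<lambda>n. nrm (\<lambda>w. f n w - g w)) \<longlonglongrightarrow> 0"
    by (simp add: Lp_norm_def)
qed

lemma monotone_limit_in_Lp:
  fixes G :: "nat \<Rightarrow> 'a \<Rightarrow> real"
  assumes G: "\<And>n. in_Lp (G n)" and nn: "\<And>n w. 0 \<le> G n w"
    and mono: "\<And>n w. G n w \<le> G (Suc n) w" and K: "\<And>n. nrm (G n) \<le> K"
  obtains H where "in_Lp H" "nrm H \<le> K" "\<And>w. 0 \<le> H w" "AE w in M. \<forall>n. G n w \<le> H w"
proof -
  note [measurable] = in_Lp_measurable[OF G]
  have K0: "0 \<le> K"
    using K[of 0] nrm_nonneg[of "G 0"] by linarith
  have inc: "incseq (\<lambda>n. ennreal (G n w powr p))" for w
    by (intro incseq_SucI ennreal_leI powr_mono2) (use nn mono p_gt_1 in auto)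
  have "(\<integral>\<^sup>+w. (SUP n. ennreal (G n w powr p)) \<partial>M) = (SUP n. \<integral>\<^sup>+w. ennreal (G n w powr p) \<partial>M)"
    by (rule nn_integral_monotone_convergence_SUP) (use inc in \<open>auto simp: incseq_def le_fun_def\<close>)
  also have "\<dots> \<le> ennreal (K powr p)"
  proof (rule SUP_least)
    fix n
    have "(\<integral>\<^sup>+w. ennreal (G n w powr p) \<partial>M) = ennreal (nrm (G n) powr p)"
      using nn_integral_eq_integral[OF in_Lp_integrable[OF G[of n]]] nn by (simp add: nrm_powr)
    also have "\<dots> \<le> ennreal (K powr p)"
      using K p_gt_1 by (intro ennreal_leI powr_mono2) auto
    finally show "(\<integral>\<^sup>+w. ennreal (G n w powr p) \<partial>M) \<le> ennreal (K powr p)" .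
  qed
  finally have *: "(\<integral>\<^sup>+w. (SUP n. ennreal (G n w powr p)) \<partial>M) \<le> ennreal (K powr p)" .
  then have fin: "AE w in M. (SUP n. ennreal (G n w powr p)) \<noteq> \<infinity>"
    by (intro nn_integral_PInf_AE) (auto simp: top_unique)
  \<comment> \<open>Where the supremum is infinite, \<open>enn2real\<close> returns 0 and H fails to
    dominate; this happens only on a null set.\<close>
  define H where "H w = enn2real (SUP n. ennreal (G n w powr p)) powr (1/p)" for w
  have H0: "0 \<le> H w" for w
    by (simp add: H_def)
  have Hp: "norm (H w) powr p = enn2real (SUP n. ennreal (G n w powr p))" for w
    using p_gt_1 by (simp add: H_def powr_powr)
  have Hm [measurable]: "H \<in> borel_measurable M"
    unfolding H_def by measurable
  have Hnn: "(\<integral>\<^sup>+w. ennreal (norm (H w) powr p) \<partial>M) \<le> ennreal (K powr p)"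
    by (rule order_trans[OF nn_integral_mono *]) (simp add: Hp[unfolded real_norm_def] ennreal_enn2real_if)
  have int: "integrable M (\<lambda>w. norm (H w) powr p)"
    using Hnn by (intro integrableI_bounded) (auto simp: less_top[symmetric] top_unique)
  show thesis
  proof (rule that)
    show "in_Lp H"
      using int by (simp add: in_Lp_def)
    have "ennreal (\<integral>w. norm (H w) powr p \<partial>M) \<le> ennreal (K powr p)"
      using Hnn nn_integral_eq_integral[OF int] by simp
    then show "nrm H \<le> K"
      using K0 by (subst nrm_le_iff) (auto simp: ennreal_le_iff)
    show "AE w in M. \<forall>n. G n w \<le> H w"
      using fin
    proof (eventually_elim, intro allI)
      fix w n
      assume w: "(SUP n. ennreal (G n w powr p)) \<noteq> \<infinity>"
      have "ennreal (G n w powr p) \<le> (SUP n. ennreal (G n w powr p))"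
        by (rule SUP_upper) simp
      also have "\<dots> = ennreal (norm (H w) powr p)"
        using w unfolding Hp by (subst ennreal_enn2real) (simp_all add: less_top[symmetric] del: SUP_eq_top_iff)
      finally have "G n w powr p \<le> H w powr p"
        using H0[of w] by simp
      then show "G n w \<le> H w"
        using nn[of n w] H0[of w] p_gt_1 by (meson not_le powr_less_mono2 p_pos)
    qed
  qed (rule H0)
qed

end

section \<open>Abel summation, the down norm and the maximal average\<close>

lemma Abel_sum_nonneg:
  fixes c d :: "nat \<Rightarrow> real"
  assumes "\<And>k. k < n \<Longrightarrow> d (Suc k) \<le> d k" "\<And>k. k \<le> n \<Longrightarrow> 0 \<le> d k"
    and "\<And>j. j \<le> n \<Longrightarrow> 0 \<le> (\<Sum>k\<le>j. c k)"
  shows "0 \<le> (\<Sum>k\<le>n. d k * c k)"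
proof -
  \<comment> \<open>The induction needs this stronger form: its step replaces d (Suc n) by the
    larger d n against a nonnegative partial sum.\<close>
  have "d n * (\<Sum>k\<le>n. c k) \<le> (\<Sum>k\<le>n. d k * c k)"
    using assms
  proof (induction n)
    case (Suc n)
    have "d (Suc n) * (\<Sum>k\<le>n. c k) \<le> d n * (\<Sum>k\<le>n. c k)"
      using Suc.prems by (intro mult_right_mono) auto
    also have "\<dots> \<le> (\<Sum>k\<le>n. d k * c k)"
      using Suc.prems by (intro Suc.IH) auto
    finally show ?case
      by (simp add: distrib_left)
  qed simp
  moreover have "0 \<le> d n * (\<Sum>k\<le>n. c k)"
    using assms by simp
  ultimately show ?thesis
    by linarith
qed

definition dec_weights :: "real \<Rightarrow> nat \<Rightarrow> (nat \<Rightarrow> complex) set" where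
  "dec_weights p J = {\<nu>. (\<forall>k<J. cmod (\<nu> (Suc k)) \<le> cmod (\<nu> k)) \<and>
     (\<Sum>k\<le>J. cmod (\<nu> k) powr (p / (p - 1))) \<le> 1}"

text \<open>
  The norm dual to \<open>\<ell>\<^sup>q\<close>, \<open>q = p / (p - 1)\<close>, tested only on weights of decreasing modulus. Complex
  weights are allowed so that they absorb the phases of the sequence.
\<close>

definition down_norm :: "real \<Rightarrow> nat \<Rightarrow> (nat \<Rightarrow> complex) \<Rightarrow> real" where
  "down_norm p J a = (SUP \<nu>\<in>dec_weights p J. cmod (\<Sum>k\<le>J. \<nu> k * a k))"

definition avg_max :: "nat \<Rightarrow> (nat \<Rightarrow> complex) \<Rightarrow> real" where
  "avg_max J a = (MAX n\<in>{..J}. (\<Sum>k\<le>n. cmod (a k)) / real (Suc n))"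

lemma zero_in_dec_weights: "(\<lambda>_. 0) \<in> dec_weights p J"
  by (simp add: dec_weights_def)

lemma dec_weights_le_1:
  assumes "1 < p" "\<nu> \<in> dec_weights p J" "k \<le> J"
  shows "cmod (\<nu> k) \<le> 1"
proof -
  have "cmod (\<nu> k) powr (p / (p - 1)) \<le> (\<Sum>k\<le>J. cmod (\<nu> k) powr (p / (p - 1)))"
    using assms(3) by (intro member_le_sum) auto
  also have "\<dots> \<le> 1 powr (p / (p - 1))"
    using assms(2) by (simp add: dec_weights_def)
  finally show ?thesis
    using assms(1) by (metis divide_pos_pos diff_gt_0_iff_gt less_trans not_le powr_less_mono2 zero_le_one zero_less_one)
qed

lemma down_norm_bound:
  assumes "1 < p" "\<nu> \<in> dec_weights p J"
  shows "cmod (\<Sum>k\<le>J. \<nu> k * a k) \<le> (\<Sum>k\<le>J. cmod (a k))"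
proof -
  have "cmod (\<Sum>k\<le>J. \<nu> k * a k) \<le> (\<Sum>k\<le>J. cmod (\<nu> k) * cmod (a k))"
    by (rule order_trans[OF norm_sum]) (simp add: norm_mult)
  also have "\<dots> \<le> (\<Sum>k\<le>J. 1 * cmod (a k))"
    using dec_weights_le_1[OF assms] by (intro sum_mono mult_right_mono) auto
  finally show ?thesis by simp
qed

lemma bdd_above_down_norm:
  assumes "1 < p" "D \<subseteq> dec_weights p J"
  shows "bdd_above ((\<lambda>\<nu>. cmod (\<Sum>k\<le>J. \<nu> k * a k)) ` D)"
  using down_norm_bound[OF assms(1)] assms(2) by (intro bdd_aboveI2) blast

lemma down_norm_upper:
  "1 < p \<Longrightarrow> \<nu> \<in> dec_weights p J \<Longrightarrow> cmod (\<Sum>k\<le>J. \<nu> k * a k) \<le> down_norm p J a"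
  unfolding down_norm_def by (rule cSUP_upper[OF _ bdd_above_down_norm]) auto

lemma down_norm_nonneg: "1 < p \<Longrightarrow> 0 \<le> down_norm p J a"
  using down_norm_upper[OF _ zero_in_dec_weights] by fastforce

lemma down_norm_le: "1 < p \<Longrightarrow> down_norm p J a \<le> (\<Sum>k\<le>J. cmod (a k))"
  unfolding down_norm_def using zero_in_dec_weights
  by (intro cSUP_least down_norm_bound) auto

text \<open>Countability is what makes the down norm of a sequence of functions measurable and lets
  exceptional null sets be united. In the product topology on sequences every set of weights is
  separable, and each functional is continuous since it involves finitely many coordinates.\<close>

lemma countable_dec_weights:
  assumes p: "1 < p"
  obtains D where "countable D" "D \<noteq> {}" "D \<subseteq> dec_weights p J"
    "\<And>a. down_norm p J a = (SUP \<nu>\<in>D. cmod (\<Sum>k\<le>J. \<nu> k * a k))"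
proof -
  obtain D where D: "countable D" "D \<subseteq> dec_weights p J" "dec_weights p J \<subseteq> closure D"
    using separable[of "dec_weights p J"] by blast
  have ne: "D \<noteq> {}"
    using D(3) zero_in_dec_weights[of p J] by auto
  have "down_norm p J a = (SUP \<nu>\<in>D. cmod (\<Sum>k\<le>J. \<nu> k * a k))" (is "_ = ?s") for a
  proof (rule antisym)
    have "\<forall>\<nu>\<in>closure D. cmod (\<Sum>k\<le>J. \<nu> k * a k) \<le> ?s"
    proof
      fix \<nu> assume \<nu>: "\<nu> \<in> closure D"
      have "continuous_on (closure D) (\<lambda>\<nu>. cmod (\<Sum>k\<le>J. \<nu> k * a k))"
        by (intro continuous_intros continuous_on_subset[OF continuous_on_product_coordinates]) auto
      then show "cmod (\<Sum>k\<le>J. \<nu> k * a k) \<le> ?s"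
        by (rule continuous_le_on_closure[OF _ \<nu>])
          (use bdd_above_down_norm[OF p D(2)] in \<open>auto intro!: cSUP_upper\<close>)
    qed
    then show "down_norm p J a \<le> ?s"
      unfolding down_norm_def using D(3) zero_in_dec_weights[of p J] by (intro cSUP_least) blast+
    show "?s \<le> down_norm p J a"
      using D(2) by (intro cSUP_least ne down_norm_upper p) auto
  qed
  with D ne show thesis
    by (intro that[of D]) auto
qed

text \<open>Hoelder's inequality for a decreasing weight l: normalise l in l^q, attach the conjugate
  phases of a, and use the result as a test weight.\<close>

lemma down_norm_dual:
  assumes p: "1 < p" and dec: "\<And>k. k < J \<Longrightarrow> l (Suc k) \<le> l k" and nn: "\<And>k. k \<le> J \<Longrightarrow> 0 \<le> l k"
  shows "(\<Sum>k\<le>J. l k * cmod (a k))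
    \<le> down_norm p J a * (\<Sum>k\<le>J. l k powr (p / (p - 1))) powr ((p - 1) / p)"
proof (cases "(\<Sum>k\<le>J. l k powr (p / (p - 1))) = 0")
  case True
  then have "\<forall>k\<in>{..J}. l k powr (p / (p - 1)) = 0"
    by (subst (asm) sum_nonneg_eq_0_iff) auto
  then have "\<forall>k\<in>{..J}. l k = 0"
    by simp
  then show ?thesis
    using down_norm_nonneg[OF p, of J a] by simp
next
  case False
  define L where "L = (\<Sum>k\<le>J. l k powr (p / (p - 1)))"
  define r where "r = L powr ((p - 1) / p)"
  have L: "L > 0"
    using False unfolding L_def by (simp add: less_le sum_nonneg)
  then have r: "r > 0"
    by (simp add: r_def)
  have rq: "r powr (p / (p - 1)) = L"
    using p L by (simp add: r_def powr_powr)
  \<comment> \<open>Where a k = 0 the sign of a k is 0, so the first summand vanishes; the second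
    one keeps the modulus of \<nu> k equal to l k / r, and thus the moduli decreasing.\<close>
  define \<nu> where "\<nu> k = complex_of_real (l k / r) * cnj (sgn (a k)) + (if a k = 0 then complex_of_real (l k / r) else 0)" for k
  have cn: "cmod (\<nu> k) = l k / r" if "k \<le> J" for k
    using nn[OF that] r by (auto simp: \<nu>_def norm_mult norm_sgn norm_divide)
  have "\<nu> \<in> dec_weights p J"
  proof -
    have "cmod (\<nu> (Suc k)) \<le> cmod (\<nu> k)" if "k < J" for k
      using that dec[OF that] r by (simp add: cn divide_right_mono)
    moreover have "(\<Sum>k\<le>J. cmod (\<nu> k) powr (p / (p - 1))) = (\<Sum>k\<le>J. l k powr (p / (p - 1)) / L)"
      using nn r by (intro sum.cong) (auto simp: cn powr_divide rq)
    moreover have "\<dots> = 1"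
      using L by (simp add: sum_divide_distrib[symmetric] L_def[symmetric])
    ultimately show ?thesis
      by (simp add: dec_weights_def)
  qed
  then have "cmod (\<Sum>k\<le>J. \<nu> k * a k) \<le> down_norm p J a"
    by (rule down_norm_upper[OF p])
  moreover have "(\<Sum>k\<le>J. \<nu> k * a k) = complex_of_real (\<Sum>k\<le>J. l k / r * cmod (a k))"
    unfolding of_real_sum
  proof (rule sum.cong)
    fix k
    have "cnj (sgn (a k)) * a k = complex_of_real (cmod (a k))"
      by (cases "a k = 0") (simp_all add: sgn_eq mult.commute[of "cnj _"] complex_norm_square[symmetric] power2_eq_square)
    then show "\<nu> k * a k = complex_of_real (l k / r * cmod (a k))"
      by (simp add: \<nu>_def algebra_simps)
  qed simp
  moreover have "0 \<le> (\<Sum>k\<le>J. l k / r * cmod (a k))"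
    using nn r by (intro sum_nonneg) auto
  ultimately have "(\<Sum>k\<le>J. l k / r * cmod (a k)) \<le> down_norm p J a"
    by (simp del: of_real_sum)
  also have "(\<Sum>k\<le>J. l k / r * cmod (a k)) = (\<Sum>k\<le>J. l k * cmod (a k)) / r"
    by (simp add: sum_divide_distrib)
  finally show ?thesis
    using r by (simp add: field_simps r_def L_def)
qed

lemma Youngs_inequality':
  fixes p a b :: real
  assumes "1 < p" "0 \<le> a" "0 \<le> b"
  shows "p * a * b \<le> a powr p + (p - 1) * b powr (p / (p - 1))"
proof -
  have "a * b \<le> a powr p / p + b powr (p / (p - 1)) / (p / (p - 1))"
    using assms by (intro Youngs_inequality) (auto simp: field_simps)
  then have "p * (a * b) \<le> p * (a powr p / p + b powr (p / (p - 1)) / (p / (p - 1)))"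
    using assms by (intro mult_left_mono) auto
  also have "\<dots> = a powr p + (p - 1) * b powr (p / (p - 1))"
    using assms by (simp add: field_simps)
  finally show ?thesis by (simp add: mult.assoc)
qed

lemma avg_max_attained:
  obtains n where "n \<le> J" "(\<Sum>k\<le>n. cmod (a k)) = avg_max J a * real (Suc n)"
proof -
  have "avg_max J a \<in> (\<lambda>n. (\<Sum>k\<le>n. cmod (a k)) / real (Suc n)) ` {..J}"
    unfolding avg_max_def by (intro Max_in) auto
  then obtain n where n: "n \<le> J" "avg_max J a = (\<Sum>k\<le>n. cmod (a k)) / real (Suc n)"
    by auto
  show thesis
    by (rule that[OF n(1)]) (unfold n(2), simp del: of_nat_Suc)
qed

lemma avg_max_upper: "n \<le> J \<Longrightarrow> (\<Sum>k\<le>n. cmod (a k)) \<le> avg_max J a * real (Suc n)"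
proof -
  assume "n \<le> J"
  then have "(\<Sum>k\<le>n. cmod (a k)) / real (Suc n) \<le> avg_max J a"
    unfolding avg_max_def by (intro Max_ge) auto
  then show ?thesis
    by (simp add: field_simps)
qed

lemma avg_max_nonneg: "0 \<le> avg_max J a"
  using order_trans[OF norm_ge_zero[of "a 0"], of "avg_max J a"] avg_max_upper[of 0 J a] by simp

lemma avg_max_mono: "J \<le> J' \<Longrightarrow> avg_max J a \<le> avg_max J' a"
  unfolding avg_max_def by (intro Max_mono) auto

text \<open>
  Any decreasing weight may be replaced by one that is at most \<open>\<mu> = M\<^bsup>p-1\<^esup>\<close> everywhere and equal to
  \<open>\<mu>\<close> up to the index where the maximal average \<open>M\<close> is attained: by Abel summation this
  does not decrease \<open>\<Sum>k. p a\<^sub>k l\<^sub>k - (p-1) l\<^sub>k\<^sup>q\<close>. Splitting off the first term of the new weight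
  bounds the rest by the down norm of the shifted sequence.
\<close>

theorem down_norm_step:
  assumes p: "1 < p"
  shows "(p - 1) * avg_max (Suc J) a powr p + down_norm p (Suc J) a powr p
    \<le> down_norm p J (\<lambda>k. a (Suc k)) powr p + p * cmod (a 0) * avg_max (Suc J) a powr (p - 1)"
proof -
  define M where "M = avg_max (Suc J) a"
  define q where "q = p / (p - 1)"
  define \<mu> where "\<mu> = M powr (p - 1)"
  define \<alpha> where "\<alpha> k = cmod (a k)" for k
  define b where "b = down_norm p J (\<lambda>k. a (Suc k))"
  have M: "0 \<le> M"
    by (simp add: M_def avg_max_nonneg)
  have \<mu>: "0 \<le> \<mu>"
    by (simp add: \<mu>_def)
  have b: "0 \<le> b"
    unfolding b_def by (rule down_norm_nonneg[OF p])
  have \<mu>q: "\<mu> powr q = M powr p"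
    using p by (simp add: \<mu>_def q_def powr_powr)
  have M\<mu>: "M * \<mu> = M powr p"
    using M p powr_add[of M 1 "p - 1"] by (cases "M = 0") (simp_all add: \<mu>_def)
  obtain n where n: "n \<le> Suc J" "(\<Sum>k\<le>n. \<alpha> k) = M * real (Suc n)"
    unfolding M_def \<alpha>_def by (rule avg_max_attained[of "Suc J" a])
  have part: "0 \<le> (\<Sum>k\<le>j. M - \<alpha> k)" if "j \<le> Suc J" for j
    using avg_max_upper[OF that, of a] by (simp add: sum_subtractf M_def \<alpha>_def mult.commute)
  have part_n: "(\<Sum>k\<le>n. M - \<alpha> k) = 0"
    using n by (simp add: sum_subtractf mult.commute)
  \<comment> \<open>The right-hand side does not depend on the test weight, so it is enough to treat
    one weight at a time and take the supremum at the end.\<close>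
  have main: "s powr p \<le> b powr p + p * \<alpha> 0 * \<mu> - (p - 1) * M powr p"
    if \<nu>: "\<nu> \<in> dec_weights p (Suc J)" and s: "s = cmod (\<Sum>k\<le>Suc J. \<nu> k * a k)" for \<nu> s
  proof -
    have s0: "0 \<le> s"
      by (simp add: s)
    \<comment> \<open>With this scaling the sum of \<alpha> k * l k is at least s^p, and the sum of
      l k^q is at most s^p because (p - 1) q = p. The functional \<phi> of l is then at least p s^p
      - (p - 1) s^p = s^p.\<close>
    define l where "l k = s powr (p - 1) * cmod (\<nu> k)" for k
    have l0: "0 \<le> l k" for k
      by (simp add: l_def)
    have ldec: "l (Suc k) \<le> l k" if "k \<le> J" for k
      using \<nu> that unfolding l_def dec_weights_def by (intro mult_left_mono) auto
    define \<phi> where "\<phi> u = (\<Sum>k\<le>Suc J. p * \<alpha> k * u k - (p - 1) * u k powr q)" for u :: "nat \<Rightarrow> real"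
    have sp: "s powr (p - 1) * s = s powr p"
      using s0 p powr_add[of s "p - 1" 1] by (cases "s = 0") simp_all
    have "s powr p \<le> \<phi> l"
    proof -
      have "s \<le> (\<Sum>k\<le>Suc J. cmod (\<nu> k) * \<alpha> k)"
        unfolding s \<alpha>_def by (rule order_trans[OF norm_sum]) (simp add: norm_mult)
      then have "s powr (p - 1) * s \<le> s powr (p - 1) * (\<Sum>k\<le>Suc J. cmod (\<nu> k) * \<alpha> k)"
        by (intro mult_left_mono) auto
      then have 1: "s powr p \<le> (\<Sum>k\<le>Suc J. \<alpha> k * l k)"
        unfolding sp l_def sum_distrib_left by (simp only: mult_ac)
      have "(\<Sum>k\<le>Suc J. l k powr q) = s powr p * (\<Sum>k\<le>Suc J. cmod (\<nu> k) powr q)"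
        unfolding sum_distrib_left using p
        by (intro sum.cong) (simp_all add: l_def powr_mult powr_powr q_def)
      also have "\<dots> \<le> s powr p * 1"
        using \<nu> unfolding dec_weights_def q_def by (intro mult_left_mono) auto
      finally have 2: "(\<Sum>k\<le>Suc J. l k powr q) \<le> s powr p"
        by simp
      have "s powr p = p * s powr p - (p - 1) * s powr p"
        by (simp add: algebra_simps)
      also have "\<dots> \<le> p * (\<Sum>k\<le>Suc J. \<alpha> k * l k) - (p - 1) * (\<Sum>k\<le>Suc J. l k powr q)"
        using p 1 2 by (intro diff_mono mult_left_mono) auto
      also have "\<dots> = \<phi> l"
        by (simp only: \<phi>_def sum_subtractf sum_distrib_left mult.assoc)
      finally show ?thesis .
    qed
    also define l' where "l' k = (if k \<le> n then \<mu> else min (l k) \<mu>)" for k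
    have l'0: "0 \<le> l' k" for k
      using l0 \<mu> by (simp add: l'_def)
    have l'dec: "l' (Suc k) \<le> l' k" if "k \<le> J" for k
      using ldec[OF that] by (auto simp: l'_def)
    have l'00: "l' 0 = \<mu>"
      by (simp add: l'_def)
    have "\<phi> l \<le> \<phi> l'"
    proof -
      \<comment> \<open>Young's inequality: u \<mapsto> p M u - (p - 1) u^q is largest at u = \<mu>,
        with value M^p, and wherever l' differs from l it equals \<mu>. This prices the change of
        weight as if every \<alpha> k were M; the rest is the sum of (l - l') (M -
        \<alpha>).\<close>
      have tan: "p * M * l k - (p - 1) * l k powr q \<le> p * M * l' k - (p - 1) * l' k powr q" for k
      proof (cases "l' k = l k")
        case False
        then have "l' k = \<mu>"
          by (auto simp: l'_def min_def split: if_splits)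
        moreover have "p * M * \<mu> - (p - 1) * \<mu> powr q = M powr p"
          by (simp add: \<mu>q mult.assoc M\<mu> algebra_simps)
        ultimately show ?thesis
          using Youngs_inequality'[OF p M l0[of k]] by (simp add: q_def)
      qed simp
      \<comment> \<open>l - l' is the excess of l over \<mu>, plus min l \<mu> - \<mu> at indices up
        to n. The excess and the minimum both decrease, so Abel summation applies, as all partial
        sums of M - \<alpha> are nonnegative. The constant \<mu> contributes nothing, because the
        sum of M - \<alpha> up to n is zero: n is where the maximal average is attained.\<close>
      have dec1: "0 \<le> (\<Sum>k\<le>Suc J. max (l k - \<mu>) 0 * (M - \<alpha> k))"
      proof (rule Abel_sum_nonneg)
        show "max (l (Suc k) - \<mu>) 0 \<le> max (l k - \<mu>) 0" if "k < Suc J" for k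
          using ldec[of k] that by (intro max.mono) auto
      qed (use part in auto)
      have dec2: "0 \<le> (\<Sum>k\<le>n. min (l k) \<mu> * (M - \<alpha> k))"
      proof (rule Abel_sum_nonneg)
        show "min (l (Suc k)) \<mu> \<le> min (l k) \<mu>" if "k < n" for k
          using ldec[of k] that n(1) by (intro min.mono) auto
      qed (use part n(1) l0 \<mu> in auto)
      have "(\<Sum>k\<le>Suc J. (l k - l' k) * (M - \<alpha> k))
          = (\<Sum>k\<le>Suc J. max (l k - \<mu>) 0 * (M - \<alpha> k)
              + (if k \<le> n then min (l k) \<mu> * (M - \<alpha> k) - \<mu> * (M - \<alpha> k) else 0))"
        by (intro sum.cong) (auto simp: l'_def min_def max_def algebra_simps)
      also have "\<dots> = (\<Sum>k\<le>Suc J. max (l k - \<mu>) 0 * (M - \<alpha> k))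
          + (\<Sum>k\<le>n. min (l k) \<mu> * (M - \<alpha> k) - \<mu> * (M - \<alpha> k))"
      proof -
        have "(\<Sum>k\<le>Suc J. if k \<le> n then min (l k) \<mu> * (M - \<alpha> k) - \<mu> * (M - \<alpha> k) else 0)
            = (\<Sum>k\<le>n. min (l k) \<mu> * (M - \<alpha> k) - \<mu> * (M - \<alpha> k))"
          using n(1) by (intro sum.mono_neutral_cong_right) auto
        then show ?thesis
          by (simp only: sum.distrib)
      qed
      also have "(\<Sum>k\<le>n. min (l k) \<mu> * (M - \<alpha> k) - \<mu> * (M - \<alpha> k)) = (\<Sum>k\<le>n. min (l k) \<mu> * (M - \<alpha> k))"
        using part_n by (simp only: sum_subtractf[where f="\<lambda>k. min (l k) \<mu> * (M - \<alpha> k)"] sum_distrib_left[symmetric] mult_zero_right diff_zero)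
      finally have 1: "0 \<le> (\<Sum>k\<le>Suc J. (l k - l' k) * (M - \<alpha> k))"
        using dec1 dec2 by linarith
      have "\<phi> l \<le> (\<Sum>k\<le>Suc J. (p * \<alpha> k * l' k - (p - 1) * l' k powr q) - p * ((l k - l' k) * (M - \<alpha> k)))"
        unfolding \<phi>_def
      proof (rule sum_mono)
        fix k
        show "p * \<alpha> k * l k - (p - 1) * l k powr q
            \<le> (p * \<alpha> k * l' k - (p - 1) * l' k powr q) - p * ((l k - l' k) * (M - \<alpha> k))"
          using tan[of k] by (simp add: algebra_simps)
      qed
      also have "\<dots> = \<phi> l' - p * (\<Sum>k\<le>Suc J. (l k - l' k) * (M - \<alpha> k))"
        by (simp only: \<phi>_def sum_subtractf sum_distrib_left)
      also have "\<dots> \<le> \<phi> l'"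
        using 1 p by simp
      finally show ?thesis .
    qed
    also have "\<phi> l' = p * \<alpha> 0 * \<mu> - (p - 1) * M powr p
        + (p * (\<Sum>k\<le>J. l' (Suc k) * \<alpha> (Suc k)) - (p - 1) * (\<Sum>k\<le>J. l' (Suc k) powr q))"
      unfolding \<phi>_def sum.atMost_Suc_shift l'00 \<mu>q
      by (simp only: sum_subtractf sum_distrib_left mult_ac)
    \<comment> \<open>On the tail, duality bounds the linear part by p b L^(1/q), and Young's
      inequality splits this into b^p + (p - 1) L, whose second term cancels.\<close>
    also have "p * (\<Sum>k\<le>J. l' (Suc k) * \<alpha> (Suc k)) - (p - 1) * (\<Sum>k\<le>J. l' (Suc k) powr q) \<le> b powr p"
    proof -
      define L where "L = (\<Sum>k\<le>J. l' (Suc k) powr q)"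
      have L: "0 \<le> L"
        by (simp add: L_def sum_nonneg)
      have "(\<Sum>k\<le>J. l' (Suc k) * \<alpha> (Suc k)) \<le> b * L powr ((p - 1) / p)"
        unfolding b_def L_def \<alpha>_def q_def
        by (intro down_norm_dual p) (auto intro: l'dec l'0)
      then have "p * (\<Sum>k\<le>J. l' (Suc k) * \<alpha> (Suc k)) \<le> p * b * L powr ((p - 1) / p)"
        using p by (simp add: mult.assoc)
      also have "\<dots> \<le> b powr p + (p - 1) * (L powr ((p - 1) / p)) powr (p / (p - 1))"
        using p b by (intro Youngs_inequality') auto
      also have "(L powr ((p - 1) / p)) powr (p / (p - 1)) = L"
        using L p by (simp add: powr_powr)
      finally show ?thesis
        by (simp add: L_def)
    qed
    finally show ?thesis
      by linarith
  qed
  define R where "R = b powr p + p * \<alpha> 0 * \<mu> - (p - 1) * M powr p"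
  \<comment> \<open>The zero weight is admissible and gives the nonnegativity that makes the p-th
    root of R meaningful.\<close>
  have R: "0 \<le> R"
    using main[OF zero_in_dec_weights refl] by (simp add: R_def)
  have "down_norm p (Suc J) a \<le> R powr (1 / p)"
    unfolding down_norm_def
  proof (rule cSUP_least)
    fix \<nu> assume "\<nu> \<in> dec_weights p (Suc J)"
    from main[OF this refl] have "(cmod (\<Sum>k\<le>Suc J. \<nu> k * a k) powr p) powr (1/p) \<le> R powr (1/p)"
      unfolding R_def[symmetric] using p by (intro powr_mono2) auto
    then show "cmod (\<Sum>k\<le>Suc J. \<nu> k * a k) \<le> R powr (1 / p)"
      using p by (simp add: powr_powr del: sum.atMost_Suc)
  qed (use zero_in_dec_weights in blast)
  then have "down_norm p (Suc J) a powr p \<le> (R powr (1 / p)) powr p"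
    using p down_norm_nonneg[OF p] by (intro powr_mono2) auto
  also have "\<dots> = R"
    using p R by (simp add: powr_powr)
  finally show ?thesis
    by (simp add: R_def M_def \<mu>_def \<alpha>_def b_def)
qed

section \<open>Maximal inequalities as domination by one function\<close>

context Lp_space
begin

text \<open>The supremum over I is never formed: a majorant makes sense for every index set. The
  exceptional null set may depend on i, so the bound holds simultaneously in i only along countable
  index sets.\<close>

definition maximal_bound :: "'i set \<Rightarrow> ('i \<Rightarrow> 'a \<Rightarrow> complex) \<Rightarrow> real \<Rightarrow> bool" where
  "maximal_bound I u K \<longleftrightarrow>
     (\<exists>G :: 'a \<Rightarrow> real. in_Lp G \<and> nrm G \<le> K \<and> (\<forall>i\<in>I. AE w in M. cmod (u i w) \<le> G w))"

lemma maximal_boundI: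
  "in_Lp G \<Longrightarrow> nrm G \<le> K \<Longrightarrow> (\<And>i. i \<in> I \<Longrightarrow> AE w in M. cmod (u i w) \<le> G w) \<Longrightarrow> maximal_bound I u K"
  for G :: "'a \<Rightarrow> real"
  by (auto simp: maximal_bound_def)

lemma maximal_boundE:
  assumes "maximal_bound I u K"
  obtains G :: "'a \<Rightarrow> real" where "in_Lp G" "nrm G \<le> K" "\<And>i. i \<in> I \<Longrightarrow> AE w in M. cmod (u i w) \<le> G w"
  using assms by (auto simp: maximal_bound_def)

lemma maximal_bound_subset: "maximal_bound I u K \<Longrightarrow> J \<subseteq> I \<Longrightarrow> maximal_bound J u K"
  by (auto simp: maximal_bound_def)

lemma maximal_bound_mono: "maximal_bound I u K \<Longrightarrow> K \<le> L \<Longrightarrow> maximal_bound I u L"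
  by (force simp: maximal_bound_def)

lemma maximal_bound_nonneg: "maximal_bound I u K \<Longrightarrow> 0 \<le> K"
  unfolding maximal_bound_def using nrm_nonneg order_trans by blast

lemma maximal_bound_dominated:
  assumes "maximal_bound I u K" and "\<And>i. i \<in> I \<Longrightarrow> AE w in M. cmod (v i w) \<le> cmod (u i w)"
  shows "maximal_bound I v K"
proof -
  obtain G :: "'a \<Rightarrow> real" where G: "in_Lp G" "nrm G \<le> K" "\<And>i. i \<in> I \<Longrightarrow> AE w in M. cmod (u i w) \<le> G w"
    using maximal_boundE[OF assms(1)] by blast
  show ?thesis
  proof (rule maximal_boundI[OF G(1,2)])
    fix i assume "i \<in> I"
    from G(3)[OF this] assms(2)[OF this] show "AE w in M. cmod (v i w) \<le> G w"
      by eventually_elim auto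
  qed
qed

lemma maximal_bound_add:
  assumes "maximal_bound I u K" "maximal_bound I v L"
  shows "maximal_bound I (\<lambda>i w. u i w + v i w) (K + L)"
proof -
  obtain G where G: "in_Lp (G :: 'a \<Rightarrow> real)" "nrm G \<le> K" "\<And>i. i \<in> I \<Longrightarrow> AE w in M. cmod (u i w) \<le> G w"
    using maximal_boundE[OF assms(1)] by blast
  obtain G' where G': "in_Lp (G' :: 'a \<Rightarrow> real)" "nrm G' \<le> L" "\<And>i. i \<in> I \<Longrightarrow> AE w in M. cmod (v i w) \<le> G' w"
    using maximal_boundE[OF assms(2)] by blast
  show ?thesis
  proof (rule maximal_boundI[OF in_Lp_add[OF G(1) G'(1)]])
    show "nrm (\<lambda>w. G w + G' w) \<le> K + L"
      using nrm_triangle[OF G(1) G'(1)] G(2) G'(2) by linarith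
    fix i assume "i \<in> I"
    from G(3)[OF this] G'(3)[OF this] show "AE w in M. cmod (u i w + v i w) \<le> G w + G' w"
      by eventually_elim (meson norm_triangle_mono)
  qed
qed

lemma maximal_bound_const: "in_Lp f \<Longrightarrow> maximal_bound I (\<lambda>_. f) (nrm f)"
  by (rule maximal_boundI[OF in_Lp_norm[of f]]) auto

lemma maximal_bound_sum:
  assumes "finite I" "\<And>i. i \<in> I \<Longrightarrow> in_Lp (u i)"
  shows "maximal_bound I u (\<Sum>i\<in>I. nrm (u i))"
proof (rule maximal_boundI)
  show "in_Lp (\<lambda>w. \<Sum>i\<in>I. cmod (u i w))"
    using assms by (intro in_Lp_sum in_Lp_norm) auto
  show "nrm (\<lambda>w. \<Sum>i\<in>I. cmod (u i w)) \<le> (\<Sum>i\<in>I. nrm (u i))"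
    using nrm_sum[of I "\<lambda>i w. cmod (u i w)", OF in_Lp_norm] assms(2) by simp
  show "AE w in M. cmod (u i w) \<le> (\<Sum>i\<in>I. cmod (u i w))" if "i \<in> I" for i
    using that assms(1) by (intro AE_I2 member_le_sum) auto
qed

lemma in_Lp_Max:
  fixes u :: "'i \<Rightarrow> 'a \<Rightarrow> complex"
  assumes "finite I" "I \<noteq> {}" "\<And>i. i \<in> I \<Longrightarrow> in_Lp (u i)"
  shows "in_Lp (\<lambda>w. MAX i\<in>I. cmod (u i w))"
proof (rule in_Lp_bound(1))
  show "(\<lambda>w. MAX i\<in>I. cmod (u i w)) \<in> borel_measurable M"
    using assms in_Lp_measurable[OF assms(3)] by (intro borel_measurable_Max) auto
  show "in_Lp (\<lambda>w. \<Sum>i\<in>I. cmod (u i w))"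
    using assms by (intro in_Lp_sum in_Lp_norm) auto
  have "(MAX i\<in>I. cmod (u i w)) \<le> (\<Sum>i\<in>I. cmod (u i w))" for w
    using assms by (intro Max.boundedI) (auto intro: member_le_sum)
  moreover have "0 \<le> (MAX i\<in>I. cmod (u i w))" for w
    using assms(1,2) by (auto simp: Max_ge_iff)
  ultimately show "AE w in M. norm (MAX i\<in>I. cmod (u i w)) \<le> norm (\<Sum>i\<in>I. cmod (u i w))"
    by (intro AE_I2) (simp add: sum_nonneg)
qed

lemma maximal_bound_finite_iff:
  assumes "finite I" "I \<noteq> {}" "\<And>i. i \<in> I \<Longrightarrow> in_Lp (u i)"
  shows "maximal_bound I u K \<longleftrightarrow> nrm (\<lambda>w. MAX i\<in>I. cmod (u i w)) \<le> K"
proof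
  assume "maximal_bound I u K"
  then obtain G where G: "in_Lp (G :: 'a \<Rightarrow> real)" "nrm G \<le> K" "\<And>i. i \<in> I \<Longrightarrow> AE w in M. cmod (u i w) \<le> G w"
    using maximal_boundE by blast
  have "AE w in M. \<forall>i\<in>I. cmod (u i w) \<le> G w"
    using G(3) assms(1) by (intro AE_all_countable_set) (auto intro: countable_finite)
  then have "AE w in M. norm (MAX i\<in>I. cmod (u i w)) \<le> norm (G w)"
  proof eventually_elim
    case (elim w)
    have "(MAX i\<in>I. cmod (u i w)) \<le> G w"
      using assms(1,2) elim by (intro Max.boundedI) auto
    moreover have "0 \<le> (MAX i\<in>I. cmod (u i w))"
      using assms(1,2) by (auto simp: Max_ge_iff)
    ultimately show ?case by simp
  qed
  then have "nrm (\<lambda>w. MAX i\<in>I. cmod (u i w)) \<le> nrm G"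
    by (intro in_Lp_bound(2) G(1) in_Lp_measurable[OF in_Lp_Max] assms)
  then show "nrm (\<lambda>w. MAX i\<in>I. cmod (u i w)) \<le> K"
    using G(2) by linarith
next
  assume "nrm (\<lambda>w. MAX i\<in>I. cmod (u i w)) \<le> K"
  then show "maximal_bound I u K"
    using assms(1) in_Lp_Max[OF assms]
    by (intro maximal_boundI[where G="\<lambda>w. MAX i\<in>I. cmod (u i w)"]) auto
qed

text \<open>The maxima over initial segments of an enumeration increase and have norms at most K, so
  monotone convergence yields a majorant with the same constant.\<close>

lemma maximal_bound_countable:
  assumes I: "countable I" and u: "\<And>i. i \<in> I \<Longrightarrow> in_Lp (u i)" and K: "0 \<le> K"
    and fin: "\<And>F. finite F \<Longrightarrow> F \<subseteq> I \<Longrightarrow> F \<noteq> {} \<Longrightarrow> maximal_bound F u K"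
  shows "maximal_bound I u K"
proof (cases "I = {}")
  case True
  then show ?thesis
    using K by (intro maximal_boundI[OF in_Lp_zero]) auto
next
  case False
  define e where "e = from_nat_into I"
  have e: "e k \<in> I" for k
    using False by (simp add: e_def from_nat_into)
  define G where "G n w = (MAX k\<in>{..n}. cmod (u (e k) w))" for n :: nat and w
  have GL: "in_Lp (G n)" for n
    unfolding G_def by (rule in_Lp_Max) (use e u in auto)
  have Gn: "nrm (G n) \<le> K" for n
  proof -
    have "nrm (\<lambda>w. MAX i\<in>e ` {..n}. cmod (u i w)) \<le> K"
      using fin[of "e ` {..n}"] e u by (subst maximal_bound_finite_iff[symmetric]) auto
    then show ?thesis
      unfolding G_def by (simp add: image_image)
  qed
  obtain H where H: "in_Lp H" "nrm H \<le> K" "\<And>w. 0 \<le> H w" "AE w in M. \<forall>n. G n w \<le> H w"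
  proof (rule monotone_limit_in_Lp[OF GL _ _ Gn])
    show "0 \<le> G n w" for n w
      by (auto simp: G_def Max_ge_iff)
    show "G n w \<le> G (Suc n) w" for n w
      unfolding G_def by (intro Max_mono) auto
  qed (rule that)
  show ?thesis
  proof (rule maximal_boundI[OF H(1,2)])
    fix i assume i: "i \<in> I"
    then obtain k where k: "i = e k"
      using from_nat_into_surj[OF I] e_def by metis
    have le: "cmod (u i w) \<le> G k w" for w
      unfolding G_def k by (intro Max_ge) auto
    show "AE w in M. cmod (u i w) \<le> H w"
      using H(4) by eventually_elim (use le in \<open>meson order_trans\<close>)
  qed
qed

text \<open>Maximal inequalities survive limits in norm. On a finite set F the supremum of the
  errors has norm at most the sum of their norms, and each error is made smaller than e / card F.
  The approximants v may depend on F and e as long as K does not.\<close>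

lemma maximal_bound_limit:
  assumes I: "countable I" and u: "\<And>i. i \<in> I \<Longrightarrow> in_Lp (u i)" and K: "0 \<le> K"
    and appr: "\<And>F e. finite F \<Longrightarrow> F \<subseteq> I \<Longrightarrow> F \<noteq> {} \<Longrightarrow> 0 < e \<Longrightarrow>
      \<exists>v. (\<forall>i\<in>F. in_Lp (v i)) \<and> (\<forall>i\<in>F. nrm (\<lambda>w. u i w - v i w) < e) \<and> maximal_bound F v K"
  shows "maximal_bound I u K"
proof (rule maximal_bound_countable[OF I u K])
  fix F assume F: "finite F" "F \<subseteq> I" "F \<noteq> {}"
  have uF: "\<And>i. i \<in> F \<Longrightarrow> in_Lp (u i)"
    using F(2) u by auto
  have "nrm (\<lambda>w. MAX i\<in>F. cmod (u i w)) \<le> K + e" if e: "0 < e" for e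
  proof -
    define e' where "e' = e / card F"
    have "0 < e'"
      using e F by (simp add: e'_def card_gt_0_iff)
    then obtain v where v: "\<forall>i\<in>F. in_Lp (v i)" "\<forall>i\<in>F. nrm (\<lambda>w. u i w - v i w) < e'" "maximal_bound F v K"
      using appr[OF F] by blast
    have "maximal_bound F (\<lambda>i w. u i w - v i w) (\<Sum>i\<in>F. nrm (\<lambda>w. u i w - v i w))"
      using F(1) uF v(1) by (intro maximal_bound_sum in_Lp_diff) auto
    then have "maximal_bound F (\<lambda>i w. v i w + (u i w - v i w)) (K + (\<Sum>i\<in>F. nrm (\<lambda>w. u i w - v i w)))"
      by (rule maximal_bound_add[OF v(3)])
    moreover have "(\<Sum>i\<in>F. nrm (\<lambda>w. u i w - v i w)) \<le> (\<Sum>i\<in>F. e')"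
      using v(2) by (intro sum_mono) (auto intro: less_imp_le)
    moreover have "(\<Sum>i\<in>F. e') = e"
      using F by (simp add: e'_def)
    ultimately have "maximal_bound F u (K + e)"
      by (auto elim: maximal_bound_mono)
    then show ?thesis
      using maximal_bound_finite_iff[OF F(1,3) uF] by simp
  qed
  then have "nrm (\<lambda>w. MAX i\<in>F. cmod (u i w)) \<le> K"
    by (rule field_le_epsilon)
  then show "maximal_bound F u K"
    using maximal_bound_finite_iff[OF F(1,3) uF] by simp
qed

end

section \<open>Contractively regular operators\<close>

locale regular_contraction = Lp_space +
  fixes S :: "('a \<Rightarrow> complex) \<Rightarrow> 'a \<Rightarrow> complex"
  assumes bounded_linear: "Lp_bounded_linear M p S"
    and regular: "regular_bound M p S 1"
begin

lemma S_in: "in_Lp f \<Longrightarrow> in_Lp (S f)"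
  using bounded_linear by (simp add: Lp_bounded_linear_def in_Lp_iff)

lemma S_cong: "in_Lp f \<Longrightarrow> in_Lp g \<Longrightarrow> AE w in M. f w = g w \<Longrightarrow> AE w in M. S f w = S g w"
  using bounded_linear by (simp add: Lp_bounded_linear_def in_Lp_iff)

lemma S_add: "in_Lp f \<Longrightarrow> in_Lp g \<Longrightarrow> AE w in M. S (\<lambda>w. f w + g w) w = S f w + S g w"
  using bounded_linear by (simp add: Lp_bounded_linear_def in_Lp_iff)

lemma S_mult: "in_Lp f \<Longrightarrow> AE w in M. S (\<lambda>w. c * f w) w = c * S f w"
  using bounded_linear by (simp add: Lp_bounded_linear_def in_Lp_iff)

lemma S_scaleR: "in_Lp f \<Longrightarrow> AE w in M. S (\<lambda>w. r *\<^sub>R f w) w = r *\<^sub>R S f w"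
  using S_mult[of f "complex_of_real r"] by (simp add: scaleR_conv_of_real)

lemma S_diff:
  assumes f: "in_Lp f" and g: "in_Lp g"
  shows "AE w in M. S (\<lambda>w. f w - g w) w = S f w - S g w"
  using S_add[OF f in_Lp_mult[OF g, of "-1"]] S_mult[OF g, of "-1"] by eventually_elim simp

lemma S_zero: "AE w in M. S (\<lambda>_. 0) w = 0"
  using S_mult[OF in_Lp_zero, of 0] by simp

lemma S_sum:
  assumes "\<And>i. i \<in> I \<Longrightarrow> in_Lp (f i)"
  shows "AE w in M. S (\<lambda>w. \<Sum>i\<in>I. f i w) w = (\<Sum>i\<in>I. S (f i) w)"
  using assms
proof (induction I rule: infinite_finite_induct)
  case (insert i F)
  have "AE w in M. S (\<lambda>w. f i w + (\<Sum>i\<in>F. f i w)) w = S (f i) w + S (\<lambda>w. \<Sum>i\<in>F. f i w) w"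
    using insert by (intro S_add in_Lp_sum) auto
  moreover have "AE w in M. S (\<lambda>w. \<Sum>i\<in>F. f i w) w = (\<Sum>i\<in>F. S (f i) w)"
    using insert by auto
  ultimately show ?case
    by eventually_elim (use insert in auto)
qed (use S_zero in auto)

lemma S_nrm:
  assumes "in_Lp f"
  shows "nrm (S f) \<le> nrm f"
proof -
  have "\<forall>(n::nat) x. (\<forall>k\<le>n. x k \<in> Lp M p) \<longrightarrow>
        nrm (\<lambda>w. MAX k\<in>{..n}. cmod (S (x k) w)) \<le> 1 * nrm (\<lambda>w. MAX k\<in>{..n}. cmod (x k w))"
    using regular unfolding regular_bound_def by blast
  from this[THEN spec, of "0::nat", THEN spec, of "\<lambda>_. f"] assms show ?thesis
    by (simp add: in_Lp_iff)
qed

lemma S_nrm_diff: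
  assumes "in_Lp f" "in_Lp g"
  shows "nrm (\<lambda>w. S f w - S g w) \<le> nrm (\<lambda>w. f w - g w)"
proof -
  have "nrm (\<lambda>w. S f w - S g w) = nrm (S (\<lambda>w. f w - g w))"
    using S_diff[OF assms] assms
    by (intro nrm_cong in_Lp_measurable in_Lp_diff S_in) auto
  also have "\<dots> \<le> nrm (\<lambda>w. f w - g w)"
    by (intro S_nrm in_Lp_diff assms)
  finally show ?thesis .
qed

text \<open>The defining inequality of regularity, extended from finite sequences to countable
  families and put in terms of majorants.\<close>

lemma maximal_bound_S:
  assumes I: "countable I" and u: "\<And>i. i \<in> I \<Longrightarrow> in_Lp (u i)" and b: "maximal_bound I u K"
  shows "maximal_bound I (\<lambda>i. S (u i)) K"
proof (rule maximal_bound_countable[OF I S_in[OF u] maximal_bound_nonneg[OF b]])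
  fix F assume F: "finite F" "F \<subseteq> I" "F \<noteq> {}"
  define e where "e = from_nat_into F"
  \<comment> \<open>The range {..n} has one index more than F has elements;
    \<open>from_nat_into\<close> returns an element of F there as well, so the image is still
    F.\<close>
  define n where "n = card F"
  have e: "e k \<in> F" for k
    using F(3) by (simp add: e_def from_nat_into)
  have eF: "e ` {..n} = F"
  proof -
    have "e ` {..<card F} = F"
      unfolding e_def using bij_betw_from_nat_into_finite[OF F(1)] by (simp add: bij_betw_def)
    moreover have "e ` {..<card F} \<subseteq> e ` {..n}"
      unfolding n_def by (intro image_mono) auto
    ultimately show ?thesis
      using e by auto
  qed
  have Max_eq: "(MAX i\<in>F. g i) = (MAX k\<in>{..n}. g (e k))" for g :: "_ \<Rightarrow> real"
    by (simp flip: eF add: image_image)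
  have uF: "\<And>i. i \<in> F \<Longrightarrow> in_Lp (u i)"
    using F(2) u by auto
  have "nrm (\<lambda>w. MAX k\<in>{..n}. cmod (S (u (e k)) w)) \<le> nrm (\<lambda>w. MAX k\<in>{..n}. cmod (u (e k) w))"
    using regular uF[OF e] unfolding regular_bound_def in_Lp_iff by auto
  also have "\<dots> \<le> K"
    using maximal_bound_finite_iff[OF F(1,3) uF] maximal_bound_subset[OF b F(2)] by (simp add: Max_eq)
  finally show "maximal_bound F (\<lambda>i. S (u i)) K"
    using F uF by (subst maximal_bound_finite_iff) (auto simp: Max_eq intro: S_in)
qed

end

text \<open>The infimum defining the regular norm is attained in the sense needed: for fixed x the
  inequality holds with constants arbitrarily close to 1, hence with 1.\<close>

lemma (in Lp_space) contractively_regular_imp_regular_contraction: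
  assumes "contractively_regular M p S"
  shows "regular_contraction M p S"
proof
  show "Lp_bounded_linear M p S"
    using assms by (simp add: contractively_regular_def regular_operator_def)
  obtain C0 where C0: "regular_bound M p S C0"
    using assms by (auto simp: contractively_regular_def regular_operator_def)
  have C: "\<exists>C<1 + e. regular_bound M p S C" if "0 < e" for e
  proof -
    have "Inf {C. regular_bound M p S C} < 1 + e"
      using assms that by (simp add: contractively_regular_def regular_norm_def)
    then show ?thesis
      using C0 cInf_lessD[of "{C. regular_bound M p S C}" "1 + e"] by auto
  qed
  show "regular_bound M p S 1"
    unfolding regular_bound_def
  proof (intro conjI allI impI)
    fix n and x :: "nat \<Rightarrow> 'a \<Rightarrow> complex"
    assume x: "\<forall>k\<le>n. x k \<in> Lp M p"
    let ?l = "nrm (\<lambda>w. MAX k\<in>{..n}. cmod (S (x k) w))" and ?r = "nrm (\<lambda>w. MAX k\<in>{..n}. cmod (x k w))"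
    have "?l \<le> ?r + e" if "0 < e" for e
    proof -
      \<comment> \<open>Dividing by ?r + 1 instead of ?r keeps the quotient meaningful when ?r = 0
        and still makes the excess at most e.\<close>
      have "0 < e / (?r + 1)"
        using that nrm_nonneg[of "\<lambda>w. MAX k\<in>{..n}. cmod (x k w)"] by (intro divide_pos_pos) linarith+
      then obtain C where C': "C < 1 + e / (?r + 1)" "regular_bound M p S C"
        using C by blast
      have "?l \<le> C * ?r"
        using C'(2) x unfolding regular_bound_def by blast
      also have "\<dots> \<le> (1 + e / (?r + 1)) * ?r"
        using C'(1) by (intro mult_right_mono) auto
      also have "\<dots> = ?r + e * (?r / (?r + 1))"
        by (simp add: algebra_simps)
      also have "\<dots> \<le> ?r + e * 1"
      proof -
        have "?r / (?r + 1) \<le> 1"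
          using nrm_nonneg[of "\<lambda>w. MAX k\<in>{..n}. cmod (x k w)"] by (subst divide_le_eq_1_pos) linarith+
        then show ?thesis
          using that by (intro add_left_mono mult_left_mono) auto
      qed
      finally show ?thesis by simp
    qed
    then show "?l \<le> 1 * ?r"
      using field_le_epsilon[of ?l ?r] by simp
  qed simp
qed

section \<open>The maximal inequality for discrete averages\<close>

context Lp_space
begin

text \<open>With C = p (2p/(p-1))^(p-1) from \<open>absorb_first_term\<close>, the factor 2/(p-1)
  inverts the half of (p-1) M^p that is left after absorption. The factor 1 + 2C comes from
  telescoping over 2J steps and averaging over the last J of them.\<close>

definition max_const :: real where
  "max_const = (2 * (1 + 2 * (p * (2 * p / (p - 1)) powr (p - 1))) / (p - 1)) powr (1 / p)"

lemma max_const_nonneg: "0 \<le> max_const"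
  by (simp add: max_const_def)

text \<open>The mixed term of \<open>down_norm_step\<close> may cost at most half of (p - 1) m^p.
  The ratio r = 2p/(p-1) is chosen so that this is immediate when r a \<le> m; otherwise m is
  replaced by r a and only a power of a remains.\<close>

lemma absorb_first_term:
  fixes a m :: real
  assumes "0 \<le> a" "0 \<le> m"
  shows "p * a * m powr (p - 1)
    \<le> (p - 1) / 2 * m powr p + p * (2 * p / (p - 1)) powr (p - 1) * a powr p"
proof -
  define r where "r = 2 * p / (p - 1)"
  have r: "0 < r" "p = (p - 1) / 2 * r"
    using p_gt_1 by (auto simp: r_def)
  have pp: "y * y powr (p - 1) = y powr p" if "0 \<le> y" for y :: real
    using that p_gt_1 powr_add[of y 1 "p - 1"] by (cases "y = 0") auto
  show ?thesis
  proof (cases "r * a \<le> m")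
    case True
    have "p * a * m powr (p - 1) = (p - 1) / 2 * (r * a) * m powr (p - 1)"
      using r(2) by (metis mult.assoc)
    also have "\<dots> \<le> (p - 1) / 2 * m * m powr (p - 1)"
      using True p_gt_1 by (intro mult_right_mono mult_left_mono) auto
    also have "\<dots> = (p - 1) / 2 * m powr p"
      using pp[OF assms(2)] by (simp add: mult.assoc)
    finally show ?thesis
      using p_gt_1 by (smt (verit) mult_nonneg_nonneg powr_ge_zero)
  next
    case False
    then have "p * a * m powr (p - 1) \<le> p * a * (r * a) powr (p - 1)"
      using p_gt_1 assms by (intro mult_left_mono powr_mono2) auto
    also have "\<dots> = p * r powr (p - 1) * (a * a powr (p - 1))"
      using r assms by (subst powr_mult) auto
    also have "\<dots> = p * r powr (p - 1) * a powr p"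
      using pp[OF assms(1)] by simp
    finally show ?thesis
      using p_gt_1 by (smt (verit) r_def mult_nonneg_nonneg powr_ge_zero divide_nonneg_nonneg)
  qed
qed

lemma in_Lp_down_norm:
  assumes a: "\<And>k. in_Lp (a k)"
  shows "in_Lp (\<lambda>w. down_norm p J (\<lambda>k. a k w))"
proof (rule in_Lp_bound(1))
  note [measurable] = in_Lp_measurable[OF a]
  obtain D where D: "countable D" "D \<noteq> {}" "D \<subseteq> dec_weights p J"
    "\<And>a. down_norm p J a = (SUP \<nu>\<in>D. cmod (\<Sum>k\<le>J. \<nu> k * a k))"
    by (rule countable_dec_weights[OF p_gt_1, of J]) (rule that)
  show "(\<lambda>w. down_norm p J (\<lambda>k. a k w)) \<in> borel_measurable M"
    unfolding D(4)
  proof (rule borel_measurable_cSUP[OF D(1)])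
    show "bdd_above ((\<lambda>\<nu>. cmod (\<Sum>k\<le>J. \<nu> k * a k w)) ` D)" for w
      by (rule bdd_above_down_norm[OF p_gt_1 D(3)])
  qed measurable
  show "in_Lp (\<lambda>w. \<Sum>k\<le>J. cmod (a k w))"
    using a by (intro in_Lp_sum in_Lp_norm)
  show "AE w in M. norm (down_norm p J (\<lambda>k. a k w)) \<le> norm (\<Sum>k\<le>J. cmod (a k w))"
    using down_norm_nonneg[OF p_gt_1] down_norm_le[OF p_gt_1] by (intro AE_I2) (simp add: sum_nonneg)
qed

end

context regular_contraction
begin

lemma S_pow_in: "in_Lp f \<Longrightarrow> in_Lp ((S ^^ k) f)"
  by (induction k) (auto intro: S_in)

text \<open>The combinations of the a k with weights from a countable dense set are all dominated by
  the down norm, so their images under S have a majorant of no larger norm. Linearity identifies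
  these images off one common null set.\<close>

lemma nrm_down_norm_S:
  assumes a: "\<And>k. in_Lp (a k)"
  shows "nrm (\<lambda>w. down_norm p J (\<lambda>k. S (a k) w)) \<le> nrm (\<lambda>w. down_norm p J (\<lambda>k. a k w))"
proof -
  obtain D where D: "countable D" "D \<noteq> {}" "D \<subseteq> dec_weights p J"
    "\<And>a. down_norm p J a = (SUP \<nu>\<in>D. cmod (\<Sum>k\<le>J. \<nu> k * a k))"
    by (rule countable_dec_weights[OF p_gt_1, of J]) (rule that)
  define u where "u \<nu> w = (\<Sum>k\<le>J. \<nu> k * a k w)" for \<nu> :: "nat \<Rightarrow> complex" and w
  have u: "in_Lp (u \<nu>)" for \<nu>
    unfolding u_def using a by (intro in_Lp_sum in_Lp_mult)
  have "maximal_bound D u (nrm (\<lambda>w. down_norm p J (\<lambda>k. a k w)))"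
  proof (rule maximal_boundI[OF in_Lp_down_norm[OF a] order_refl])
    show "AE w in M. cmod (u \<nu> w) \<le> down_norm p J (\<lambda>k. a k w)" if "\<nu> \<in> D" for \<nu>
      unfolding u_def using that D(3) by (intro AE_I2 down_norm_upper p_gt_1) auto
  qed
  then have "maximal_bound D (\<lambda>\<nu>. S (u \<nu>)) (nrm (\<lambda>w. down_norm p J (\<lambda>k. a k w)))"
    by (intro maximal_bound_S D(1) u)
  then obtain G :: "'a \<Rightarrow> real" where G: "in_Lp G" "nrm G \<le> nrm (\<lambda>w. down_norm p J (\<lambda>k. a k w))"
    "\<And>\<nu>. \<nu> \<in> D \<Longrightarrow> AE w in M. cmod (S (u \<nu>) w) \<le> G w"
    using maximal_boundE by blast
  have Su: "AE w in M. S (u \<nu>) w = (\<Sum>k\<le>J. \<nu> k * S (a k) w)" for \<nu>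
  proof -
    have "AE w in M. S (u \<nu>) w = (\<Sum>k\<le>J. S (\<lambda>w. \<nu> k * a k w) w)"
      unfolding u_def using a by (intro S_sum in_Lp_mult)
    moreover have "AE w in M. \<forall>k\<in>{..J}. S (\<lambda>w. \<nu> k * a k w) w = \<nu> k * S (a k) w"
      using a by (intro AE_all_countable_set S_mult) auto
    ultimately show ?thesis
      by eventually_elim auto
  qed
  have "AE w in M. \<forall>\<nu>\<in>D. cmod (\<Sum>k\<le>J. \<nu> k * S (a k) w) \<le> G w"
  proof (rule AE_all_countable_set[OF D(1)])
    fix \<nu> assume "\<nu> \<in> D"
    from G(3)[OF this] Su[of \<nu>] show "AE w in M. cmod (\<Sum>k\<le>J. \<nu> k * S (a k) w) \<le> G w"
      by eventually_elim simp
  qed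
  then have "AE w in M. norm (down_norm p J (\<lambda>k. S (a k) w)) \<le> norm (G w)"
  proof eventually_elim
    case (elim w)
    have "down_norm p J (\<lambda>k. S (a k) w) \<le> G w"
      unfolding D(4) using D(2) elim by (intro cSUP_least) auto
    then show ?case
      using down_norm_nonneg[OF p_gt_1, of J "\<lambda>k. S (a k) w"] by simp
  qed
  then have "nrm (\<lambda>w. down_norm p J (\<lambda>k. S (a k) w)) \<le> nrm G"
    using a by (intro in_Lp_bound(2) G(1) in_Lp_measurable[OF in_Lp_down_norm] S_in)
  with G(2) show ?thesis
    by linarith
qed

lemma nrm_avg_max:
  assumes x: "in_Lp x"
  shows "in_Lp (\<lambda>w. avg_max J (\<lambda>k. (S ^^ k) x w))" (is "in_Lp (?M J)")
    and "nrm (\<lambda>w. avg_max J (\<lambda>k. (S ^^ k) x w)) \<le> max_const * nrm x"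
proof -
  note Sx = S_pow_in[OF x]
  note [measurable] = in_Lp_measurable[OF Sx]
  have M: "in_Lp (?M J)" for J
  proof (rule in_Lp_bound(1))
    show "?M J \<in> borel_measurable M"
      unfolding avg_max_def by measurable
    show "in_Lp (\<lambda>w. \<Sum>k\<le>J. cmod ((S ^^ k) x w))"
      using Sx by (intro in_Lp_sum in_Lp_norm)
    have "?M J w \<le> (\<Sum>k\<le>J. cmod ((S ^^ k) x w))" for w
    proof -
      obtain n where n: "n \<le> J" "(\<Sum>k\<le>n. cmod ((S ^^ k) x w)) = ?M J w * real (Suc n)"
        using avg_max_attained[of J "\<lambda>k. (S ^^ k) x w"] by blast
      have "?M J w * 1 \<le> ?M J w * real (Suc n)"
        by (intro mult_left_mono avg_max_nonneg) auto
      also have "\<dots> \<le> (\<Sum>k\<le>J. cmod ((S ^^ k) x w))"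
        unfolding n(2)[symmetric] using n(1) by (intro sum_mono2) auto
      finally show ?thesis by simp
    qed
    then show "AE w in M. norm (?M J w) \<le> norm (\<Sum>k\<le>J. cmod ((S ^^ k) x w))"
      by (intro AE_I2) (simp add: sum_nonneg avg_max_nonneg)
  qed
  then show "in_Lp (?M J)" .
  define C where "C = p * (2 * p / (p - 1)) powr (p - 1)"
  have C: "0 \<le> C"
    using p_gt_1 by (simp add: C_def)
  define N where "N J = nrm (?M J) powr p" for J
  define B where "B J w = down_norm p J (\<lambda>k. (S ^^ k) x w)" for J w
  define \<beta> where "\<beta> J = nrm (B J) powr p" for J
  define \<xi> where "\<xi> = nrm x powr p"
  have B: "in_Lp (B J)" for J
    unfolding B_def by (rule in_Lp_down_norm[OF Sx])
  \<comment> \<open>Shifting the orbit is the same as applying S termwise. The pointwise inequality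
    therefore integrates to a relation between consecutive values of \<beta>, with the down norm of
    the shifted orbit compared to that of the orbit itself.\<close>
  have step: "(p - 1) / 2 * N (Suc J) + \<beta> (Suc J) \<le> \<beta> J + C * \<xi>" for J
  proof -
    define B' where "B' w = down_norm p J (\<lambda>k. S ((S ^^ k) x) w)" for w
    have B': "in_Lp B'"
      unfolding B'_def by (rule in_Lp_down_norm[OF S_in[OF Sx]])
    have pw: "(p - 1) / 2 * norm (?M (Suc J) w) powr p + norm (B (Suc J) w) powr p
        \<le> norm (B' w) powr p + C * norm (x w) powr p" for w
      using down_norm_step[OF p_gt_1, of J "\<lambda>k. (S ^^ k) x w"]
        absorb_first_term[of "cmod (x w)" "?M (Suc J) w"]
        avg_max_nonneg[of "Suc J" "\<lambda>k. (S ^^ k) x w"]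
        down_norm_nonneg[OF p_gt_1, of "Suc J" "\<lambda>k. (S ^^ k) x w"]
        down_norm_nonneg[OF p_gt_1, of "J" "\<lambda>k. S ((S ^^ k) x) w"]
      by (simp add: B_def B'_def C_def field_simps)
    note int = in_Lp_integrable[OF M] in_Lp_integrable[OF B] in_Lp_integrable[OF B'] in_Lp_integrable[OF x]
    have "(\<integral>w. (p - 1) / 2 * norm (?M (Suc J) w) powr p + norm (B (Suc J) w) powr p \<partial>M)
        \<le> (\<integral>w. norm (B' w) powr p + C * norm (x w) powr p \<partial>M)"
      using pw int by (intro integral_mono Bochner_Integration.integrable_add integrable_mult_right)
    then have "(p - 1) / 2 * N (Suc J) + \<beta> (Suc J) \<le> nrm B' powr p + C * \<xi>"
      using int by (simp add: N_def \<beta>_def \<xi>_def nrm_powr)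
    moreover have "nrm B' powr p \<le> \<beta> J"
      unfolding \<beta>_def B'_def B_def using p_gt_1 by (intro powr_mono2 nrm_down_norm_S Sx) auto
    ultimately show ?thesis by linarith
  qed
  have Nmono: "N i \<le> N j" if "i \<le> j" for i j
    unfolding N_def using p_gt_1 avg_max_mono[OF that] avg_max_nonneg
    by (intro powr_mono2 in_Lp_bound(2) M in_Lp_measurable[OF M]) auto
  have tele: "(p - 1) / 2 * (\<Sum>j\<in>{0<..n}. N j) + \<beta> n \<le> \<beta> 0 + real n * (C * \<xi>)" for n
  proof (induction n)
    case (Suc n)
    have "(\<Sum>j\<in>{0<..Suc n}. N j) = (\<Sum>j\<in>{0<..n}. N j) + N (Suc n)"
      by (simp add: atLeastSucAtMost_greaterThanAtMost[symmetric])
    then show ?case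
      using Suc step[of n] by (simp add: algebra_simps add_divide_distrib)
  qed simp
  have \<beta>0: "\<beta> 0 \<le> \<xi>"
  proof -
    have "norm (B 0 w) \<le> norm (x w)" for w
      using down_norm_le[OF p_gt_1, of 0 "\<lambda>k. (S ^^ k) x w"]
        down_norm_nonneg[OF p_gt_1, of 0 "\<lambda>k. (S ^^ k) x w"] by (simp add: B_def)
    then show ?thesis
      unfolding \<beta>_def \<xi>_def using p_gt_1
      by (intro powr_mono2 in_Lp_bound(2) x in_Lp_measurable[OF B]) auto
  qed
  \<comment> \<open>Telescoping controls only the sum of the N j. Since N increases, the J terms
    with J < j \<le> 2J are each at least N J, which turns the bound on the sum into one that does
    not depend on J.\<close>
  have NJ: "N J \<le> 2 * (1 + 2 * C) / (p - 1) * \<xi>" if J: "0 < J" for J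
  proof -
    have "real J * N J = (\<Sum>j\<in>{J<..2*J}. N J)"
      by simp
    also have "\<dots> \<le> (\<Sum>j\<in>{J<..2*J}. N j)"
      by (intro sum_mono Nmono) auto
    also have "\<dots> \<le> (\<Sum>j\<in>{0<..2*J}. N j)"
      by (intro sum_mono2) (auto simp: N_def)
    finally have "(p - 1) / 2 * (real J * N J) \<le> (p - 1) / 2 * (\<Sum>j\<in>{0<..2*J}. N j)"
      using p_gt_1 by (intro mult_left_mono) auto
    also have "\<dots> \<le> \<xi> + real (2 * J) * (C * \<xi>)"
    proof -
      have "0 \<le> \<beta> (2 * J)"
        by (simp add: \<beta>_def)
      then show ?thesis
        using tele[of "2*J"] \<beta>0 by linarith
    qed
    also have "\<dots> \<le> real J * \<xi> + real (2 * J) * (C * \<xi>)"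
    proof -
      have "1 * \<xi> \<le> real J * \<xi>"
        using J by (intro mult_right_mono) (auto simp: \<xi>_def)
      then show ?thesis by simp
    qed
    also have "\<dots> = real J * ((1 + 2 * C) * \<xi>)"
      by (simp add: algebra_simps)
    finally have "real J * ((p - 1) / 2 * N J) \<le> real J * ((1 + 2 * C) * \<xi>)"
      by (simp add: mult_ac)
    then have "(p - 1) / 2 * N J \<le> (1 + 2 * C) * \<xi>"
      by (rule mult_left_le_imp_le) (use J in simp)
    then show ?thesis
      using p_gt_1 by (simp add: field_simps)
  qed
  have "N J \<le> 2 * (1 + 2 * C) / (p - 1) * \<xi>"
    using NJ[of "Suc J"] Nmono[of J "Suc J"] by simp
  then have "(nrm (?M J) powr p) powr (1 / p) \<le> (2 * (1 + 2 * C) / (p - 1) * \<xi>) powr (1 / p)"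
    unfolding N_def using p_gt_1 by (intro powr_mono2) auto
  also have "\<dots> = max_const * nrm x"
    using p_gt_1 unfolding max_const_def C_def[symmetric] powr_mult \<xi>_def by (simp add: powr_powr)
  finally show "nrm (?M J) \<le> max_const * nrm x"
    using p_gt_1 by (simp add: powr_powr)
qed

text \<open>For n = 0 this is the zero function, which the maximal inequality over all n
  includes.\<close>

definition avg :: "nat \<Rightarrow> ('a \<Rightarrow> complex) \<Rightarrow> 'a \<Rightarrow> complex" where
  "avg n f w = (1 / real n) *\<^sub>R (\<Sum>k<n. (S ^^ k) f w)"

lemma in_Lp_avg: "in_Lp f \<Longrightarrow> in_Lp (avg n f)"
  unfolding avg_def by (intro in_Lp_scaleR in_Lp_sum S_pow_in)

theorem maximal_averages:
  assumes x: "in_Lp x"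
  shows "maximal_bound UNIV (\<lambda>n. avg n x) (max_const * nrm x)"
proof (rule maximal_bound_countable)
  fix F :: "nat set" assume F: "finite F" "F \<noteq> {}"
  show "maximal_bound F (\<lambda>n. avg n x) (max_const * nrm x)"
  proof (rule maximal_boundI[OF nrm_avg_max[OF x, of "Max F"]])
    fix n assume "n \<in> F"
    then have n: "n \<le> Max F"
      using F by simp
    have "cmod (avg n x w) \<le> avg_max (Max F) (\<lambda>k. (S ^^ k) x w)" for w
    proof (cases n)
      case 0
      then show ?thesis
        by (simp add: avg_def avg_max_nonneg)
    next
      case (Suc m)
      have "cmod (avg n x w) \<le> (\<Sum>k\<le>m. cmod ((S ^^ k) x w)) / real n"
        using norm_sum[of "\<lambda>k. (S ^^ k) x w" "{..<n}"]
        by (simp add: avg_def Suc lessThan_Suc_atMost divide_right_mono)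
      also have "\<dots> \<le> avg_max (Max F) (\<lambda>k. (S ^^ k) x w)"
        using avg_max_upper[of m "Max F" "\<lambda>k. (S ^^ k) x w"] n by (simp add: Suc divide_le_eq)
      finally show ?thesis .
    qed
    then show "AE w in M. cmod (avg n x w) \<le> avg_max (Max F) (\<lambda>k. (S ^^ k) x w)"
      by simp
  qed
qed (use x in_Lp_avg max_const_nonneg in auto)

end

section \<open>Banach's principle and pointwise convergence of discrete averages\<close>

context Lp_space
begin

text \<open>The p-th powers of the norms are O(n^-p), which is summable because p > 1. No pointwise
  control of the individual f n enters, so this applies to orbits and to majorants that change with
  n.\<close>

lemma AE_scaled_tendsto_zero:
  fixes f :: "nat \<Rightarrow> 'a \<Rightarrow> 'b::real_normed_vector"
  assumes f: "\<And>n. in_Lp (f n)" "\<And>n. nrm (f n) \<le> K"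
  shows "AE w in M. (\<lambda>n. (1 / real n) *\<^sub>R f n w) \<longlonglongrightarrow> 0"
proof (rule summable_nrm_powr_imp_AE_tendsto)
  show "in_Lp (\<lambda>w. (1 / real n) *\<^sub>R f n w)" for n
    by (intro in_Lp_scaleR f)
  have le: "nrm (\<lambda>w. (1 / real n) *\<^sub>R f n w) powr p \<le> K powr p * real n powr - p" for n
  proof -
    have "nrm (\<lambda>w. (1 / real n) *\<^sub>R f n w) \<le> K * (1 / real n)"
      unfolding nrm_scaleR using f(2)[of n] by (simp add: divide_right_mono)
    then have "nrm (\<lambda>w. (1 / real n) *\<^sub>R f n w) powr p \<le> (K * (1 / real n)) powr p"
      using p_gt_1 by (intro powr_mono2) auto
    also have "\<dots> = K powr p * real n powr - p"
      unfolding powr_mult by (simp add: powr_divide powr_minus_divide)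
    finally show ?thesis .
  qed
  show "summable (\<lambda>n. nrm (\<lambda>w. (1 / real n) *\<^sub>R f n w) powr p)"
  proof (rule summable_comparison_test')
    show "summable (\<lambda>n. K powr p * real n powr - p)"
      using p_gt_1 by (intro summable_mult) (simp add: summable_real_powr_iff)
    show "norm (nrm (\<lambda>w. (1 / real n) *\<^sub>R f n w) powr p) \<le> K powr p * real n powr - p"
      if "0 \<le> n" for n
      using le[of n] by simp
  qed
qed

text \<open>Banach's principle: the upper limit of |u| along F is at most every G k, and a
  subsequence of G tends to zero almost everywhere. The filter is arbitrary, so that sequences of
  averages and limits in t are both covered.\<close>

lemma AE_tendsto_zero_by_maximal:
  fixes u :: "'t \<Rightarrow> 'a \<Rightarrow> complex" and G :: "nat \<Rightarrow> 'a \<Rightarrow> real"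
  assumes G: "\<And>k. in_Lp (G k)" "(\<lambda>k. nrm (G k)) \<longlonglongrightarrow> 0"
    and ev: "\<And>k. AE w in M. \<forall>e>0. eventually (\<lambda>t. cmod (u t w) \<le> G k w + e) F"
  shows "AE w in M. ((\<lambda>t. u t w) \<longlongrightarrow> 0) F"
proof -
  obtain r :: "nat \<Rightarrow> nat" where r: "strict_mono r" "AE w in M. (\<lambda>k. G (r k) w) \<longlonglongrightarrow> 0"
    using nrm_tendsto_imp_AE_subseq[OF G] by blast
  have "AE w in M. \<forall>k. \<forall>e>0. eventually (\<lambda>t. cmod (u t w) \<le> G k w + e) F"
    using ev by (simp add: AE_all_countable)
  with r(2) show ?thesis
  proof eventually_elim
    case (elim w)
    show ?case
    proof (rule tendstoI)
      fix e :: real assume e: "0 < e"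
      have "eventually (\<lambda>k. G (r k) w < e / 2) sequentially"
        using order_tendstoD(2)[OF elim(1), of "e / 2"] e by simp
      then obtain k where k: "G (r k) w < e / 2"
        by (auto simp: eventually_sequentially)
      have "eventually (\<lambda>t. cmod (u t w) \<le> G (r k) w + e / 2) F"
        using elim(2) e by simp
      then show "eventually (\<lambda>t. dist (u t w) 0 < e) F"
        by eventually_elim (use k in simp)
    qed
  qed
qed

end

context regular_contraction
begin

lemma S_pow_cong:
  "in_Lp f \<Longrightarrow> in_Lp g \<Longrightarrow> AE w in M. f w = g w \<Longrightarrow> AE w in M. (S ^^ k) f w = (S ^^ k) g w"
proof (induction k)
  case (Suc k)
  then show ?case
    using S_cong[OF S_pow_in S_pow_in, of f g k k] by simp
qed auto

lemma S_pow_diff: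
  assumes "in_Lp f" "in_Lp g"
  shows "AE w in M. (S ^^ k) (\<lambda>w. f w - g w) w = (S ^^ k) f w - (S ^^ k) g w"
proof (induction k)
  case (Suc k)
  have "AE w in M. S ((S ^^ k) (\<lambda>w. f w - g w)) w = S (\<lambda>w. (S ^^ k) f w - (S ^^ k) g w) w"
    using Suc assms by (intro S_cong S_pow_in in_Lp_diff)
  with S_diff[OF S_pow_in[OF assms(1)] S_pow_in[OF assms(2)], of k k]
  show ?case by eventually_elim simp
qed simp

lemma S_pow_nrm: "in_Lp f \<Longrightarrow> nrm ((S ^^ k) f) \<le> nrm f"
proof (induction k)
  case (Suc k)
  then show ?case
    using S_nrm[OF S_pow_in, of f k] by auto
qed auto

lemma avg_cong:
  assumes "in_Lp f" "in_Lp g" "AE w in M. f w = g w"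
  shows "AE w in M. avg n f w = avg n g w"
proof -
  have "AE w in M. \<forall>k. (S ^^ k) f w = (S ^^ k) g w"
    using S_pow_cong[OF assms] by (simp add: AE_all_countable)
  then show ?thesis
    by eventually_elim (simp add: avg_def)
qed

lemma avg_diff:
  assumes "in_Lp f" "in_Lp g"
  shows "AE w in M. avg n (\<lambda>w. f w - g w) w = avg n f w - avg n g w"
proof -
  have "AE w in M. \<forall>k. (S ^^ k) (\<lambda>w. f w - g w) w = (S ^^ k) f w - (S ^^ k) g w"
    using S_pow_diff[OF assms] by (simp add: AE_all_countable)
  then show ?thesis
    by eventually_elim (simp add: avg_def sum_subtractf scaleR_diff_right)
qed

lemma S_avg:
  assumes "in_Lp f"
  shows "AE w in M. S (avg n f) w = (1 / real n) *\<^sub>R (\<Sum>k<n. (S ^^ Suc k) f w)"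
proof -
  have "AE w in M. S (\<lambda>w. (1 / real n) *\<^sub>R (\<Sum>k<n. (S ^^ k) f w)) w
      = (1 / real n) *\<^sub>R S (\<lambda>w. \<Sum>k<n. (S ^^ k) f w) w"
    using assms by (intro S_scaleR in_Lp_sum S_pow_in)
  moreover have "AE w in M. S (\<lambda>w. \<Sum>k<n. (S ^^ k) f w) w = (\<Sum>k<n. S ((S ^^ k) f) w)"
    using assms by (intro S_sum S_pow_in)
  ultimately show ?thesis
    by eventually_elim (simp add: avg_def[abs_def])
qed

lemma S_avg_diff:
  assumes "in_Lp f"
  shows "nrm (\<lambda>w. S (avg n f) w - avg n f w) \<le> 2 * nrm f / real n"
proof -
  have "AE w in M. S (avg n f) w - avg n f w = (1 / real n) *\<^sub>R ((S ^^ n) f w - f w)"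
    using S_avg[OF assms, of n]
  proof eventually_elim
    case (elim w)
    have "(\<Sum>k<n. (S ^^ Suc k) f w - (S ^^ k) f w) = (S ^^ n) f w - f w"
      using sum_lessThan_telescope[of "\<lambda>k. (S ^^ k) f w" n] by simp
    then show ?case
      unfolding elim avg_def by (simp add: sum_subtractf flip: scaleR_diff_right)
  qed
  then have "nrm (\<lambda>w. S (avg n f) w - avg n f w) = nrm (\<lambda>w. (1 / real n) *\<^sub>R ((S ^^ n) f w - f w))"
    using assms by (intro nrm_cong in_Lp_measurable in_Lp_diff S_in in_Lp_avg in_Lp_scaleR S_pow_in) auto
  also have "\<dots> = nrm (\<lambda>w. (S ^^ n) f w - f w) / real n"
    by (simp add: nrm_scaleR)
  also have "\<dots> \<le> (2 * nrm f) / real n"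
  proof (rule divide_right_mono)
    have "nrm (\<lambda>w. (S ^^ n) f w - f w) \<le> nrm ((S ^^ n) f) + nrm f"
      using nrm_triangle_diff[OF S_pow_in[OF assms] in_Lp_zero assms, of n]
        nrm_minus_commute[of "\<lambda>_. 0" f] by simp
    then show "nrm (\<lambda>w. (S ^^ n) f w - f w) \<le> 2 * nrm f"
      using S_pow_nrm[OF assms, of n] by linarith
  qed simp
  finally show ?thesis .
qed

lemma avg_fixed:
  assumes y: "in_Lp y" and "AE w in M. S y w = y w" and "0 < n"
  shows "AE w in M. avg n y w = y w"
proof -
  have "AE w in M. (S ^^ k) y w = y w" for k
  proof (induction k)
    case (Suc k)
    have "AE w in M. S ((S ^^ k) y) w = S y w"
      using Suc y by (intro S_cong S_pow_in)
    with assms(2) show ?case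
      by eventually_elim simp
  qed simp
  then have "AE w in M. \<forall>k. (S ^^ k) y w = y w"
    by (simp add: AE_all_countable)
  then show ?thesis
    by eventually_elim (use \<open>0 < n\<close> in \<open>simp add: avg_def scaleR_conv_of_real\<close>)
qed

lemma avg_coboundary:
  assumes f: "in_Lp f"
  shows "AE w in M. (\<lambda>n. avg n (\<lambda>w. f w - S f w) w) \<longlonglongrightarrow> 0"
proof -
  have "AE w in M. (S ^^ k) (\<lambda>w. f w - S f w) w = (S ^^ k) f w - (S ^^ Suc k) f w" for k
    using S_pow_diff[OF f S_in[OF f], of k] by (simp add: funpow_swap1)
  then have 1: "AE w in M. \<forall>k. (S ^^ k) (\<lambda>w. f w - S f w) w = (S ^^ k) f w - (S ^^ Suc k) f w"
    by (simp add: AE_all_countable)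
  have "AE w in M. (\<lambda>n. (1 / real n) *\<^sub>R (S ^^ n) f w) \<longlonglongrightarrow> 0"
    by (rule AE_scaled_tendsto_zero[OF S_pow_in[OF f] S_pow_nrm[OF f]])
  with 1 show ?thesis
  proof eventually_elim
    case (elim w)
    have "avg n (\<lambda>w. f w - S f w) w = (1 / real n) *\<^sub>R f w - (1 / real n) *\<^sub>R (S ^^ n) f w" for n
      unfolding avg_def using elim(1) sum_lessThan_telescope'[of "\<lambda>k. (S ^^ k) f w" n]
      by (simp flip: scaleR_diff_right)
    moreover have "(\<lambda>n. (1 / real n) *\<^sub>R f w - (1 / real n) *\<^sub>R (S ^^ n) f w) \<longlonglongrightarrow> 0 *\<^sub>R f w - 0"
      by (intro tendsto_intros elim(2) lim_1_over_n)
    ultimately show ?case by simp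
  qed
qed

text \<open>g - avg n g is the mean over k < n of g - S^k g, and each of these is I - S applied to
  the partial sum g + ... + S^(k-1) g.\<close>

lemma diff_avg_coboundary:
  assumes g: "in_Lp g" and n: "0 < n"
  shows "\<exists>f. in_Lp f \<and> (AE w in M. g w - avg n g w = f w - S f w)"
proof -
  define F where "F k w = (\<Sum>j<k. (S ^^ j) g w)" for k w
  have F: "in_Lp (F k)" for k
    unfolding F_def using g by (intro in_Lp_sum S_pow_in)
  have SF: "AE w in M. F k w - S (F k) w = g w - (S ^^ k) g w" for k
  proof -
    have "AE w in M. S (F k) w = (\<Sum>j<k. S ((S ^^ j) g) w)"
      unfolding F_def using g by (intro S_sum S_pow_in)
    then show ?thesis
    proof eventually_elim
      case (elim w)
      show ?case
        unfolding elim F_def using sum_lessThan_telescope'[of "\<lambda>k. (S ^^ k) g w" k]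
        by (simp add: sum_subtractf)
    qed
  qed
  define f where "f w = (1 / real n) *\<^sub>R (\<Sum>k<n. F k w)" for w
  have f: "in_Lp f"
    unfolding f_def using F by (intro in_Lp_scaleR in_Lp_sum)
  have "AE w in M. S f w = (1 / real n) *\<^sub>R S (\<lambda>w. \<Sum>k<n. F k w) w"
    unfolding f_def using F by (intro S_scaleR in_Lp_sum)
  moreover have "AE w in M. S (\<lambda>w. \<Sum>k<n. F k w) w = (\<Sum>k<n. S (F k) w)"
    using F by (intro S_sum)
  moreover have "AE w in M. \<forall>k. F k w - S (F k) w = g w - (S ^^ k) g w"
    using SF by (simp add: AE_all_countable)
  ultimately have "AE w in M. g w - avg n g w = f w - S f w"
  proof eventually_elim
    case (elim w)
    have "f w - S f w = (1 / real n) *\<^sub>R (\<Sum>k<n. F k w - S (F k) w)"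
      unfolding elim(1,2) f_def by (simp add: sum_subtractf flip: scaleR_diff_right)
    also have "\<dots> = (1 / real n) *\<^sub>R (\<Sum>k<n. g w) - avg n g w"
      by (simp only: elim(3) sum_subtractf avg_def scaleR_diff_right)
    also have "(1 / real n) *\<^sub>R (\<Sum>k<n. g w) = g w"
      using n by (simp add: scaleR_conv_of_real)
    finally show ?case by simp
  qed
  with f show ?thesis by blast
qed

text \<open>
  The limit is found as in the mean ergodic theorem, by minimising a Hilbert norm over almost
  invariant elements of \<open>g + R(I - S)\<close>. All averages of \<open>g\<close> are dominated by one \<open>G\<close> in
  \<open>L\<^sup>p\<close>, so the weighted norm with weight \<open>G\<^bsup>p-2\<^esup>\<close> is finite on the relevant set, and the
  parallelogram law replaces the uniform convexity of \<open>L\<^sup>p\<close>.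
\<close>

lemma exists_fixed_approximation:
  assumes g: "in_Lp g"
  obtains h y f where "\<And>k. in_Lp (h k)" "in_Lp y" "(\<lambda>k::nat. nrm (\<lambda>w. h k w - y w)) \<longlonglongrightarrow> 0"
    "AE w in M. S y w = y w" "\<And>k. in_Lp (f k)" "\<And>k. AE w in M. g w - h k w = f k w - S (f k) w"
proof -
  obtain G0 :: "'a \<Rightarrow> real" where G0: "in_Lp G0" "\<And>n. AE w in M. cmod (avg n g w) \<le> G0 w"
    using maximal_averages[OF g] unfolding maximal_bound_def by blast
  define G where "G w = \<bar>G0 w\<bar>" for w
  have G: "in_Lp G"
    using in_Lp_norm[OF G0(1)] by (simp add: G_def[abs_def])
  have Gnn: "0 \<le> G w" for w
    by (simp add: G_def)
  have GA: "AE w in M. cmod (avg n g w) \<le> G w" for n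
    using G0(2)[of n] by eventually_elim (simp add: G_def)
  note [measurable] = in_Lp_measurable[OF G]
  define \<Phi> where "\<Phi> h = (\<integral>w. (cmod (h w))\<^sup>2 * G w powr (p - 2) \<partial>M)" for h :: "'a \<Rightarrow> complex"
  \<comment> \<open>These conditions are stable under midpoints. The bound 2 * nrm g / n is the one
    that \<open>avg n g\<close> satisfies, so K n is nonempty for n > 0 and shrinks as n
    grows.\<close>
  define K where "K n = {h. in_Lp h \<and> (AE w in M. cmod (h w) \<le> G w) \<and>
      nrm (\<lambda>w. S h w - h w) \<le> 2 * nrm g / real n \<and>
      (\<exists>f. in_Lp f \<and> (AE w in M. g w - h w = f w - S f w))}" for n :: nat
  have KL: "in_Lp h" if "h \<in> K n" for h n
    using that by (simp add: K_def)
  have GG: "G w ^ 2 * G w powr (p - 2) = norm (G w) powr p" for w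
    using Gnn[of w] p_gt_1 powr_add[of "G w" 2 "p - 2"] by (cases "G w = 0") simp_all
  have bd: "(cmod (h w))\<^sup>2 * G w powr (p - 2) \<le> c\<^sup>2 * norm (G w) powr p"
    if "cmod (h w) \<le> c * G w" for h w c
  proof -
    have "(cmod (h w))\<^sup>2 \<le> (c * G w)\<^sup>2"
      using that by (intro power_mono) auto
    then have "(cmod (h w))\<^sup>2 * G w powr (p - 2) \<le> (c * G w)\<^sup>2 * G w powr (p - 2)"
      by (intro mult_right_mono) auto
    then show ?thesis
      using GG[of w] by (simp add: power_mult_distrib mult.assoc)
  qed
  have int: "integrable M (\<lambda>w. (cmod (h w))\<^sup>2 * G w powr (p - 2))"
    if h: "in_Lp h" "AE w in M. cmod (h w) \<le> c * G w" for h c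
  proof -
    note [measurable] = in_Lp_measurable[OF h(1)]
    have "integrable M (\<lambda>w. c\<^sup>2 * norm (G w) powr p)"
      using in_Lp_integrable[OF G] by simp
    then show ?thesis
    proof (rule Bochner_Integration.integrable_bound)
      show "AE w in M. norm ((cmod (h w))\<^sup>2 * G w powr (p - 2)) \<le> norm (c\<^sup>2 * norm (G w) powr p)"
        using h(2) by eventually_elim (use bd in auto)
    qed measurable
  qed
  have intK: "integrable M (\<lambda>w. (cmod (h w))\<^sup>2 * G w powr (p - 2))" if "h \<in> K n" for h n
    using that int[of h 1] by (simp add: K_def)
  have \<Phi>nn: "0 \<le> \<Phi> h" for h
    unfolding \<Phi>_def by (intro integral_nonneg_AE) auto
  have \<Phi>le: "\<Phi> h \<le> nrm G powr p" if "h \<in> K n" for h n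
    unfolding \<Phi>_def nrm_powr
  proof (intro integral_mono_AE intK[OF that] in_Lp_integrable[OF G])
    have "AE w in M. cmod (h w) \<le> G w"
      using that by (simp add: K_def)
    then show "AE w in M. (cmod (h w))\<^sup>2 * G w powr (p - 2) \<le> norm (G w) powr p"
      by eventually_elim (use bd[of h _ 1] in auto)
  qed
  have avgK: "avg n g \<in> K n" if "0 < n" for n
    unfolding K_def using in_Lp_avg[OF g] GA S_avg_diff[OF g] diff_avg_coboundary[OF g that] by simp
  have Kanti: "K m \<subseteq> K n" if "0 < n" "n \<le> m" for n m
  proof -
    have "2 * nrm g / real m \<le> 2 * nrm g / real n"
      using that by (intro divide_left_mono) auto
    then show ?thesis
      unfolding K_def by auto
  qed
  have Kmid: "(\<lambda>w. (1/2) *\<^sub>R (h w + k w)) \<in> K n" if h: "h \<in> K n" and k: "k \<in> K n" for h k n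
  proof -
    let ?m = "\<lambda>w. (1/2) *\<^sub>R (h w + k w)"
    note hL = KL[OF h] and kL = KL[OF k]
    have mL: "in_Lp ?m"
      using hL kL by (intro in_Lp_scaleR in_Lp_add)
    have Sm: "AE w in M. S ?m w = (1/2) *\<^sub>R (S h w + S k w)"
      using S_scaleR[OF in_Lp_add[OF hL kL], of "1/2"] S_add[OF hL kL] by eventually_elim simp
    have 1: "AE w in M. cmod (?m w) \<le> G w"
    proof -
      have "AE w in M. cmod (h w) \<le> G w" "AE w in M. cmod (k w) \<le> G w"
        using h k by (auto simp: K_def)
      then show ?thesis
      proof eventually_elim
        case (elim w)
        then show ?case
          using norm_triangle_ineq[of "h w" "k w"] by simp
      qed
    qed
    have 2: "nrm (\<lambda>w. S ?m w - ?m w) \<le> 2 * nrm g / real n"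
    proof -
      have "AE w in M. S ?m w - ?m w = (1/2) *\<^sub>R ((S h w - h w) + (S k w - k w))"
        using Sm by eventually_elim (simp add: scaleR_diff_right scaleR_add_right)
      then have "nrm (\<lambda>w. S ?m w - ?m w) = nrm (\<lambda>w. (1/2) *\<^sub>R ((S h w - h w) + (S k w - k w)))"
        using hL kL mL by (intro nrm_cong in_Lp_measurable in_Lp_diff S_in in_Lp_scaleR in_Lp_add) auto
      also have "\<dots> = 1/2 * nrm (\<lambda>w. (S h w - h w) + (S k w - k w))"
        unfolding nrm_scaleR by simp
      also have "\<dots> \<le> 1/2 * (nrm (\<lambda>w. S h w - h w) + nrm (\<lambda>w. S k w - k w))"
        using hL kL by (intro mult_left_mono nrm_triangle in_Lp_diff S_in) auto
      also have "\<dots> \<le> 1/2 * (2 * nrm g / real n + 2 * nrm g / real n)"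
        using h k by (intro mult_left_mono add_mono) (auto simp: K_def)
      finally show ?thesis by simp
    qed
    have 3: "\<exists>f. in_Lp f \<and> (AE w in M. g w - ?m w = f w - S f w)"
    proof -
      obtain f1 where f1: "in_Lp f1" "AE w in M. g w - h w = f1 w - S f1 w"
        using h by (auto simp: K_def)
      obtain f2 where f2: "in_Lp f2" "AE w in M. g w - k w = f2 w - S f2 w"
        using k by (auto simp: K_def)
      have "AE w in M. g w - ?m w = (1/2) *\<^sub>R (f1 w + f2 w) - S (\<lambda>w. (1/2) *\<^sub>R (f1 w + f2 w)) w"
        using f1(2) f2(2) S_scaleR[OF in_Lp_add[OF f1(1) f2(1)], of "1/2"] S_add[OF f1(1) f2(1)]
      proof eventually_elim
        case (elim w)
        have "g w - ?m w = (1/2) *\<^sub>R ((g w - h w) + (g w - k w))"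
          by (simp add: scaleR_conv_of_real field_simps)
        also have "\<dots> = (1/2) *\<^sub>R (f1 w + f2 w) - (1/2) *\<^sub>R (S f1 w + S f2 w)"
          unfolding elim(1,2) by (simp add: scaleR_conv_of_real field_simps)
        finally show ?case
          using elim(3,4) by simp
      qed
      then show ?thesis
        using in_Lp_scaleR[OF in_Lp_add[OF f1(1) f2(1)], of "1/2"] by blast
    qed
    from mL 1 2 3 show ?thesis
      by (simp add: K_def)
  qed
  \<comment> \<open>The index starts at Suc n: at 0 the quotient 2 * nrm g / 0 is 0, and K 0 would
    require exact invariance.\<close>
  define d where "d n = (INF h\<in>K (Suc n). \<Phi> h)" for n
  have ne: "K (Suc n) \<noteq> {}" for n
    using avgK[of "Suc n"] by auto
  have bdd: "bdd_below (\<Phi> ` A)" for A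
    using \<Phi>nn by (intro bdd_belowI2)
  have dmono: "d n \<le> d m" if "n \<le> m" for n m
    unfolding d_def using that by (intro cINF_superset_mono ne bdd Kanti) auto
  have dbd: "d n \<le> nrm G powr p" for n
    unfolding d_def by (rule cINF_lower2[where f=\<Phi>, OF bdd avgK[OF zero_less_Suc[of n]] \<Phi>le[OF avgK[OF zero_less_Suc[of n]]]])
  have "\<exists>h\<in>K (Suc n). \<Phi> h < d n + 1 / real (Suc n)" for n
    using cInf_lessD[of "\<Phi> ` K (Suc n)" "d n + 1 / real (Suc n)"] ne[of n] by (auto simp: d_def)
  then obtain h where h: "\<And>n. h n \<in> K (Suc n)" "\<And>n. \<Phi> (h n) < d n + 1 / real (Suc n)"
    by metis
  note hL = KL[OF h(1)]
  have hG: "AE w in M. cmod (h n w) \<le> G w" for n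
    using h(1)[of n] by (simp add: K_def)
  obtain D where D: "d \<longlonglongrightarrow> D" "\<And>n. d n \<le> D"
    using incseq_convergent[of d "nrm G powr p"] dmono dbd by (auto simp: incseq_def)
  \<comment> \<open>For n \<le> m the midpoint of h n and h m lies in K (Suc n), so \<Phi> is at
    least d n there. The parallelogram law then bounds \<Phi> of the difference by 2 (d m - d n) + 4
    / (n+1), and d m \<le> D.\<close>
  define \<epsilon> where "\<epsilon> n = 2 * (D - d n) + 4 / real (Suc n)" for n
  have \<epsilon>: "\<epsilon> \<longlonglongrightarrow> 0"
  proof -
    have "(\<lambda>n. 2 * (D - d n) + 4 * (1 / real (Suc n))) \<longlonglongrightarrow> 2 * (D - D) + 4 * 0"
      by (intro tendsto_intros D(1) LIMSEQ_Suc[OF lim_1_over_n])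
    then show ?thesis
      by (simp add: \<epsilon>_def[abs_def])
  qed
  have cauchy: "\<Phi> (\<lambda>w. h n w - h m w) \<le> \<epsilon> n" if nm: "n \<le> m" for n m
  proof -
    have hm: "h m \<in> K (Suc n)"
      using h(1)[of m] Kanti[of "Suc n" "Suc m"] nm by auto
    let ?m = "\<lambda>w. (1/2) *\<^sub>R (h n w + h m w)"
    have mK: "?m \<in> K (Suc n)"
      by (rule Kmid[OF h(1) hm])
    have "AE w in M. cmod (h n w - h m w) \<le> 2 * G w"
      using hG[of n] hG[of m]
    proof eventually_elim
      case (elim w)
      then show ?case
        using norm_triangle_ineq4[of "h n w" "h m w"] by simp
    qed
    then have i4: "integrable M (\<lambda>w. (cmod (h n w - h m w))\<^sup>2 * G w powr (p - 2))"
      by (intro int in_Lp_diff hL)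
    note i = i4 intK[OF mK] intK[OF h(1)[of n]] intK[OF hm]
    have par: "(cmod (h n w - h m w))\<^sup>2 * G w powr (p - 2) + 4 * ((cmod (?m w))\<^sup>2 * G w powr (p - 2))
        = 2 * ((cmod (h n w))\<^sup>2 * G w powr (p - 2)) + 2 * ((cmod (h m w))\<^sup>2 * G w powr (p - 2))" for w
    proof -
      have "(cmod (h n w - h m w))\<^sup>2 + 4 * (cmod (?m w))\<^sup>2 = 2 * (cmod (h n w))\<^sup>2 + 2 * (cmod (h m w))\<^sup>2"
        unfolding cmod_power2 by (simp add: power2_eq_square algebra_simps)
      from arg_cong[OF this, of "\<lambda>t. t * G w powr (p - 2)"] show ?thesis
        by (simp only: distrib_right mult.assoc)
    qed
    have "\<Phi> (\<lambda>w. h n w - h m w) + 4 * \<Phi> ?m = 2 * \<Phi> (h n) + 2 * \<Phi> (h m)"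
    proof -
      have "\<Phi> (\<lambda>w. h n w - h m w) + 4 * \<Phi> ?m = (\<integral>w. (cmod (h n w - h m w))\<^sup>2 * G w powr (p - 2)
          + 4 * ((cmod (?m w))\<^sup>2 * G w powr (p - 2)) \<partial>M)"
        unfolding \<Phi>_def using i(1,2)
        by (subst Bochner_Integration.integral_add) (auto simp del: scaleR_complex.sel)
      also have "\<dots> = 2 * \<Phi> (h n) + 2 * \<Phi> (h m)"
        unfolding \<Phi>_def par using i(3,4) by (subst Bochner_Integration.integral_add) auto
      finally show ?thesis .
    qed
    moreover have "d n \<le> \<Phi> ?m"
      unfolding d_def by (rule cINF_lower[OF bdd mK])
    moreover have "1 / real (Suc m) \<le> 1 / real (Suc n)"
      using nm by (intro divide_left_mono) auto
    ultimately have "\<Phi> (\<lambda>w. h n w - h m w) \<le> 2 * (d m - d n) + 4 * (1 / real (Suc n))"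
    proof -
      assume *: "\<Phi> (\<lambda>w. h n w - h m w) + 4 * \<Phi> ?m = 2 * \<Phi> (h n) + 2 * \<Phi> (h m)" "d n \<le> \<Phi> ?m"
        "1 / real (Suc m) \<le> 1 / real (Suc n)"
      define a b where "a = 1 / real (Suc n)" and "b = 1 / real (Suc m)"
      have "\<Phi> (h n) < d n + a" "\<Phi> (h m) < d m + b" "b \<le> a"
        using h(2)[of n] h(2)[of m] *(3) by (simp_all add: a_def b_def)
      then show ?thesis
        using *(1,2) unfolding a_def[symmetric] by argo
    qed
    then show ?thesis
      using D(2)[of m] by (simp add: \<epsilon>_def)
  qed
  \<comment> \<open>The rate 1/4 leaves room for a factor 2^k: the sum of 2^k \<Phi> (\<Delta> k) is
    still finite.\<close>
  have "\<exists>r. \<forall>n. \<epsilon> (r n) < (1/4)^n \<and> r n < r (Suc n)"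
  proof (rule dependent_nat_choice)
    have ex: "\<exists>k>m. \<epsilon> k < (1/4)^n" for n m
    proof -
      have "eventually (\<lambda>k. \<epsilon> k < (1/4)^n) sequentially"
        using order_tendstoD(2)[OF \<epsilon>] by simp
      then obtain N where "\<forall>k\<ge>N. \<epsilon> k < (1/4)^n"
        unfolding eventually_sequentially by blast
      then show ?thesis
        by (intro exI[of _ "max N (Suc m)"]) auto
    qed
    show "\<exists>k. \<epsilon> k < (1/4)^0"
      using ex[of 0 0] by blast
    show "\<exists>k. \<epsilon> k < (1/4) ^ Suc n \<and> m < k" for m n
      using ex[of m "Suc n"] by blast
  qed
  then obtain r where r: "\<And>n. \<epsilon> (r n) < (1/4)^n" "\<And>n. r n < r (Suc n)"
    by blast
  define \<Delta> where "\<Delta> k w = h (r k) w - h (r (Suc k)) w" for k w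
  have \<Delta>L: "in_Lp (\<Delta> k)" for k
    unfolding \<Delta>_def by (intro in_Lp_diff hL)
  note [measurable] = in_Lp_measurable[OF \<Delta>L] in_Lp_measurable[OF hL]
  have \<Delta>G: "AE w in M. cmod (\<Delta> k w) \<le> 2 * G w" for k
    using hG[of "r k"] hG[of "r (Suc k)"]
  proof eventually_elim
    case (elim w)
    then show ?case
      unfolding \<Delta>_def using norm_triangle_ineq4[of "h (r k) w" "h (r (Suc k)) w"] by simp
  qed
  have \<Delta>\<Phi>: "\<Phi> (\<Delta> k) \<le> (1/4)^k" for k
    using cauchy[of "r k" "r (Suc k)"] r(1)[of k] r(2)[of k] unfolding \<Delta>_def by linarith
  have "AE w in M. (\<Sum>k. ennreal (2 ^ k * ((cmod (\<Delta> k w))\<^sup>2 * G w powr (p - 2)))) \<noteq> \<infinity>"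
  proof (rule nn_integral_PInf_AE)
    have "(\<integral>\<^sup>+w. (\<Sum>k. ennreal (2 ^ k * ((cmod (\<Delta> k w))\<^sup>2 * G w powr (p - 2)))) \<partial>M)
        = (\<Sum>k. \<integral>\<^sup>+w. ennreal (2 ^ k * ((cmod (\<Delta> k w))\<^sup>2 * G w powr (p - 2))) \<partial>M)"
      by (rule nn_integral_suminf) measurable
    also have "\<dots> = (\<Sum>k. ennreal (2 ^ k * \<Phi> (\<Delta> k)))"
      unfolding \<Phi>_def using int[OF \<Delta>L \<Delta>G]
      by (subst nn_integral_eq_integral) (auto intro!: integrable_mult_right)
    also have "\<dots> \<le> (\<Sum>k. ennreal ((1/2) ^ k))"
    proof (intro suminf_le summableI ennreal_leI)
      show "2 ^ k * \<Phi> (\<Delta> k) \<le> (1/2)^k" for k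
        using mult_left_mono[OF \<Delta>\<Phi>[of k], of "2 ^ k"] by (simp flip: power_mult_distrib)
    qed
    also have "\<dots> < \<infinity>"
      by (subst suminf_ennreal2) (auto intro: summable_geometric)
    finally show "(\<integral>\<^sup>+w. (\<Sum>k. ennreal (2 ^ k * ((cmod (\<Delta> k w))\<^sup>2 * G w powr (p - 2)))) \<partial>M) \<noteq> \<infinity>"
      by simp
  qed measurable
  moreover have hG': "AE w in M. \<forall>n. cmod (h n w) \<le> G w"
    using hG by (simp add: AE_all_countable)
  ultimately have conv: "AE w in M. convergent (\<lambda>k. h (r k) w)"
  proof eventually_elim
    case (elim w)
    show ?case
    \<comment> \<open>Where G vanishes the weight is zero and \<Phi> gives no information, but there
      every h n vanishes by domination.\<close>
    proof (cases "G w = 0")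
      case True
      then have "h n w = 0" for n
        using elim(2) True by simp
      then show ?thesis
        by (simp add: convergent_const)
    next
      case False
      define wt where "wt = G w powr (p - 2)"
      have wt: "0 < wt"
        using False by (simp add: wt_def)
      have "summable (\<lambda>k. 2 ^ k * ((cmod (\<Delta> k w))\<^sup>2 * wt))"
        using elim(1) unfolding wt_def by (intro summable_suminf_not_top) auto
      then have "summable (\<lambda>k. (2 ^ k * ((cmod (\<Delta> k w))\<^sup>2 * wt)) * (1 / wt) + (1/2)^k)"
        by (intro summable_add summable_mult2 summable_geometric) auto
      then have "summable (\<lambda>k. \<Delta> k w)"
      proof (rule summable_comparison_test'[where N=0])
        fix k :: nat
        \<comment> \<open>With u = 2^k |\<Delta> k| this is u \<le> u^2 + 1. Divided by 2^k it reads
          |\<Delta> k| \<le> 2^k |\<Delta> k|^2 + 2^-k, which turns summable weighted squares into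
          absolute summability.\<close>
        have "0 \<le> (cmod (\<Delta> k w) * 2 ^ k - 1)\<^sup>2 + cmod (\<Delta> k w) * 2 ^ k"
          by auto
        then have "cmod (\<Delta> k w) * 2 ^ k \<le> (cmod (\<Delta> k w))\<^sup>2 * (2 ^ k)\<^sup>2 + 1"
          by (simp add: power2_eq_square algebra_simps)
        then have "cmod (\<Delta> k w) * 2 ^ k / 2 ^ k \<le> ((cmod (\<Delta> k w))\<^sup>2 * (2 ^ k)\<^sup>2 + 1) / 2 ^ k"
          by (intro divide_right_mono) auto
        then show "norm (\<Delta> k w) \<le> (2 ^ k * ((cmod (\<Delta> k w))\<^sup>2 * wt)) * (1 / wt) + (1/2)^k"
          using wt by (simp add: add_divide_distrib power2_eq_square power_divide mult_ac)
      qed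
      then have "convergent (\<lambda>n. \<Sum>k<n. \<Delta> k w)"
        by (simp add: summable_iff_convergent)
      moreover have "(\<Sum>k<n. \<Delta> k w) = h (r 0) w - h (r n) w" for n
        unfolding \<Delta>_def by (rule sum_lessThan_telescope')
      ultimately have "convergent (\<lambda>n. h (r 0) w - h (r n) w)"
        by simp
      from convergent_diff[OF convergent_const[of "h (r 0) w"] this] show ?thesis by simp
    qed
  qed
  define y where "y w = lim (\<lambda>k. h (r k) w)" for w
  have ym: "y \<in> borel_measurable M"
    unfolding y_def by measurable
  have lim: "AE w in M. (\<lambda>k. h (r k) w) \<longlonglongrightarrow> y w"
    using conv by eventually_elim (simp add: y_def convergent_LIMSEQ_iff)
  \<comment> \<open>The Hilbert norm served only to find a pointwise limit; domination by G brings
    the convergence back to the norm of L^p.\<close>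
  have y: "in_Lp y" "(\<lambda>k. nrm (\<lambda>w. h (r k) w - y w)) \<longlonglongrightarrow> 0"
    by (rule dominated_nrm_tendsto[OF in_Lp_measurable[OF hL] ym G hG lim])+
  have "nrm (\<lambda>w. S y w - y w) \<le> 2 * nrm g * (1 / real (Suc (r k))) + 2 * nrm (\<lambda>w. h (r k) w - y w)" for k
  proof -
    let ?h = "h (r k)"
    have "nrm (\<lambda>w. S y w - y w) \<le> nrm (\<lambda>w. S y w - S ?h w) + nrm (\<lambda>w. S ?h w - y w)"
      by (intro nrm_triangle_diff S_in hL y(1))
    also have "nrm (\<lambda>w. S ?h w - y w) \<le> nrm (\<lambda>w. S ?h w - ?h w) + nrm (\<lambda>w. ?h w - y w)"
      by (intro nrm_triangle_diff S_in hL y(1))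
    also have "nrm (\<lambda>w. S ?h w - ?h w) \<le> 2 * nrm g * (1 / real (Suc (r k)))"
      using h(1)[of "r k"] by (simp add: K_def)
    also have "nrm (\<lambda>w. S y w - S ?h w) \<le> nrm (\<lambda>w. ?h w - y w)"
      using S_nrm_diff[OF y(1) hL, of "r k"] by (simp add: nrm_minus_commute[of y])
    finally show ?thesis by simp
  qed
  moreover have "(\<lambda>k. 2 * nrm g * (1 / real (Suc (r k))) + 2 * nrm (\<lambda>w. h (r k) w - y w)) \<longlonglongrightarrow> 2 * nrm g * 0 + 2 * 0"
  proof (intro tendsto_intros y(2))
    have "strict_mono r"
      using r(2) by (simp add: strict_mono_Suc_iff)
    then show "(\<lambda>k. 1 / real (Suc (r k))) \<longlonglongrightarrow> 0"
      using LIMSEQ_subseq_LIMSEQ[OF LIMSEQ_Suc[OF lim_1_over_n]] by (simp add: o_def)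
  qed
  ultimately have "nrm (\<lambda>w. S y w - y w) \<le> 2 * nrm g * 0 + 2 * 0"
    by (intro tendsto_lowerbound[of _ _ sequentially]) auto
  then have "nrm (\<lambda>w. S y w - y w) = 0"
    by (simp add: antisym)
  then have "AE w in M. S y w - y w = 0"
    using nrm_eq_0_iff[OF in_Lp_diff[OF S_in[OF y(1)] y(1)]] by simp
  then have inv: "AE w in M. S y w = y w"
    by simp
  have "\<exists>f. in_Lp f \<and> (AE w in M. g w - h (r k) w = f w - S f w)" for k
    using h(1)[of "r k"] by (simp add: K_def)
  then obtain f where "\<And>k. in_Lp (f k)" "\<And>k. AE w in M. g w - h (r k) w = f k w - S (f k) w"
    by metis
  with hL y inv show thesis
    by (intro that[of "\<lambda>k. h (r k)" y f]) auto
qed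

text \<open>Write g = y + (g - h k) + (h k - y). The averages of y stay equal to y, those of the
  coboundary g - h k vanish in the limit, and those of h k - y have a majorant whose norm is at most
  a constant times that of h k - y.\<close>

theorem pointwise_ergodic:
  assumes g: "in_Lp g"
  obtains y where "in_Lp y" "AE w in M. (\<lambda>n. avg n g w) \<longlonglongrightarrow> y w"
proof -
  obtain h y f where h: "\<And>k. in_Lp (h k)" and y: "in_Lp y"
    and hy: "(\<lambda>k::nat. nrm (\<lambda>w. h k w - y w)) \<longlonglongrightarrow> 0" and inv: "AE w in M. S y w = y w"
    and f: "\<And>k. in_Lp (f k)" and gf: "\<And>k. AE w in M. g w - h k w = f k w - S (f k) w"
    by (rule exists_fixed_approximation[OF g]) (rule that)
  have "\<exists>G :: 'a \<Rightarrow> real. in_Lp G \<and> nrm G \<le> max_const * nrm (\<lambda>w. h k w - y w) \<and>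
      (\<forall>n. AE w in M. cmod (avg n (\<lambda>w. h k w - y w) w) \<le> G w)" for k
    using maximal_averages[OF in_Lp_diff[OF h y], of k] by (simp add: maximal_bound_def)
  then obtain G :: "nat \<Rightarrow> 'a \<Rightarrow> real" where G: "\<And>k. in_Lp (G k)"
    "\<And>k. nrm (G k) \<le> max_const * nrm (\<lambda>w. h k w - y w)"
    "\<And>k n. AE w in M. cmod (avg n (\<lambda>w. h k w - y w) w) \<le> G k w"
    by metis
  have G0: "(\<lambda>k. nrm (G k)) \<longlonglongrightarrow> 0"
  proof (rule tendsto_sandwich[of "\<lambda>_. 0"])
    show "(\<lambda>k. max_const * nrm (\<lambda>w. h k w - y w)) \<longlonglongrightarrow> 0"
      using tendsto_mult_left[OF hy, of max_const] by simp
  qed (use G(2) in auto)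
  \<comment> \<open>The index is shifted because \<open>avg 0 y\<close> is zero instead of
    y.\<close>
  have "AE w in M. ((\<lambda>n. avg (Suc n) g w - y w) \<longlongrightarrow> 0) sequentially"
  proof (rule AE_tendsto_zero_by_maximal[OF G(1) G0])
    fix k
    let ?c = "\<lambda>w. f k w - S (f k) w" and ?e = "\<lambda>w. h k w - y w"
    have cL: "in_Lp ?c" and gh: "in_Lp (\<lambda>w. g w - h k w)"
      using f h g by (auto intro: in_Lp_diff S_in)
    have "AE w in M. avg (Suc n) g w - y w = avg (Suc n) ?c w + avg (Suc n) ?e w" for n
      using avg_cong[OF gh cL gf, of "Suc n"] avg_diff[OF g h, of "Suc n" k] avg_diff[OF h y, of "Suc n" k]
        avg_fixed[OF y inv zero_less_Suc[of n]]
      by eventually_elim (simp add: algebra_simps)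
    then have 1: "AE w in M. \<forall>n. avg (Suc n) g w - y w = avg (Suc n) ?c w + avg (Suc n) ?e w"
      by (simp add: AE_all_countable)
    have 2: "AE w in M. \<forall>n. cmod (avg n ?e w) \<le> G k w"
      using G(3) by (simp add: AE_all_countable)
    show "AE w in M. \<forall>e>0. eventually (\<lambda>n. cmod (avg (Suc n) g w - y w) \<le> G k w + e) sequentially"
      using 1 2 avg_coboundary[OF f, of k]
    proof (eventually_elim, intro allI impI)
      fix w and e :: real
      assume *: "\<forall>n. avg (Suc n) g w - y w = avg (Suc n) ?c w + avg (Suc n) ?e w"
        "\<forall>n. cmod (avg n ?e w) \<le> G k w" "(\<lambda>n. avg n ?c w) \<longlonglongrightarrow> 0" and e: "0 < e"
      have "eventually (\<lambda>n. cmod (avg (Suc n) ?c w) < e) sequentially"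
        using LIMSEQ_Suc[OF *(3)] e by (auto dest!: tendstoD)
      then show "eventually (\<lambda>n. cmod (avg (Suc n) g w - y w) \<le> G k w + e) sequentially"
      proof eventually_elim
        case (elim n)
        then show ?case
          using *(1)[rule_format, of n] *(2)[rule_format, of "Suc n"]
            norm_triangle_ineq[of "avg (Suc n) ?c w" "avg (Suc n) ?e w"] by simp
      qed
    qed
  qed
  then have "AE w in M. (\<lambda>n. avg n g w) \<longlonglongrightarrow> y w"
  proof eventually_elim
    case (elim w)
    then have "(\<lambda>n. avg (Suc n) g w) \<longlonglongrightarrow> y w"
      by (simp add: LIM_zero_iff)
    then show ?case
      by (rule LIMSEQ_imp_Suc)
  qed
  with y show thesis
    by (rule that)
qed

end

context Lp_space
begin

lemma nrm_cong_eq: "AE w in M. f w = g w \<Longrightarrow> in_Lp f \<Longrightarrow> in_Lp g \<Longrightarrow> nrm f = nrm g"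
  by (rule nrm_cong) (auto simp: in_Lp_measurable)

end

section \<open>Fixed vectors against the range of S - I\<close>

context regular_contraction
begin

lemma nrm_avg:
  assumes "in_Lp f"
  shows "nrm (avg n f) \<le> nrm f"
proof (cases "n = 0")
  case False
  have "nrm (avg n f) = nrm (\<lambda>w. \<Sum>k<n. (S ^^ k) f w) / real n"
    unfolding avg_def[abs_def] nrm_scaleR by simp
  also have "\<dots> \<le> (\<Sum>k<n. nrm ((S ^^ k) f)) / real n"
    using assms by (intro divide_right_mono nrm_sum S_pow_in) auto
  also have "\<dots> \<le> (\<Sum>k<n. nrm f) / real n"
    using S_pow_nrm[OF assms] by (intro divide_right_mono sum_mono) auto
  finally show ?thesis
    using False by simp
qed (simp add: avg_def[abs_def])

lemma S_pow_diff_nrm: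
  assumes "in_Lp f"
  shows "nrm (\<lambda>w. (S ^^ n) f w - f w) \<le> real n * nrm (\<lambda>w. S f w - f w)"
proof (induction n)
  case (Suc n)
  have "nrm (\<lambda>w. (S ^^ Suc n) f w - f w)
      \<le> nrm (\<lambda>w. S ((S ^^ n) f) w - S f w) + nrm (\<lambda>w. S f w - f w)"
    using nrm_triangle_diff[OF S_pow_in[OF assms, of "Suc n"] S_in[OF assms] assms] by simp
  also have "nrm (\<lambda>w. S ((S ^^ n) f) w - S f w) \<le> nrm (\<lambda>w. (S ^^ n) f w - f w)"
    by (intro S_nrm_diff S_pow_in assms)
  also have "\<dots> \<le> real n * nrm (\<lambda>w. S f w - f w)"
    by (rule Suc.IH)
  finally show ?case
    by (simp add: algebra_simps)
qed simp

text \<open>Fixed vectors are Birkhoff-James orthogonal to the range of S - I: averaging z - (S f -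
  f) returns z up to an error of norm 2 * nrm f / n, and averaging does not increase norms. This
  yields uniqueness of the kernel component.\<close>

lemma nrm_fixed_le:
  assumes z: "in_Lp z" "AE w in M. S z w = z w" and f: "in_Lp f"
  shows "nrm z \<le> nrm (\<lambda>w. z w - (S f w - f w))"
proof -
  let ?d = "\<lambda>w. S f w - f w"
  have d: "in_Lp ?d"
    using f by (intro in_Lp_diff S_in)
  have zd: "in_Lp (\<lambda>w. z w - ?d w)"
    by (intro in_Lp_diff z d)
  have le: "nrm z \<le> nrm (\<lambda>w. z w - ?d w) + 2 * nrm f * (1 / real (Suc n))" for n
  proof -
    let ?n = "Suc n"
    have "AE w in M. avg ?n (S f) w = S (avg ?n f) w"
      using S_avg[OF f, of ?n] by eventually_elim (simp add: avg_def funpow_swap1 del: sum.lessThan_Suc)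
    then have "AE w in M. z w = avg ?n (\<lambda>w. z w - ?d w) w + (S (avg ?n f) w - avg ?n f w)"
      using avg_fixed[OF z zero_less_Suc[of n]] avg_diff[OF z(1) d, of ?n] avg_diff[OF S_in[OF f] f, of ?n]
      by eventually_elim simp
    then have "nrm z = nrm (\<lambda>w. avg ?n (\<lambda>w. z w - ?d w) w + (S (avg ?n f) w - avg ?n f w))"
      using z(1) f zd by (intro nrm_cong in_Lp_measurable in_Lp_add in_Lp_diff S_in in_Lp_avg) auto
    also have "\<dots> \<le> nrm (avg ?n (\<lambda>w. z w - ?d w)) + nrm (\<lambda>w. S (avg ?n f) w - avg ?n f w)"
      by (intro nrm_triangle in_Lp_avg[OF zd] in_Lp_diff S_in in_Lp_avg f)
    also have "\<dots> \<le> nrm (\<lambda>w. z w - ?d w) + 2 * nrm f / real ?n"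
      by (intro add_mono nrm_avg zd S_avg_diff f)
    finally show ?thesis
      by simp
  qed
  have "(\<lambda>n. nrm (\<lambda>w. z w - ?d w) + 2 * nrm f * (1 / real (Suc n))) \<longlonglongrightarrow> nrm (\<lambda>w. z w - ?d w) + 2 * nrm f * 0"
    by (intro tendsto_intros LIMSEQ_Suc[OF lim_1_over_n])
  then have "nrm z \<le> nrm (\<lambda>w. z w - ?d w) + 2 * nrm f * 0"
    using le by (intro tendsto_lowerbound[of _ _ sequentially]) auto
  then show ?thesis by simp
qed

end

section \<open>The semigroup, its generator and uniqueness of the kernel component\<close>

locale contraction_semigroup = Lp_space +
  fixes T :: "real \<Rightarrow> ('a \<Rightarrow> complex) \<Rightarrow> 'a \<Rightarrow> complex"
  assumes C0_semigroup: "Lp_C0_semigroup M p T"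
    and contractively_regular: "\<And>t. 0 \<le> t \<Longrightarrow> contractively_regular M p (T t)"
begin

lemma regular_contraction_T: "0 \<le> t \<Longrightarrow> regular_contraction M p (T t)"
  by (rule contractively_regular_imp_regular_contraction[OF contractively_regular])

lemmas T_in = regular_contraction.S_in[OF regular_contraction_T]
lemmas T_cong = regular_contraction.S_cong[OF regular_contraction_T]
lemmas T_add = regular_contraction.S_add[OF regular_contraction_T]
lemmas T_diff = regular_contraction.S_diff[OF regular_contraction_T]
lemmas T_scaleR = regular_contraction.S_scaleR[OF regular_contraction_T]
lemmas T_sum = regular_contraction.S_sum[OF regular_contraction_T]
lemmas T_nrm_diff = regular_contraction.S_nrm_diff[OF regular_contraction_T]
lemmas maximal_bound_T = regular_contraction.maximal_bound_S[OF regular_contraction_T]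
lemmas T_zero = regular_contraction.S_zero[OF regular_contraction_T]

lemma T_0: "in_Lp f \<Longrightarrow> AE w in M. T 0 f w = f w"
  using C0_semigroup by (simp add: Lp_C0_semigroup_def in_Lp_iff)

lemma T_plus: "0 \<le> s \<Longrightarrow> 0 \<le> t \<Longrightarrow> in_Lp f \<Longrightarrow> AE w in M. T (s + t) f w = T s (T t f) w"
  using C0_semigroup by (simp add: Lp_C0_semigroup_def in_Lp_iff)

lemma T_right_continuous:
  "in_Lp f \<Longrightarrow> ((\<lambda>t. nrm (\<lambda>w. T t f w - f w)) \<longlongrightarrow> 0) (at_right 0)"
  using C0_semigroup by (simp add: Lp_C0_semigroup_def in_Lp_iff)

lemma T_pow:
  assumes h: "0 \<le> h" and f: "in_Lp f"
  shows "AE w in M. (T h ^^ k) f w = T (real k * h) f w"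
proof (induction k)
  case 0
  show ?case
    using T_0[OF f] by eventually_elim simp
next
  case (Suc k)
  note pow = regular_contraction.S_pow_in[OF regular_contraction_T[OF h] f]
  have "AE w in M. T h ((T h ^^ k) f) w = T h (T (real k * h) f) w"
    using h f by (intro T_cong Suc pow T_in) auto
  moreover have "AE w in M. T (h + real k * h) f w = T h (T (real k * h) f) w"
    using h f by (intro T_plus) auto
  ultimately show ?case
    by eventually_elim (simp add: algebra_simps)
qed

text \<open>The Riemann mean with left tags and step h. It uses T at the times k h instead of powers
  of \<open>T h\<close>; the two agree almost everywhere, and this form matches the sums in the
  definition of the integral.\<close>

definition mean :: "real \<Rightarrow> nat \<Rightarrow> ('a \<Rightarrow> complex) \<Rightarrow> 'a \<Rightarrow> complex" where
  "mean h n f w = (1 / real n) *\<^sub>R (\<Sum>k<n. T (real k * h) f w)"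

lemma in_Lp_mean: "0 \<le> h \<Longrightarrow> in_Lp f \<Longrightarrow> in_Lp (mean h n f)"
  unfolding mean_def by (intro in_Lp_scaleR in_Lp_sum T_in) auto

lemma mean_eq_avg:
  assumes "0 \<le> h" "in_Lp f"
  shows "AE w in M. regular_contraction.avg (T h) n f w = mean h n f w"
proof -
  have "AE w in M. \<forall>k. (T h ^^ k) f w = T (real k * h) f w"
    using T_pow[OF assms] by (simp add: AE_all_countable)
  then show ?thesis
    by eventually_elim (simp add: mean_def regular_contraction.avg_def[OF regular_contraction_T[OF assms(1)]])
qed

lemma maximal_means:
  assumes "0 \<le> h" "in_Lp f"
  shows "maximal_bound UNIV (\<lambda>n. mean h n f) (max_const * nrm f)"
proof (rule maximal_bound_dominated)
  show "maximal_bound UNIV (\<lambda>n. regular_contraction.avg (T h) n f) (max_const * nrm f)"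
    by (rule regular_contraction.maximal_averages[OF regular_contraction_T[OF assms(1)] assms(2)])
  show "AE w in M. cmod (mean h n f w) \<le> cmod (regular_contraction.avg (T h) n f w)" for n
    using mean_eq_avg[OF assms, of n] by eventually_elim simp
qed

lemma mean_diff:
  assumes "0 \<le> h" "in_Lp f" "in_Lp g"
  shows "AE w in M. mean h n (\<lambda>w. f w - g w) w = mean h n f w - mean h n g w"
proof -
  have "AE w in M. \<forall>k. T (real k * h) (\<lambda>w. f w - g w) w = T (real k * h) f w - T (real k * h) g w"
    using T_diff[OF _ assms(2,3)] assms(1) by (simp add: AE_all_countable)
  then show ?thesis
    by eventually_elim (simp add: mean_def sum_subtractf scaleR_diff_right)
qed

lemma generator_add:
  assumes "Lp_generator M p T f g" "Lp_generator M p T f' g'"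
  shows "Lp_generator M p T (\<lambda>w. f w + f' w) (\<lambda>w. g w + g' w)"
proof -
  have L: "in_Lp f" "in_Lp g" "in_Lp f'" "in_Lp g'"
    using assms by (auto simp: Lp_generator_def in_Lp_iff)
  let ?D = "\<lambda>t f g w. (T t f w - f w) /\<^sub>R t - g w"
  have DL: "in_Lp (?D t f g)" if "0 < t" "in_Lp f" "in_Lp g" for t f g
    using that by (intro in_Lp_diff in_Lp_scaleR T_in) auto
  have lim: "((\<lambda>t. nrm (?D t f g) + nrm (?D t f' g')) \<longlongrightarrow> 0 + 0) (at_right 0)"
    using assms by (intro tendsto_add) (auto simp: Lp_generator_def)
  have le: "nrm (?D t (\<lambda>w. f w + f' w) (\<lambda>w. g w + g' w)) \<le> nrm (?D t f g) + nrm (?D t f' g')"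
    if t: "0 < t" for t
  proof -
    have "AE w in M. ?D t (\<lambda>w. f w + f' w) (\<lambda>w. g w + g' w) w = ?D t f g w + ?D t f' g' w"
      using T_add[OF less_imp_le[OF t] L(1,3)]
      by eventually_elim (simp add: scaleR_diff_right scaleR_add_right)
    then have "nrm (?D t (\<lambda>w. f w + f' w) (\<lambda>w. g w + g' w)) = nrm (\<lambda>w. ?D t f g w + ?D t f' g' w)"
      by (rule nrm_cong_eq) (use t L in \<open>auto intro!: DL in_Lp_add\<close>)
    also have "\<dots> \<le> nrm (?D t f g) + nrm (?D t f' g')"
      using t L by (intro nrm_triangle DL)
    finally show ?thesis .
  qed
  have "((\<lambda>t. nrm (?D t (\<lambda>w. f w + f' w) (\<lambda>w. g w + g' w))) \<longlongrightarrow> 0) (at_right 0)"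
  proof (rule tendsto_sandwich[of "\<lambda>_. 0"])
    show "((\<lambda>t. nrm (?D t f g) + nrm (?D t f' g')) \<longlongrightarrow> 0) (at_right 0)"
      using lim by simp
    show "\<forall>\<^sub>F t in at_right 0. nrm (?D t (\<lambda>w. f w + f' w) (\<lambda>w. g w + g' w)) \<le> nrm (?D t f g) + nrm (?D t f' g')"
      using eventually_at_right_less[of "0::real"] by eventually_elim (rule le)
  qed auto
  then show ?thesis
    unfolding Lp_generator_def using L by (simp add: in_Lp_iff[symmetric] in_Lp_add)
qed

lemma generator_scaleR:
  assumes "Lp_generator M p T f g"
  shows "Lp_generator M p T (\<lambda>w. c *\<^sub>R f w) (\<lambda>w. c *\<^sub>R g w)"
proof -
  have L: "in_Lp f" "in_Lp g"
    using assms by (auto simp: Lp_generator_def in_Lp_iff)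
  let ?D = "\<lambda>t f g w. (T t f w - f w) /\<^sub>R t - g w"
  have DL: "in_Lp (?D t f g)" if "0 < t" "in_Lp f" "in_Lp g" for t f g
    using that by (intro in_Lp_diff in_Lp_scaleR T_in) auto
  have eq: "nrm (?D t (\<lambda>w. c *\<^sub>R f w) (\<lambda>w. c *\<^sub>R g w)) = \<bar>c\<bar> * nrm (?D t f g)" if t: "0 < t" for t
  proof -
    have "AE w in M. ?D t (\<lambda>w. c *\<^sub>R f w) (\<lambda>w. c *\<^sub>R g w) w = c *\<^sub>R ?D t f g w"
      using T_scaleR[OF less_imp_le[OF t] L(1), of c]
      by eventually_elim (simp add: scaleR_diff_right mult.commute)
    then have "nrm (?D t (\<lambda>w. c *\<^sub>R f w) (\<lambda>w. c *\<^sub>R g w)) = nrm (\<lambda>w. c *\<^sub>R ?D t f g w)"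
      by (rule nrm_cong_eq) (use t L in \<open>auto intro!: DL in_Lp_scaleR\<close>)
    then show ?thesis
      by (simp only: nrm_scaleR)
  qed
  have "((\<lambda>t. \<bar>c\<bar> * nrm (?D t f g)) \<longlongrightarrow> \<bar>c\<bar> * 0) (at_right 0)"
    using assms by (intro tendsto_mult_left) (auto simp: Lp_generator_def)
  moreover have "\<forall>\<^sub>F t in at_right 0. \<bar>c\<bar> * nrm (?D t f g) = nrm (?D t (\<lambda>w. c *\<^sub>R f w) (\<lambda>w. c *\<^sub>R g w))"
    using eventually_at_right_less[of "0::real"] by eventually_elim (simp only: eq)
  ultimately have "((\<lambda>t. nrm (?D t (\<lambda>w. c *\<^sub>R f w) (\<lambda>w. c *\<^sub>R g w))) \<longlongrightarrow> \<bar>c\<bar> * 0) (at_right 0)"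
    by (rule Lim_transform_eventually)
  then show ?thesis
    unfolding Lp_generator_def using L by (simp add: in_Lp_iff[symmetric] in_Lp_scaleR)
qed

lemma generator_cong:
  assumes "Lp_generator M p T f g" "in_Lp g'" "AE w in M. g' w = g w"
  shows "Lp_generator M p T f g'"
proof -
  have L: "in_Lp f" "in_Lp g"
    using assms by (auto simp: Lp_generator_def in_Lp_iff)
  let ?D = "\<lambda>t g w. (T t f w - f w) /\<^sub>R t - g w"
  have eq: "nrm (?D t g) = nrm (?D t g')" if t: "0 < t" for t
  proof (rule nrm_cong)
    show "AE w in M. cmod (?D t g w) = cmod (?D t g' w)"
      using assms(3) by eventually_elim simp
  qed (use t L assms(2) in \<open>intro in_Lp_measurable in_Lp_diff in_Lp_scaleR T_in; simp\<close>)+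
  have ev: "\<forall>\<^sub>F t in at_right 0. nrm (?D t g) = nrm (?D t g')"
    using eventually_at_right_less[of "0::real"] by eventually_elim (rule eq)
  have "((\<lambda>t. nrm (?D t g)) \<longlongrightarrow> 0) (at_right 0)"
    using assms(1) by (simp add: Lp_generator_def)
  then have "((\<lambda>t. nrm (?D t g')) \<longlongrightarrow> 0) (at_right 0)"
    by (rule Lim_transform_eventually) (rule ev)
  then show ?thesis
    unfolding Lp_generator_def using L assms(2) by (simp add: in_Lp_iff[symmetric])
qed

lemma generator_zero: "Lp_generator M p T (\<lambda>_. 0) (\<lambda>_. 0)"
proof -
  have zero: "nrm (\<lambda>w. (T t (\<lambda>_. 0) w - 0) /\<^sub>R t - 0) = 0" if "0 < t" for t
  proof -
    have "nrm (\<lambda>w. (T t (\<lambda>_. 0) w - 0) /\<^sub>R t - 0) = nrm (\<lambda>_. 0 :: complex)"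
      using T_zero[of t] that by (intro nrm_cong in_Lp_measurable in_Lp_diff in_Lp_scaleR T_in) auto
    then show ?thesis by simp
  qed
  have "\<forall>\<^sub>F t in at_right 0. 0 = nrm (\<lambda>w. (T t (\<lambda>_. 0) w - 0) /\<^sub>R t - 0)"
    using eventually_at_right_less[of "0::real"] by eventually_elim (simp only: zero)
  then have "((\<lambda>t. nrm (\<lambda>w. (T t (\<lambda>_. 0) w - 0) /\<^sub>R t - 0)) \<longlongrightarrow> 0) (at_right 0)"
    by (rule Lim_transform_eventually[OF tendsto_const])
  then show ?thesis
    by (simp add: Lp_generator_def in_Lp_iff[symmetric])
qed

lemma generator_sum:
  assumes "\<And>i. i \<in> I \<Longrightarrow> Lp_generator M p T (f i) (g i)"
  shows "Lp_generator M p T (\<lambda>w. \<Sum>i\<in>I. f i w) (\<lambda>w. \<Sum>i\<in>I. g i w)"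
  using assms
  by (induction I rule: infinite_finite_induct) (auto intro: generator_add generator_zero)

text \<open>The generator is known only as a right derivative at 0. Splitting [0,t] into n equal
  steps bounds the norm of T t y - y by n times that of a single step, which is t times the norm of
  a difference quotient that tends to zero.\<close>

lemma op_kernel_fixed:
  assumes y: "y \<in> op_kernel (Lp_generator M p T)" and t: "0 < t"
  shows "AE w in M. T t y w = y w"
proof -
  have yL: "in_Lp y" and lim: "((\<lambda>t. nrm (\<lambda>w. (T t y w - y w) /\<^sub>R t)) \<longlongrightarrow> 0) (at_right 0)"
    using y by (auto simp: op_kernel_def Lp_generator_def in_Lp_iff)
  have "nrm (\<lambda>w. T t y w - y w) \<le> t * nrm (\<lambda>w. (T (t / Suc n) y w - y w) /\<^sub>R (t / Suc n))" for n
  proof -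
    let ?h = "t / Suc n"
    have h: "0 \<le> ?h" using t by simp
    interpret S: regular_contraction M p "T ?h"
      by (rule regular_contraction_T[OF h])
    have "AE w in M. (T ?h ^^ Suc n) y w = T t y w"
      using T_pow[OF h yL, of "Suc n"] by simp
    then have "nrm (\<lambda>w. T t y w - y w) = nrm (\<lambda>w. (T ?h ^^ Suc n) y w - y w)"
      using t yL by (intro nrm_cong in_Lp_measurable in_Lp_diff T_in S.S_pow_in) auto
    also have "\<dots> \<le> real (Suc n) * nrm (\<lambda>w. T ?h y w - y w)"
      by (rule S.S_pow_diff_nrm[OF yL])
    also have "\<dots> = t * nrm (\<lambda>w. (T ?h y w - y w) /\<^sub>R ?h)"
      unfolding nrm_scaleR using t by (simp add: field_simps)
    finally show ?thesis .
  qed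
  moreover have "(\<lambda>n. t * nrm (\<lambda>w. (T (t / Suc n) y w - y w) /\<^sub>R (t / Suc n))) \<longlonglongrightarrow> t * 0"
  proof (intro tendsto_mult_left filterlim_compose[OF lim])
    have "(\<lambda>n. t * (1 / real (Suc n))) \<longlonglongrightarrow> t * 0"
      by (intro tendsto_mult_left LIMSEQ_Suc[OF lim_1_over_n])
    then show "filterlim (\<lambda>n. t / real (Suc n)) (at_right 0) sequentially"
      using t by (auto simp: filterlim_at)
  qed
  ultimately have "nrm (\<lambda>w. T t y w - y w) \<le> t * 0"
    by (intro tendsto_lowerbound[of _ _ sequentially]) auto
  then have "nrm (\<lambda>w. T t y w - y w) = 0"
    by (simp add: antisym)
  then show ?thesis
    using nrm_eq_0_iff[OF in_Lp_diff[OF T_in yL], of t y] t yL by simp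
qed

lemma fixed_in_op_kernel:
  assumes y: "in_Lp y" "\<And>t. 0 < t \<Longrightarrow> AE w in M. T t y w = y w"
  shows "y \<in> op_kernel (Lp_generator M p T)"
proof -
  have zero: "nrm (\<lambda>w. (T t y w - y w) /\<^sub>R t - 0) = 0" if t: "0 < t" for t
  proof -
    have "nrm (\<lambda>w. (T t y w - y w) /\<^sub>R t - 0) = nrm (\<lambda>_. 0 :: complex)"
      using y(2)[OF t] y(1) t by (intro nrm_cong in_Lp_measurable in_Lp_diff in_Lp_scaleR T_in) auto
    then show ?thesis by simp
  qed
  have "\<forall>\<^sub>F t in at_right 0. 0 = nrm (\<lambda>w. (T t y w - y w) /\<^sub>R t - 0)"
    using eventually_at_right_less[of "0::real"] by eventually_elim (simp only: zero)
  then have "((\<lambda>t. nrm (\<lambda>w. (T t y w - y w) /\<^sub>R t - 0)) \<longlongrightarrow> 0) (at_right 0)"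
    by (rule Lim_transform_eventually[OF tendsto_const])
  then show ?thesis
    using y(1) by (simp add: op_kernel_def Lp_generator_def in_Lp_iff[symmetric])
qed

text \<open>The difference of the two candidates is fixed by every T t and lies in the closure of
  the range of A. Elements of that range are nearly difference quotients, hence nearly in the range
  of T t - I, and \<open>nrm_fixed_le\<close> makes the norm of the difference as small as the
  approximation.\<close>

lemma kernel_component_unique:
  assumes y: "y \<in> op_kernel (Lp_generator M p T)"
      "(\<lambda>w. x w - y w) \<in> Lp_closure M p (op_range (Lp_generator M p T))"
    and z: "z \<in> op_kernel (Lp_generator M p T)"
      "(\<lambda>w. x w - z w) \<in> Lp_closure M p (op_range (Lp_generator M p T))"
  shows "AE w in M. y w = z w"
proof -
  have L: "in_Lp y" "in_Lp z"
    using y(1) z(1) by (auto simp: op_kernel_def Lp_generator_def in_Lp_iff)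
  have xL: "in_Lp (\<lambda>w. x w - y w)" "in_Lp (\<lambda>w. x w - z w)"
    using y(2) z(2) by (auto simp: Lp_closure_def in_Lp_iff)
  let ?d = "\<lambda>w. y w - z w"
  have dL: "in_Lp ?d"
    by (intro in_Lp_diff L)
  have dfix: "AE w in M. T t ?d w = ?d w" if "0 < t" for t
    using T_diff[OF less_imp_le[OF that] L] op_kernel_fixed[OF y(1) that] op_kernel_fixed[OF z(1) that]
    by eventually_elim simp
  have "nrm ?d \<le> 0 + e" if e: "0 < e" for e
  proof -
    obtain f g where fg: "Lp_generator M p T f g" "nrm (\<lambda>w. (x w - z w) - g w) < e / 3"
      using z(2) e by (auto simp: Lp_closure_def op_range_def dest!: spec[of _ "e/3"])
    obtain f' g' where fg': "Lp_generator M p T f' g'" "nrm (\<lambda>w. (x w - y w) - g' w) < e / 3"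
      using y(2) e by (auto simp: Lp_closure_def op_range_def dest!: spec[of _ "e/3"])
    define F where "F w = f w + (-1) *\<^sub>R f' w" for w
    define W where "W w = g w + (-1) *\<^sub>R g' w" for w
    have A: "Lp_generator M p T F W"
      unfolding F_def W_def by (intro generator_add fg generator_scaleR fg')
    then have FW: "in_Lp F" "in_Lp W" and lim: "((\<lambda>t. nrm (\<lambda>w. (T t F w - F w) /\<^sub>R t - W w)) \<longlongrightarrow> 0) (at_right 0)"
      by (auto simp: Lp_generator_def in_Lp_iff)
    have gL: "in_Lp g" "in_Lp g'"
      using fg fg' by (auto simp: Lp_generator_def in_Lp_iff)
    have "nrm (\<lambda>w. ?d w - W w) = nrm (\<lambda>w. ((x w - z w) - g w) - ((x w - y w) - g' w))"
      by (simp add: W_def algebra_simps)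
    also have "\<dots> \<le> nrm (\<lambda>w. ((x w - z w) - g w) - 0) + nrm (\<lambda>w. 0 - ((x w - y w) - g' w))"
      by (intro nrm_triangle_diff in_Lp_diff xL gL in_Lp_zero)
    also have "\<dots> < 2 * e / 3"
      using fg(2) fg'(2) nrm_minus_commute[of "\<lambda>_. 0" "\<lambda>w. (x w - y w) - g' w"] by simp
    finally have dW: "nrm (\<lambda>w. ?d w - W w) < 2 * e / 3" .
    have "\<forall>\<^sub>F t in at_right 0. nrm (\<lambda>w. (T t F w - F w) /\<^sub>R t - W w) < e / 3 \<and> 0 < t"
      using order_tendstoD(2)[OF lim, of "e / 3"] e eventually_at_right_less[of "0::real"]
      by (intro eventually_conj) auto
    then obtain t where t: "nrm (\<lambda>w. (T t F w - F w) /\<^sub>R t - W w) < e / 3" "0 < t"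
      using eventually_happens'[of "at_right (0::real)"] by force
    note t0 = less_imp_le[OF t(2)]
    \<comment> \<open>Rescaling F by 1/t turns the difference quotient into the form S f - f
      required by \<open>nrm_fixed_le\<close> with S = T t.\<close>
    let ?F = "\<lambda>w. inverse t *\<^sub>R F w"
    let ?q = "\<lambda>w. (T t F w - F w) /\<^sub>R t"
    have qL: "in_Lp ?q"
      by (intro in_Lp_scaleR in_Lp_diff T_in t0 FW)
    have "AE w in M. T t ?F w - ?F w = ?q w"
      using T_scaleR[OF t0 FW(1), of "inverse t"] by eventually_elim (simp add: scaleR_diff_right)
    then have "nrm (\<lambda>w. ?d w - (T t ?F w - ?F w)) = nrm (\<lambda>w. ?d w - ?q w)"
      by (intro nrm_cong in_Lp_measurable in_Lp_diff in_Lp_scaleR T_in t0 FW dL L) auto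
    moreover have "nrm ?d \<le> nrm (\<lambda>w. ?d w - (T t ?F w - ?F w))"
      by (rule regular_contraction.nrm_fixed_le[OF regular_contraction_T[OF t0] dL dfix[OF t(2)] in_Lp_scaleR[OF FW(1)]])
    moreover have "nrm (\<lambda>w. ?d w - ?q w) \<le> nrm (\<lambda>w. ?d w - W w) + nrm (\<lambda>w. W w - ?q w)"
      by (intro nrm_triangle_diff dL FW qL)
    moreover have "nrm (\<lambda>w. W w - ?q w) < e / 3"
      using t(1) nrm_minus_commute[of W ?q] by simp
    ultimately show ?thesis
      using dW by linarith
  qed
  then have "nrm ?d \<le> 0"
    by (rule field_le_epsilon)
  then have "nrm ?d = 0"
    by (simp add: antisym)
  then show ?thesis
    using nrm_eq_0_iff[OF dL] by simp
qed

end

section \<open>Uniform Riemann sums for the L^p-valued integral\<close>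

definition uniform_division :: "real \<Rightarrow> real \<Rightarrow> nat \<Rightarrow> (real \<times> real set) set" where
  "uniform_division a d n = (\<lambda>k. (a + real k * d, {a + real k * d..a + real (Suc k) * d})) ` {..<n}"

lemma tagged_uniform_division:
  assumes d: "0 < d" and n: "0 < n"
  shows "uniform_division a d n tagged_division_of {a..a + real n * d}"
  using n
proof (induction n rule: nat_induct_non_zero)
  case 1
  have "{(a, {a..a + d})} tagged_division_of {a..a + d}"
    using d by (intro tagged_division_of_self_real) auto
  then show ?case
    by (simp add: uniform_division_def lessThan_Suc)
next
  case (Suc n)
  let ?b = "a + real n * d"
  have e: "?b + d = a + real (Suc n) * d"
    by (simp add: algebra_simps)
  have "{(?b, {?b..?b + d})} tagged_division_of {?b..?b + d}"
    using d by (intro tagged_division_of_self_real) auto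
  then have "{(?b, {?b..?b + d})} \<union> uniform_division a d n tagged_division_of {?b..?b + d} \<union> {a..?b}"
    by (rule tagged_division_Un[OF _ Suc.IH]) (auto simp: interior_atLeastAtMost_real)
  moreover have "{?b..?b + d} \<union> {a..?b} = {a..a + real (Suc n) * d}"
  proof -
    have nd: "a \<le> ?b" "?b \<le> ?b + d" using d by simp_all
    show ?thesis
      unfolding e[symmetric] Un_commute[of "{?b..?b + d}"] by (rule ivl_disj_un_two_touch(4)[OF nd])
  qed
  moreover have "{(?b, {?b..?b + d})} \<union> uniform_division a d n = uniform_division a d (Suc n)"
    by (simp add: uniform_division_def lessThan_Suc e)
  ultimately show ?case by simp
qed

lemma sum_uniform_division:
  fixes F :: "real \<Rightarrow> complex"
  assumes d: "0 < d"
  shows "(\<Sum>(s, K)\<in>uniform_division a d n. measure lborel K *\<^sub>R F s)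
    = (\<Sum>k<n. d *\<^sub>R F (a + real k * d))"
proof -
  have "inj_on (\<lambda>k. (a + real k * d, {a + real k * d..a + real (Suc k) * d})) {..<n}"
    using d by (auto simp: inj_on_def)
  then have "(\<Sum>(s, K)\<in>uniform_division a d n. measure lborel K *\<^sub>R F s)
      = (\<Sum>k<n. measure lborel {a + real k * d..a + real (Suc k) * d} *\<^sub>R F (a + real k * d))"
    unfolding uniform_division_def by (subst sum.reindex) auto
  also have "\<dots> = (\<Sum>k<n. d *\<^sub>R F (a + real k * d))"
    using d by (intro sum.cong) (auto simp: algebra_simps)
  finally show ?thesis .
qed

lemma scaled_sum_diff_const:
  fixes c :: complex
  assumes "0 < n"
  shows "(1 / real n) *\<^sub>R (\<Sum>k<n. f k - c) = (1 / real n) *\<^sub>R (\<Sum>k<n. f k) - c"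
  using assms by (simp add: sum_subtractf scaleR_conv_of_real diff_divide_distrib)

lemma fine_uniform_division:
  assumes "0 < d" "d < \<delta>"
  shows "(\<lambda>s. ball s \<delta>) fine uniform_division a d n"
  using assms by (auto simp: fine_def uniform_division_def dist_real_def algebra_simps)

context Lp_space
begin

lemma has_Lp_integral_limit:
  assumes int: "has_Lp_integral M p F y a b"
    and D: "\<And>n. D n tagged_division_of {a..b}"
    and fine: "\<And>\<delta>. 0 < \<delta> \<Longrightarrow> \<forall>\<^sub>F n in sequentially. (\<lambda>s. ball s \<delta>) fine D n"
  shows "(\<lambda>n. nrm (\<lambda>w. (\<Sum>(s, K)\<in>D n. measure lborel K *\<^sub>R F s w) - y w)) \<longlonglongrightarrow> 0"
proof (rule tendstoI)
  fix e :: real assume "0 < e"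
  then obtain \<delta> where \<delta>: "0 < \<delta>" "\<And>D. D tagged_division_of {a..b} \<Longrightarrow> (\<lambda>s. ball s \<delta>) fine D \<Longrightarrow>
      nrm (\<lambda>w. (\<Sum>(s, K)\<in>D. measure lborel K *\<^sub>R F s w) - y w) < e"
    using int unfolding has_Lp_integral_def by blast
  show "\<forall>\<^sub>F n in sequentially. dist (nrm (\<lambda>w. (\<Sum>(s, K)\<in>D n. measure lborel K *\<^sub>R F s w) - y w)) 0 < e"
    using fine[OF \<delta>(1)] by eventually_elim (use \<delta>(2)[OF D] in simp)
qed

lemma uniform_Riemann_sums_limit:
  assumes int: "has_Lp_integral M p F y 0 t" and t: "0 < t"
  shows "(\<lambda>n. nrm (\<lambda>w. (\<Sum>k<Suc n. (t / Suc n) *\<^sub>R F (real k * (t / Suc n)) w) - y w)) \<longlonglongrightarrow> 0"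
proof -
  have "(\<lambda>n. nrm (\<lambda>w. (\<Sum>(s, K)\<in>uniform_division 0 (t / Suc n) (Suc n). measure lborel K *\<^sub>R F s w) - y w)) \<longlonglongrightarrow> 0"
  proof (rule has_Lp_integral_limit[OF int])
    show "uniform_division 0 (t / real (Suc n)) (Suc n) tagged_division_of {0..t}" for n
      using tagged_uniform_division[of "t / Suc n" "Suc n" 0] t by simp
    fix \<delta> :: real assume "0 < \<delta>"
    moreover have "(\<lambda>n. t * (1 / real (Suc n))) \<longlonglongrightarrow> t * 0"
      by (intro tendsto_mult_left LIMSEQ_Suc[OF lim_1_over_n])
    ultimately have "\<forall>\<^sub>F n in sequentially. t / real (Suc n) < \<delta>"
      by (intro order_tendstoD(2)) auto
    then show "\<forall>\<^sub>F n in sequentially. (\<lambda>s. ball s \<delta>) fine uniform_division 0 (t / real (Suc n)) (Suc n)"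
      by eventually_elim (use t in \<open>intro fine_uniform_division; simp\<close>)
  qed
  then show ?thesis
    using t by (subst (asm) sum_uniform_division) auto
qed

text \<open>The division is made to have a node at t, so that for an orbit the second sum is T t
  applied to a Riemann sum over [0,s]. The mesh may differ on the two halves.\<close>

lemma split_Riemann_sums_limit:
  assumes int: "has_Lp_integral M p F y 0 (t + s)" and t: "0 < t" and s: "0 < s"
  shows "(\<lambda>n. nrm (\<lambda>w. (\<Sum>k<Suc n. (t / Suc n) *\<^sub>R F (real k * (t / Suc n)) w)
    + (\<Sum>k<Suc n. (s / Suc n) *\<^sub>R F (t + real k * (s / Suc n)) w) - y w)) \<longlonglongrightarrow> 0"
proof -
  define A where "A n = uniform_division 0 (t / Suc n) (Suc n)" for n
  define B where "B n = uniform_division t (s / Suc n) (Suc n)" for n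
  have small: "\<forall>\<^sub>F n in sequentially. r / real (Suc n) < \<delta>" if "0 < \<delta>" for \<delta> r :: real
  proof -
    have "(\<lambda>n. r * (1 / real (Suc n))) \<longlonglongrightarrow> r * 0"
      by (intro tendsto_mult_left LIMSEQ_Suc[OF lim_1_over_n])
    with that show ?thesis
      by (intro order_tendstoD(2)) auto
  qed
  have "(\<lambda>n. nrm (\<lambda>w. (\<Sum>(s, K)\<in>A n \<union> B n. measure lborel K *\<^sub>R F s w) - y w)) \<longlonglongrightarrow> 0"
  proof (rule has_Lp_integral_limit[OF int])
    fix n
    have "A n tagged_division_of {0..t}"
      unfolding A_def using tagged_uniform_division[of "t / Suc n" "Suc n" 0] t by simp
    moreover have "B n tagged_division_of {t..t + s}"
      unfolding B_def using tagged_uniform_division[of "s / Suc n" "Suc n" t] s by simp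
    ultimately have "A n \<union> B n tagged_division_of {0..t} \<union> {t..t + s}"
      by (rule tagged_division_Un) (auto simp: interior_atLeastAtMost_real)
    moreover have "{0..t} \<union> {t..t + s} = {0..t + s}"
      using t s by auto
    ultimately show "A n \<union> B n tagged_division_of {0..t + s}"
      by simp
  next
    fix \<delta> :: real assume \<delta>: "0 < \<delta>"
    show "\<forall>\<^sub>F n in sequentially. (\<lambda>s. ball s \<delta>) fine A n \<union> B n"
      using small[OF \<delta>, of t] small[OF \<delta>, of s]
      by eventually_elim (use t s in \<open>auto simp: A_def B_def intro!: fine_Un fine_uniform_division\<close>)
  qed
  moreover have "(\<Sum>(s, K)\<in>A n \<union> B n. measure lborel K *\<^sub>R F s w)
      = (\<Sum>k<Suc n. (t / Suc n) *\<^sub>R F (real k * (t / Suc n)) w)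
        + (\<Sum>k<Suc n. (s / Suc n) *\<^sub>R F (t + real k * (s / Suc n)) w)" for n w
  proof -
    \<comment> \<open>The tags of A n lie strictly to the left of t and those of B n do not, so the
      sum over the union splits.\<close>
    have disj: "A n \<inter> B n = {}"
    proof (rule ccontr)
      assume "A n \<inter> B n \<noteq> {}"
      then obtain k l where kl: "k < Suc n" "real k * (t / Suc n) = t + real l * (s / Suc n)"
        unfolding A_def B_def uniform_division_def by auto
      have "real k * (t / Suc n) < real (Suc n) * (t / Suc n)"
        using kl(1) t by (intro mult_strict_right_mono) auto
      also have "\<dots> = t"
        by simp
      also have "t \<le> t + real l * (s / Suc n)"
        using s by simp
      finally show False
        using kl(2) by simp
    qed
    have "finite (A n)" "finite (B n)"
      by (auto simp: A_def B_def uniform_division_def)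
    then have "(\<Sum>(s, K)\<in>A n \<union> B n. measure lborel K *\<^sub>R F s w)
        = (\<Sum>(s, K)\<in>A n. measure lborel K *\<^sub>R F s w) + (\<Sum>(s, K)\<in>B n. measure lborel K *\<^sub>R F s w)"
      using disj by (rule sum.union_disjoint)
    then show ?thesis
      unfolding A_def B_def using t s by (simp only: sum_uniform_division divide_pos_pos of_nat_0_less_iff zero_less_Suc add_0)
  qed
  ultimately show ?thesis by simp
qed

end

section \<open>Representatives of the means and their algebra\<close>

locale semigroup_means = contraction_semigroup +
  fixes x :: "'a \<Rightarrow> complex" and m :: "real \<Rightarrow> 'a \<Rightarrow> complex"
  assumes x: "in_Lp x"
    and means: "\<And>t. 0 < t \<Longrightarrow> represents_mean M p T t x (m t)"
begin

lemma means_integral: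
  assumes "0 < t"
  obtains z where "has_Lp_integral M p (\<lambda>s. T s x) z 0 t" "in_Lp z" "AE w in M. z w = t *\<^sub>R m t w"
proof -
  obtain z where z: "has_Lp_integral M p (\<lambda>s. T s x) z 0 t" "AE w in M. m t w = (1 / t) *\<^sub>R z w"
    using means[OF assms] by (auto simp: represents_mean_def)
  moreover have "in_Lp z"
    using z(1) by (simp add: has_Lp_integral_def in_Lp_iff)
  moreover have "AE w in M. z w = t *\<^sub>R m t w"
    using z(2) by eventually_elim (use assms in simp)
  ultimately show thesis
    using that by blast
qed

lemma in_Lp_m: "0 < t \<Longrightarrow> in_Lp (m t)"
proof -
  assume t: "0 < t"
  obtain z where z: "has_Lp_integral M p (\<lambda>s. T s x) z 0 t" "in_Lp z" "AE w in M. z w = t *\<^sub>R m t w"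
    by (rule means_integral[OF t])
  have "m t \<in> borel_measurable M"
    using means[OF t] by (auto simp: represents_mean_def)
  moreover have "AE w in M. m t w = (1 / t) *\<^sub>R z w"
    using z(3) by eventually_elim (use t in simp)
  ultimately show ?thesis
    using in_Lp_cong[OF _ _ in_Lp_scaleR[OF z(2), of "1 / t"]] by blast
qed

lemma mean_scaleR:
  assumes "0 < n"
  shows "(\<Sum>k<n. (t / real n) *\<^sub>R T (real k * (t / real n)) x w) = t *\<^sub>R mean (t / real n) n x w"
  using assms by (simp add: mean_def scaleR_sum_right)

lemma mean_limit:
  assumes t: "0 < t"
  shows "(\<lambda>n. nrm (\<lambda>w. mean (t / Suc n) (Suc n) x w - m t w)) \<longlonglongrightarrow> 0"
proof -
  obtain z where z: "has_Lp_integral M p (\<lambda>s. T s x) z 0 t" "in_Lp z" "AE w in M. z w = t *\<^sub>R m t w"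
    by (rule means_integral[OF t])
  have mL: "in_Lp (mean (t / Suc n) (Suc n) x)" for n
    using t by (intro in_Lp_mean x) auto
  have "nrm (\<lambda>w. t *\<^sub>R mean (t / Suc n) (Suc n) x w - z w)
      = t * nrm (\<lambda>w. mean (t / Suc n) (Suc n) x w - m t w)" for n
  proof -
    have "AE w in M. t *\<^sub>R mean (t / Suc n) (Suc n) x w - z w = t *\<^sub>R (mean (t / Suc n) (Suc n) x w - m t w)"
      using z(3) by eventually_elim (simp add: scaleR_diff_right)
    then have "nrm (\<lambda>w. t *\<^sub>R mean (t / Suc n) (Suc n) x w - z w)
        = nrm (\<lambda>w. t *\<^sub>R (mean (t / Suc n) (Suc n) x w - m t w))"
      by (rule nrm_cong_eq) (intro in_Lp_diff in_Lp_scaleR mL z(2) in_Lp_m t)+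
    then show ?thesis
      unfolding nrm_scaleR using t by simp
  qed
  then have "(\<lambda>n. t * nrm (\<lambda>w. mean (t / Suc n) (Suc n) x w - m t w)) \<longlonglongrightarrow> 0"
    using uniform_Riemann_sums_limit[OF z(1) t] by (simp only: mean_scaleR[OF zero_less_Suc])
  from tendsto_mult_left[OF this, of "1 / t"] show ?thesis
    using t by simp
qed

text \<open>The integral over [0,t+s] is the one over [0,t] plus T t applied to the one over [0,s]:
  Riemann sums with a node at t converge in norm to both sides. Comparing this identity with the one
  where t and s are exchanged is the source of \<open>generator_m\<close> and
  \<open>T_m_diff\<close>.\<close>

lemma m_additive:
  assumes t: "0 < t" and s: "0 < s"
  shows "AE w in M. (t + s) *\<^sub>R m (t + s) w = t *\<^sub>R m t w + s *\<^sub>R T t (m s) w"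
proof -
  obtain z where z: "has_Lp_integral M p (\<lambda>s. T s x) z 0 (t + s)" "in_Lp z" "AE w in M. z w = (t + s) *\<^sub>R m (t + s) w"
    by (rule means_integral[OF add_pos_pos[OF t s]])
  define A where "A n = mean (t / Suc n) (Suc n) x" for n
  define B where "B n = mean (s / Suc n) (Suc n) x" for n
  have AL: "in_Lp (A n)" for n
    unfolding A_def using t by (intro in_Lp_mean x) auto
  have BL: "in_Lp (B n)" for n
    unfolding B_def using s by (intro in_Lp_mean x) auto
  have t0: "0 \<le> t" using t by simp
  note TB = T_in[OF t0 BL]
  have TBeq: "AE w in M. (\<Sum>k<Suc n. (s / Suc n) *\<^sub>R T (t + real k * (s / Suc n)) x w) = s *\<^sub>R T t (B n) w" for n
  proof -
    have nn: "0 \<le> real k * (s / real (Suc n))" for k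
      using s by simp
    have "AE w in M. T t (B n) w = (1 / real (Suc n)) *\<^sub>R T t (\<lambda>w. \<Sum>k<Suc n. T (real k * (s / Suc n)) x w) w"
      unfolding B_def mean_def by (intro T_scaleR t0 in_Lp_sum T_in nn x)
    moreover have "AE w in M. T t (\<lambda>w. \<Sum>k<Suc n. T (real k * (s / Suc n)) x w) w
        = (\<Sum>k<Suc n. T t (T (real k * (s / Suc n)) x) w)"
      by (intro T_sum t0 T_in nn x)
    moreover have "AE w in M. \<forall>k. T (t + real k * (s / Suc n)) x w = T t (T (real k * (s / Suc n)) x) w"
      unfolding AE_all_countable by (intro allI T_plus t0 nn x)
    ultimately show ?thesis
      by eventually_elim (simp only: scaleR_sum_right[symmetric] scaleR_scaleR, simp)
  qed
  have lim: "(\<lambda>n. nrm (\<lambda>w. (t *\<^sub>R A n w + s *\<^sub>R T t (B n) w) - z w)) \<longlonglongrightarrow> 0"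
  proof -
    have "nrm (\<lambda>w. (\<Sum>k<Suc n. (t / Suc n) *\<^sub>R T (real k * (t / Suc n)) x w)
        + (\<Sum>k<Suc n. (s / Suc n) *\<^sub>R T (t + real k * (s / Suc n)) x w) - z w)
        = nrm (\<lambda>w. (t *\<^sub>R A n w + s *\<^sub>R T t (B n) w) - z w)" (is "nrm ?l = nrm ?r") for n
    proof (rule nrm_cong_eq)
      show "AE w in M. ?l w = ?r w"
        using TBeq[of n] by eventually_elim (simp only: A_def mean_scaleR[OF zero_less_Suc])
      show "in_Lp ?l"
        using t s by (intro in_Lp_diff in_Lp_add in_Lp_sum in_Lp_scaleR T_in x z(2)) auto
      show "in_Lp ?r"
        by (intro in_Lp_diff in_Lp_add in_Lp_scaleR AL TB z(2))
    qed
    then show ?thesis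
      using split_Riemann_sums_limit[OF z(1) t s] by simp
  qed
  let ?u = "\<lambda>w. t *\<^sub>R m t w + s *\<^sub>R T t (m s) w"
  have wL: "in_Lp ?u"
    by (intro in_Lp_add in_Lp_scaleR in_Lp_m t s T_in t0)
  have lim2: "(\<lambda>n. nrm (\<lambda>w. (t *\<^sub>R A n w + s *\<^sub>R T t (B n) w) - ?u w)) \<longlonglongrightarrow> 0"
  proof (rule tendsto_sandwich[of "\<lambda>_. 0"])
    have "(\<lambda>n. t * nrm (\<lambda>w. A n w - m t w) + s * nrm (\<lambda>w. B n w - m s w)) \<longlonglongrightarrow> t * 0 + s * 0"
      unfolding A_def B_def by (intro tendsto_add tendsto_mult_left mean_limit t s)
    then show "(\<lambda>n. t * nrm (\<lambda>w. A n w - m t w) + s * nrm (\<lambda>w. B n w - m s w)) \<longlonglongrightarrow> 0"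
      by simp
    have "nrm (\<lambda>w. (t *\<^sub>R A n w + s *\<^sub>R T t (B n) w) - ?u w)
        \<le> t * nrm (\<lambda>w. A n w - m t w) + s * nrm (\<lambda>w. B n w - m s w)" for n
    proof -
      have eq: "(\<lambda>w. (t *\<^sub>R A n w + s *\<^sub>R T t (B n) w) - ?u w)
          = (\<lambda>w. t *\<^sub>R (A n w - m t w) + s *\<^sub>R (T t (B n) w - T t (m s) w))"
        by (simp add: scaleR_diff_right algebra_simps)
      have "nrm (\<lambda>w. (t *\<^sub>R A n w + s *\<^sub>R T t (B n) w) - ?u w)
          \<le> nrm (\<lambda>w. t *\<^sub>R (A n w - m t w)) + nrm (\<lambda>w. s *\<^sub>R (T t (B n) w - T t (m s) w))"
        unfolding eq by (intro nrm_triangle in_Lp_scaleR in_Lp_diff AL TB in_Lp_m T_in t0 t s)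
      also have "\<dots> = t * nrm (\<lambda>w. A n w - m t w) + s * nrm (\<lambda>w. T t (B n) w - T t (m s) w)"
        unfolding nrm_scaleR using t s by simp
      also have "\<dots> \<le> t * nrm (\<lambda>w. A n w - m t w) + s * nrm (\<lambda>w. B n w - m s w)"
        using s by (intro add_left_mono mult_left_mono T_nrm_diff t0 BL in_Lp_m) auto
      finally show ?thesis .
    qed
    then show "\<forall>\<^sub>F n in sequentially. nrm (\<lambda>w. (t *\<^sub>R A n w + s *\<^sub>R T t (B n) w) - ?u w)
        \<le> t * nrm (\<lambda>w. A n w - m t w) + s * nrm (\<lambda>w. B n w - m s w)"
      by simp
  qed auto
  have "AE w in M. z w = ?u w"
    by (rule nrm_tendsto_unique[OF _ z(2) wL lim lim2]) (intro in_Lp_add in_Lp_scaleR AL TB)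
  with z(3) show ?thesis
    by eventually_elim simp
qed

lemma m_tendsto_0: "((\<lambda>t. nrm (\<lambda>w. m t w - x w)) \<longlongrightarrow> 0) (at_right 0)"
proof (rule tendstoI)
  fix e :: real assume e: "0 < e"
  have "\<forall>\<^sub>F t in at_right 0. nrm (\<lambda>w. T t x w - x w) < e / 2"
    using order_tendstoD(2)[OF T_right_continuous[OF x], of "e / 2"] e by simp
  then obtain b where b: "0 < b" "\<And>t. 0 < t \<Longrightarrow> t < b \<Longrightarrow> nrm (\<lambda>w. T t x w - x w) < e / 2"
    by (auto simp: eventually_at_right_field)
  \<comment> \<open>The leftmost tag of each Riemann sum is 0, a time that the limit from the right
    says nothing about.\<close>
  have T0: "nrm (\<lambda>w. T 0 x w - x w) = 0"
    using nrm_eq_0_iff[OF in_Lp_diff[OF T_in x], of 0 x] T_0[OF x] x by simp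
  have "nrm (\<lambda>w. m t w - x w) < e" if t: "0 < t" "t < b" for t
  proof -
    have le: "nrm (\<lambda>w. m t w - x w) \<le> nrm (\<lambda>w. mean (t / Suc n) (Suc n) x w - m t w) + e / 2" for n
    proof -
      let ?A = "mean (t / Suc n) (Suc n) x"
      have AL: "in_Lp ?A"
        using t by (intro in_Lp_mean x) auto
      have nn: "0 \<le> real k * (t / real (Suc n))" for k
        using t by simp
      have "nrm (\<lambda>w. ?A w - x w) = nrm (\<lambda>w. (1 / real (Suc n)) *\<^sub>R (\<Sum>k<Suc n. T (real k * (t / Suc n)) x w - x w))"
        by (simp only: mean_def scaled_sum_diff_const[OF zero_less_Suc])
      also have "\<dots> = nrm (\<lambda>w. \<Sum>k<Suc n. T (real k * (t / Suc n)) x w - x w) / real (Suc n)"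
        unfolding nrm_scaleR by simp
      also have "\<dots> \<le> (\<Sum>k<Suc n. nrm (\<lambda>w. T (real k * (t / Suc n)) x w - x w)) / real (Suc n)"
        by (intro divide_right_mono nrm_sum in_Lp_diff T_in nn x) auto
      also have "\<dots> \<le> (\<Sum>k<Suc n. e / 2) / real (Suc n)"
      proof (intro divide_right_mono sum_mono)
        fix k assume k: "k \<in> {..<Suc n}"
        have "real k * (t / Suc n) \<le> real (Suc n) * (t / Suc n)"
          using k t by (intro mult_right_mono) auto
        then have "real k * (t / Suc n) < b"
          using t(2) by simp
        then show "nrm (\<lambda>w. T (real k * (t / Suc n)) x w - x w) \<le> e / 2"
          using b(2)[of "real k * (t / Suc n)"] T0 e t(1) by (cases "k = 0") (auto intro: less_imp_le)
      qed simp
      also have "\<dots> = e / 2"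
        by (simp del: of_nat_Suc)
      finally have "nrm (\<lambda>w. ?A w - x w) \<le> e / 2" .
      moreover have "nrm (\<lambda>w. m t w - x w) \<le> nrm (\<lambda>w. m t w - ?A w) + nrm (\<lambda>w. ?A w - x w)"
        by (intro nrm_triangle_diff in_Lp_m t AL x)
      ultimately show ?thesis
        by (simp add: nrm_minus_commute[of "m t"])
    qed
    have "(\<lambda>n. nrm (\<lambda>w. mean (t / Suc n) (Suc n) x w - m t w) + e / 2) \<longlonglongrightarrow> 0 + e / 2"
      by (intro tendsto_add mean_limit t tendsto_const)
    then have "nrm (\<lambda>w. m t w - x w) \<le> 0 + e / 2"
      using le by (intro tendsto_lowerbound[of _ _ sequentially]) auto
    then show ?thesis
      using e by simp
  qed
  then have "\<forall>\<^sub>F t in at_right 0. nrm (\<lambda>w. m t w - x w) < e"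
    using b(1) by (auto simp: eventually_at_right_field)
  then show "\<forall>\<^sub>F t in at_right 0. dist (nrm (\<lambda>w. m t w - x w)) 0 < e"
    by simp
qed

text \<open>A maps the integral Z of the orbit over [0,s] to T s x - x. Exchanging s and h in
  \<open>m_additive\<close> gives T h Z - Z = h (T s (m h) - m h), and m h tends to x in
  norm.\<close>

lemma generator_m:
  assumes s: "0 < s"
  shows "Lp_generator M p T (\<lambda>w. s *\<^sub>R m s w) (\<lambda>w. T s x w - x w)"
proof -
  have s0: "0 \<le> s" using s by simp
  let ?Z = "\<lambda>w. s *\<^sub>R m s w" and ?g = "\<lambda>w. T s x w - x w"
  have ZL: "in_Lp ?Z" and gL: "in_Lp ?g"
    using s0 s x by (auto intro!: in_Lp_scaleR in_Lp_m in_Lp_diff T_in)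
  have le: "nrm (\<lambda>w. (T h ?Z w - ?Z w) /\<^sub>R h - ?g w) \<le> 2 * nrm (\<lambda>w. m h w - x w)" if h: "0 < h" for h
  proof -
    have h0: "0 \<le> h" using h by simp
    note mh = in_Lp_m[OF h]
    have "AE w in M. T h ?Z w = s *\<^sub>R T h (m s) w"
      by (intro T_scaleR h0 in_Lp_m s)
    then have "AE w in M. (T h ?Z w - ?Z w) /\<^sub>R h - ?g w = (T s (m h) w - T s x w) + (x w - m h w)"
      using m_additive[OF h s] m_additive[OF s h]
    proof eventually_elim
      case (elim w)
      have "h *\<^sub>R m h w + s *\<^sub>R T h (m s) w = s *\<^sub>R m s w + h *\<^sub>R T s (m h) w"
        using elim(2,3) by (simp add: add.commute)
      then have "T h ?Z w - ?Z w = h *\<^sub>R (T s (m h) w - m h w)"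
        unfolding elim(1) by (simp add: scaleR_diff_right algebra_simps)
      then show ?case
        using h by simp
    qed
    then have "nrm (\<lambda>w. (T h ?Z w - ?Z w) /\<^sub>R h - ?g w)
        = nrm (\<lambda>w. (T s (m h) w - T s x w) + (x w - m h w))"
      by (rule nrm_cong_eq) (intro in_Lp_add in_Lp_diff in_Lp_scaleR T_in h0 s0 x mh in_Lp_m s)+
    also have "\<dots> \<le> nrm (\<lambda>w. T s (m h) w - T s x w) + nrm (\<lambda>w. x w - m h w)"
      by (intro nrm_triangle in_Lp_diff T_in s0 x mh)
    also have "\<dots> \<le> nrm (\<lambda>w. m h w - x w) + nrm (\<lambda>w. m h w - x w)"
      by (intro add_mono T_nrm_diff s0 x mh) (simp add: nrm_minus_commute)
    finally show ?thesis by simp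
  qed
  have "((\<lambda>h. nrm (\<lambda>w. (T h ?Z w - ?Z w) /\<^sub>R h - ?g w)) \<longlongrightarrow> 0) (at_right 0)"
  proof (rule tendsto_sandwich[of "\<lambda>_. 0"])
    show "((\<lambda>h. 2 * nrm (\<lambda>w. m h w - x w)) \<longlongrightarrow> 0) (at_right 0)"
      using tendsto_mult_left[OF m_tendsto_0, of 2] by simp
    show "\<forall>\<^sub>F h in at_right 0. nrm (\<lambda>w. (T h ?Z w - ?Z w) /\<^sub>R h - ?g w) \<le> 2 * nrm (\<lambda>w. m h w - x w)"
      using eventually_at_right_less[of "0::real"] by eventually_elim (rule le)
  qed auto
  then show ?thesis
    unfolding Lp_generator_def using ZL gL by (simp add: in_Lp_iff[symmetric])
qed

text \<open>x minus a Riemann mean is minus the mean of the differences T (k h) x - x, each of which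
  is in the range by \<open>generator_m\<close>.\<close>

lemma diff_mean_in_range:
  assumes h: "0 < h" and n: "0 < n"
  shows "(\<lambda>w. x w - mean h n x w) \<in> op_range (Lp_generator M p T)"
proof -
  \<comment> \<open>Time 0 gets its own clause, since nothing is known about
    \<open>m 0\<close>.\<close>
  define f where "f k w = (if k = 0 then 0 else (real k * h) *\<^sub>R m (real k * h) w)" for k w
  have gen: "Lp_generator M p T (f k) (\<lambda>w. T (real k * h) x w - x w)" for k
  proof (cases "k = 0")
    case True
    have "Lp_generator M p T (\<lambda>_. 0) (\<lambda>w. T 0 x w - x w)"
    proof (rule generator_cong[OF generator_zero])
      show "AE w in M. T 0 x w - x w = 0"
        using T_0[OF x] by eventually_elim simp
    qed (intro in_Lp_diff T_in x, simp)
    with True show ?thesis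
      by (simp add: f_def[abs_def])
  next
    case False
    then have "0 < real k * h"
      using h by simp
    from generator_m[OF this] False show ?thesis
      by (simp add: f_def[abs_def])
  qed
  have "Lp_generator M p T (\<lambda>w. (- (1 / real n)) *\<^sub>R (\<Sum>k<n. f k w))
      (\<lambda>w. (- (1 / real n)) *\<^sub>R (\<Sum>k<n. T (real k * h) x w - x w))"
    by (intro generator_scaleR generator_sum gen)
  moreover have "(- (1 / real n)) *\<^sub>R (\<Sum>k<n. T (real k * h) x w - x w) = x w - mean h n x w" for w
    unfolding scaleR_minus_left scaled_sum_diff_const[OF n] mean_def by simp
  ultimately show ?thesis
    by (auto simp: op_range_def)
qed

end

section \<open>Dyadic times\<close>

definition dyadics :: "real set" where
  "dyadics = {real i / 2 ^ j | i j. 0 < i}"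

lemma countable_dyadics: "countable dyadics"
proof -
  have "dyadics \<subseteq> (\<lambda>(i, j). real i / 2 ^ j) ` (UNIV :: (nat \<times> nat) set)"
    by (auto simp: dyadics_def)
  then show ?thesis
    by (rule countable_subset) auto
qed

lemma dyadics_pos: "t \<in> dyadics \<Longrightarrow> 0 < t"
  by (auto simp: dyadics_def)

lemma grid_in_dyadics: "0 < i \<Longrightarrow> real i * (1 / 2 ^ j) \<in> dyadics"
  by (auto simp: dyadics_def)

lemma one_in_dyadics: "1 \<in> dyadics"
  using grid_in_dyadics[of 1 0] by simp

text \<open>Rounding provides a grid index for every j, exact for all large j; finitely many dyadic
  times can thus be placed on one common grid by intersecting eventual statements.\<close>

lemma dyadics_grid:
  assumes "t \<in> dyadics"
  shows "\<forall>\<^sub>F j in sequentially. 0 < nat \<lfloor>t * 2 ^ j\<rfloor> \<and> real (nat \<lfloor>t * 2 ^ j\<rfloor>) = t * 2 ^ j"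
proof -
  obtain i j0 where ij: "t = real i / 2 ^ j0" "0 < i"
    using assms by (auto simp: dyadics_def)
  have "0 < nat \<lfloor>t * 2 ^ j\<rfloor> \<and> real (nat \<lfloor>t * 2 ^ j\<rfloor>) = t * 2 ^ j" if "j0 \<le> j" for j
  proof -
    have "(2::real) ^ j = 2 ^ j0 * 2 ^ (j - j0)"
      using that by (simp flip: power_add)
    then have eq: "t * 2 ^ j = real (i * 2 ^ (j - j0))"
      by (simp add: ij(1))
    show ?thesis
      unfolding eq floor_of_nat nat_int using ij(2) by simp
  qed
  then show ?thesis
    unfolding eventually_sequentially by blast
qed

text \<open>Rounding up gives dyadic points strictly above t. They stay in the half line where
  \<phi> is continuous, and they are eventually below b because t < b.\<close>

lemma le_from_dyadics:
  fixes \<phi> :: "real \<Rightarrow> real"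
  assumes cont: "continuous_on {0<..} \<phi>" and le: "\<And>s. s \<in> dyadics \<Longrightarrow> s < b \<Longrightarrow> \<phi> s \<le> c"
    and t: "0 < t" "t < b"
  shows "\<phi> t \<le> c"
proof -
  define d where "d j = real (Suc (nat \<lfloor>t * 2 ^ j\<rfloor>)) * (1 / 2 ^ j)" for j
  have d: "t < d j" "d j \<le> t + (1/2) ^ j" "d j \<in> dyadics" for j
  proof -
    have "0 \<le> \<lfloor>t * 2 ^ j\<rfloor>"
      using t by simp
    then have e: "d j = (real_of_int \<lfloor>t * 2 ^ j\<rfloor> + 1) / 2 ^ j"
      by (simp add: d_def add.commute)
    have "t * 2 ^ j < real_of_int \<lfloor>t * 2 ^ j\<rfloor> + 1" "real_of_int \<lfloor>t * 2 ^ j\<rfloor> \<le> t * 2 ^ j"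
      by linarith+
    then show "t < d j" "d j \<le> t + (1/2) ^ j"
      unfolding e by (simp_all add: field_simps power_one_over)
    show "d j \<in> dyadics"
      unfolding d_def by (rule grid_in_dyadics) simp
  qed
  have lim: "d \<longlonglongrightarrow> t"
  proof (rule tendsto_sandwich[of "\<lambda>_. t" _ _ "\<lambda>j. t + (1/2) ^ j"])
    have "(\<lambda>j. t + (1/2) ^ j) \<longlonglongrightarrow> t + 0"
      by (intro tendsto_add tendsto_const LIMSEQ_power_zero) simp
    then show "(\<lambda>j. t + (1/2) ^ j) \<longlonglongrightarrow> t"
      by simp
  qed (use d in \<open>auto intro!: always_eventually less_imp_le\<close>)
  have "continuous (at t) \<phi>"
    using cont t(1) continuous_on_eq_continuous_at[OF open_greaterThan, of 0 \<phi>] by auto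
  then have "(\<lambda>j. \<phi> (d j)) \<longlonglongrightarrow> \<phi> t"
    by (rule continuous_imp_tendsto[unfolded o_def, OF _ lim])
  moreover have "\<forall>\<^sub>F j in sequentially. \<phi> (d j) \<le> c"
    using order_tendstoD(2)[OF lim t(2)] by eventually_elim (intro le d)
  ultimately show ?thesis
    by (rule tendsto_upperbound) simp
qed

section \<open>The maximal inequality for the means and convergence at 0\<close>

context semigroup_means
begin

lemma dyadic_mean_limit:
  assumes t: "t \<in> dyadics"
  shows "(\<lambda>j. nrm (\<lambda>w. m t w - mean (1 / 2 ^ j) (nat \<lfloor>t * 2 ^ j\<rfloor>) x w)) \<longlonglongrightarrow> 0"
proof -
  have t0: "0 < t"
    by (rule dyadics_pos[OF t])
  define g where "g n = nrm (\<lambda>w. mean (t / real n) n x w - m t w)" for n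
  have "g \<longlonglongrightarrow> 0"
    using mean_limit[OF t0] unfolding g_def by (rule LIMSEQ_imp_Suc)
  moreover have "filterlim (\<lambda>j. nat \<lfloor>t * 2 ^ j\<rfloor>) at_top sequentially"
  proof -
    have "filterlim (\<lambda>j. t * 2 ^ j) at_top sequentially"
      by (rule filterlim_tendsto_pos_mult_at_top[OF tendsto_const t0]) (rule filterlim_at_top_mono[OF filterlim_real_sequentially], simp add: less_imp_le)
    then show ?thesis
      by (intro filterlim_compose[OF filterlim_nat_sequentially] filterlim_compose[OF filterlim_floor_sequentially])
  qed
  ultimately have "(\<lambda>j. g (nat \<lfloor>t * 2 ^ j\<rfloor>)) \<longlonglongrightarrow> 0"
    by (rule filterlim_compose)
  moreover have "\<forall>\<^sub>F j in sequentially. g (nat \<lfloor>t * 2 ^ j\<rfloor>)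
      = nrm (\<lambda>w. m t w - mean (1 / 2 ^ j) (nat \<lfloor>t * 2 ^ j\<rfloor>) x w)"
    using dyadics_grid[OF t]
  proof eventually_elim
    case (elim j)
    have "t / real (nat \<lfloor>t * 2 ^ j\<rfloor>) = 1 / 2 ^ j"
      unfolding conjunct2[OF elim] using t0 by simp
    then show ?case
      unfolding g_def by (simp only: nrm_minus_commute[of "m t"])
  qed
  ultimately show ?thesis
    by (rule Lim_transform_eventually)
qed

text \<open>On a finite set of dyadic times, all means are approximated by averages of the single
  operator \<open>T (1 / 2 ^ j)\<close>, and the maximal constant for such averages is the same for
  every j.\<close>

lemma maximal_m: "maximal_bound dyadics m (max_const * nrm x)"
proof (rule maximal_bound_limit[OF countable_dyadics])
  show "in_Lp (m t)" if "t \<in> dyadics" for t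
    using that by (intro in_Lp_m dyadics_pos)
  show "0 \<le> max_const * nrm x"
    by (simp add: max_const_nonneg)
  fix F and e :: real
  assume F: "finite F" "F \<subseteq> dyadics" and e: "0 < e"
  have "\<forall>\<^sub>F j in sequentially. \<forall>t\<in>F. nrm (\<lambda>w. m t w - mean (1 / 2 ^ j) (nat \<lfloor>t * 2 ^ j\<rfloor>) x w) < e"
  proof (rule eventually_ball_finite[OF F(1)], rule ballI)
    fix t assume "t \<in> F"
    with F(2) have "t \<in> dyadics" by auto
    from order_tendstoD(2)[OF dyadic_mean_limit[OF this] e]
    show "\<forall>\<^sub>F j in sequentially. nrm (\<lambda>w. m t w - mean (1 / 2 ^ j) (nat \<lfloor>t * 2 ^ j\<rfloor>) x w) < e" .
  qed
  then obtain j where j: "\<forall>t\<in>F. nrm (\<lambda>w. m t w - mean (1 / 2 ^ j) (nat \<lfloor>t * 2 ^ j\<rfloor>) x w) < e"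
    by (auto simp: eventually_sequentially)
  define v where "v t = mean (1 / 2 ^ j) (nat \<lfloor>t * 2 ^ j\<rfloor>) x" for t :: real
  obtain G where G: "in_Lp (G :: 'a \<Rightarrow> real)" "nrm G \<le> max_const * nrm x"
      "\<And>n. AE w in M. cmod (mean (1 / 2 ^ j) n x w) \<le> G w"
    using maximal_means[of "1 / 2 ^ j", OF _ x] unfolding maximal_bound_def by auto
  have "maximal_bound F v (max_const * nrm x)"
    by (rule maximal_boundI[OF G(1,2)]) (simp add: v_def G(3))
  moreover have "in_Lp (v t)" for t
    unfolding v_def by (intro in_Lp_mean x) simp
  ultimately show "\<exists>v. (\<forall>t\<in>F. in_Lp (v t)) \<and> (\<forall>t\<in>F. nrm (\<lambda>w. m t w - v t w) < e) \<and>
      maximal_bound F v (max_const * nrm x)"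
    using j by (intro exI[of _ v]) (auto simp: v_def)
qed

text \<open>The exchange of s and u moves the small time s into a factor s / u. What it multiplies
  has a majorant valid for all dyadic s, by \<open>maximal_m\<close> and regularity of T u.\<close>

lemma T_m_diff:
  assumes s: "0 < s" and u: "0 < u"
  shows "AE w in M. T s (m u) w - m u w = (s / u) *\<^sub>R (T u (m s) w - m s w)"
  using m_additive[OF s u] m_additive[OF u s]
proof eventually_elim
  case (elim w)
  have "s *\<^sub>R m s w + u *\<^sub>R T s (m u) w = u *\<^sub>R m u w + s *\<^sub>R T u (m s) w"
    using elim by (simp add: add.commute)
  then have "u *\<^sub>R (T s (m u) w - m u w) = s *\<^sub>R (T u (m s) w - m s w)"
    by (simp add: scaleR_diff_right algebra_simps)
  then have "(1 / u) *\<^sub>R (u *\<^sub>R (T s (m u) w - m u w)) = (1 / u) *\<^sub>R (s *\<^sub>R (T u (m s) w - m s w))"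
    by (rule arg_cong)
  then show ?case
    using u by simp
qed

text \<open>
  For the approximant \<open>w = m u\<close> of \<open>x\<close>, the difference \<open>T s w - w\<close> is of order \<open>s\<close> uniformly
  in \<open>s\<close>, with a majorant in \<open>L\<^sup>p\<close>; the remainder \<open>x - w\<close> is handled by the maximal inequality.
\<close>

lemma local_maximal_bound:
  assumes u: "0 < u" and \<delta>: "0 < \<delta>"
  shows "maximal_bound (dyadics \<inter> {..\<delta>}) (\<lambda>t w. m t w - x w)
    ((max_const + 1) * nrm (\<lambda>w. m u w - x w) + \<delta> / u * (2 * (max_const * nrm x)))"
    (is "maximal_bound ?D _ ?K")
proof (rule maximal_bound_limit)
  show "countable ?D"
    by (simp add: countable_dyadics)
  show "in_Lp (\<lambda>w. m t w - x w)" if "t \<in> ?D" for t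
    using that by (intro in_Lp_diff in_Lp_m x dyadics_pos) auto
  show "0 \<le> ?K"
    using u \<delta> max_const_nonneg by simp
  fix F and e :: real
  assume F: "finite F" "F \<subseteq> ?D" and e: "0 < e"
  define N where "N j t = nat \<lfloor>t * 2 ^ j\<rfloor>" for j :: nat and t :: real
  have "\<forall>\<^sub>F j in sequentially. \<forall>t\<in>F. nrm (\<lambda>w. m t w - mean (1 / 2 ^ j) (N j t) x w) < e
      \<and> 0 < N j t \<and> real (N j t) = t * 2 ^ j"
  proof (rule eventually_ball_finite[OF F(1)], rule ballI)
    fix t assume "t \<in> F"
    with F(2) have t: "t \<in> dyadics" by auto
    from order_tendstoD(2)[OF dyadic_mean_limit[OF t] e] dyadics_grid[OF t]
    show "\<forall>\<^sub>F j in sequentially. nrm (\<lambda>w. m t w - mean (1 / 2 ^ j) (N j t) x w) < e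
        \<and> 0 < N j t \<and> real (N j t) = t * 2 ^ j"
      unfolding N_def by eventually_elim auto
  qed
  then obtain j where j: "\<And>t. t \<in> F \<Longrightarrow> nrm (\<lambda>w. m t w - mean (1 / 2 ^ j) (N j t) x w) < e"
      "\<And>t. t \<in> F \<Longrightarrow> 0 < N j t" "\<And>t. t \<in> F \<Longrightarrow> real (N j t) = t * 2 ^ j"
    by (auto simp: eventually_sequentially)
  define h where "h = 1 / (2::real) ^ j"
  have h: "0 < h"
    by (simp add: h_def)
  have h0: "0 \<le> h"
    using h by simp
  note wL = in_Lp_m[OF u]
  have xw: "in_Lp (\<lambda>w. x w - m u w)"
    by (intro in_Lp_diff x wL)
  \<comment> \<open>A Riemann mean of x minus x is split as the mean of x - m u (maximal
    inequality), plus the mean of m u minus m u (order t / u), plus m u - x (independent of t). The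
    first and third parts account for max_const + 1 in the bound.\<close>
  define v1 where "v1 t = mean h (N j t) (\<lambda>w. x w - m u w)" for t
  define v2 where "v2 t w = mean h (N j t) (m u) w - m u w" for t w
  define v3 where "v3 w = m u w - x w" for w
  have b1: "maximal_bound F v1 (max_const * nrm (\<lambda>w. x w - m u w))"
  proof -
    obtain G where G: "in_Lp (G :: 'a \<Rightarrow> real)" "nrm G \<le> max_const * nrm (\<lambda>w. x w - m u w)"
        "\<And>n. AE w in M. cmod (mean h n (\<lambda>w. x w - m u w) w) \<le> G w"
      using maximal_means[OF h0 xw] unfolding maximal_bound_def by auto
    show ?thesis
      by (rule maximal_boundI[OF G(1,2)]) (simp add: v1_def G(3))
  qed
  have b2: "maximal_bound F v2 (\<delta> / u * (2 * (max_const * nrm x)))"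
  proof -
    obtain G where G: "in_Lp (G :: 'a \<Rightarrow> real)" "nrm G \<le> max_const * nrm x"
        "\<And>t. t \<in> dyadics \<Longrightarrow> AE w in M. cmod (m t w) \<le> G w"
      using maximal_m unfolding maximal_bound_def by blast
    have "maximal_bound dyadics (\<lambda>t. T u (m t)) (max_const * nrm x)"
      using u by (intro maximal_bound_T countable_dyadics maximal_m in_Lp_m dyadics_pos) auto
    then obtain H where H: "in_Lp (H :: 'a \<Rightarrow> real)" "nrm H \<le> max_const * nrm x"
        "\<And>t. t \<in> dyadics \<Longrightarrow> AE w in M. cmod (T u (m t) w) \<le> H w"
      unfolding maximal_bound_def by blast
    let ?G = "\<lambda>w. (\<delta> / u) *\<^sub>R (H w + G w)"
    \<comment> \<open>Grid times k h with k > 0 are dyadic, so G and H apply to them; this is where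
      the means at all dyadic times are needed.\<close>
    have step: "AE w in M. cmod (T (real k * h) (m u) w - m u w) \<le> real k * h / u * (H w + G w)" for k
    proof (cases "k = 0")
      case True
      show ?thesis
        using T_0[OF wL] by eventually_elim (simp add: True)
    next
      case False
      then have k: "real k * h \<in> dyadics"
        using grid_in_dyadics[of k j] by (simp add: h_def)
      show ?thesis
        using T_m_diff[OF dyadics_pos[OF k] u] G(3)[OF k] H(3)[OF k]
      proof eventually_elim
        case (elim w)
        have "cmod (T u (m (real k * h)) w - m (real k * h) w) \<le> H w + G w"
          using norm_triangle_ineq4[of "T u (m (real k * h)) w" "m (real k * h) w"] elim(2,3) by linarith
        then have "real k * h / u * cmod (T u (m (real k * h)) w - m (real k * h) w)
            \<le> real k * h / u * (H w + G w)"
          using h u by (intro mult_left_mono) auto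
        then show ?case
          unfolding elim(1) norm_scaleR using h u by simp
      qed
    qed
    then have step': "AE w in M. \<forall>k. cmod (T (real k * h) (m u) w - m u w) \<le> real k * h / u * (H w + G w)"
      by (simp add: AE_all_countable)
    show ?thesis
    proof (rule maximal_boundI)
      show "in_Lp ?G"
        by (intro in_Lp_scaleR in_Lp_add G(1) H(1))
      have "nrm ?G = \<delta> / u * nrm (\<lambda>w. H w + G w)"
        unfolding nrm_scaleR using \<delta> u by simp
      also have "\<dots> \<le> \<delta> / u * (2 * (max_const * nrm x))"
        using nrm_triangle[OF H(1) G(1)] G(2) H(2) \<delta> u by (intro mult_left_mono) auto
      finally show "nrm ?G \<le> \<delta> / u * (2 * (max_const * nrm x))" .
      fix t assume t: "t \<in> F"
      have Nh: "real (N j t) * h = t" "t \<le> \<delta>"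
        using j(3)[OF t] F(2) t by (auto simp: h_def)
      show "AE w in M. cmod (v2 t w) \<le> ?G w"
        using step' G(3)[OF one_in_dyadics] H(3)[OF one_in_dyadics]
      proof eventually_elim
        case (elim w)
        \<comment> \<open>The majorants are merely real functions; evaluating their bounds at the
          dyadic time 1 shows that H + G is nonnegative almost everywhere.\<close>
        have HG: "0 \<le> H w + G w"
          using elim(2,3) norm_ge_zero[of "m 1 w"] norm_ge_zero[of "T u (m 1) w"] by linarith
        have "v2 t w = (1 / real (N j t)) *\<^sub>R (\<Sum>k<N j t. T (real k * h) (m u) w - m u w)"
          unfolding v2_def mean_def scaled_sum_diff_const[OF j(2)[OF t]] ..
        then have "cmod (v2 t w) \<le> (\<Sum>k<N j t. cmod (T (real k * h) (m u) w - m u w)) / real (N j t)"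
          using norm_sum[of "\<lambda>k. T (real k * h) (m u) w - m u w" "{..<N j t}"]
          by (simp add: divide_right_mono)
        also have "\<dots> \<le> (\<Sum>k<N j t. \<delta> / u * (H w + G w)) / real (N j t)"
        proof (intro divide_right_mono sum_mono)
          fix k assume "k \<in> {..<N j t}"
          then have "real k * h \<le> real (N j t) * h"
            using h by (intro mult_right_mono) auto
          then have "real k * h / u * (H w + G w) \<le> \<delta> / u * (H w + G w)"
            using Nh HG u by (intro mult_right_mono divide_right_mono) auto
          then show "cmod (T (real k * h) (m u) w - m u w) \<le> \<delta> / u * (H w + G w)"
            using elim(1)[rule_format, of k] by linarith
        qed simp
        also have "\<dots> = ?G w"
          using j(2)[OF t] by simp
        finally show ?case .
      qed
    qed
  qed
  have b3: "maximal_bound F (\<lambda>_. v3) (nrm (\<lambda>w. m u w - x w))"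
    unfolding v3_def by (intro maximal_bound_const in_Lp_diff x wL)
  define v where "v t w = mean h (N j t) x w - x w" for t w
  have "maximal_bound F (\<lambda>t w. v1 t w + v2 t w + v3 w) ?K"
    using maximal_bound_add[OF maximal_bound_add[OF b1 b2] b3]
    by (rule maximal_bound_mono) (simp add: nrm_minus_commute[of x] algebra_simps)
  then have "maximal_bound F v ?K"
  proof (rule maximal_bound_dominated)
    show "AE w in M. cmod (v t w) \<le> cmod (v1 t w + v2 t w + v3 w)" for t
      using mean_diff[OF h0 x wL, of "N j t"] by eventually_elim (simp add: v_def v1_def v2_def v3_def)
  qed
  moreover have "nrm (\<lambda>w. (m t w - x w) - v t w) < e" if "t \<in> F" for t
    using j(1)[OF that] by (simp add: v_def h_def)
  moreover have "in_Lp (v t)" for t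
    unfolding v_def by (intro in_Lp_diff in_Lp_mean h0 x)
  ultimately show "\<exists>v. (\<forall>t\<in>F. in_Lp (v t)) \<and> (\<forall>t\<in>F. nrm (\<lambda>w. (m t w - x w) - v t w) < e) \<and> maximal_bound F v ?K"
    by blast
qed

theorem m_AE_tendsto_0:
  assumes cont: "AE w in M. continuous_on {0<..} (\<lambda>t. m t w)"
  shows "AE w in M. ((\<lambda>t. m t w) \<longlongrightarrow> x w) (at_right 0)"
proof -
  have ex: "\<exists>\<delta>>0. \<exists>G :: 'a \<Rightarrow> real. in_Lp G \<and> nrm G \<le> e \<and>
      (\<forall>t\<in>dyadics \<inter> {..\<delta>}. AE w in M. cmod (m t w - x w) \<le> G w)" if e: "0 < e" for e
  proof -
    let ?c = "max_const + 1" and ?C = "2 * (max_const * nrm x)"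
    have c: "0 < ?c" and C: "0 \<le> ?C"
      using max_const_nonneg by auto
    have "\<forall>\<^sub>F u in at_right 0. nrm (\<lambda>w. m u w - x w) < e / 2 / ?c \<and> 0 < u"
      using e c by (intro eventually_conj order_tendstoD(2)[OF m_tendsto_0] eventually_at_right_less) auto
    then obtain u where u: "nrm (\<lambda>w. m u w - x w) < e / 2 / ?c" "0 < u"
      using eventually_happens'[of "at_right (0::real)"] by force
    \<comment> \<open>u has been fixed so that the first term of the local bound is at most e / 2;
      now \<delta> does the same for the term of order \<delta> / u. The 1 in the denominator covers
      the case ?C = 0.\<close>
    define \<delta> where "\<delta> = u * (e / 2) / (?C + 1)"
    have \<delta>: "0 < \<delta>"
      using u(2) e C unfolding \<delta>_def by (intro divide_pos_pos mult_pos_pos) auto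
    have "\<delta> / u * D = e / 2 * (D / (D + 1))" if "\<delta> = u * (e / 2) / (D + 1)" for D
      using u(2) by (simp add: that)
    from this[OF \<delta>_def] have "\<delta> / u * ?C = e / 2 * (?C / (?C + 1))" .
    also have "\<dots> \<le> e / 2 * 1"
      using C e by (intro mult_left_mono) (auto simp: divide_le_eq_1)
    finally have "\<delta> / u * ?C \<le> e / 2"
      by simp
    moreover have "?c * nrm (\<lambda>w. m u w - x w) \<le> e / 2"
      using u(1) unfolding pos_less_divide_eq[OF c] by (subst mult.commute) (rule less_imp_le)
    ultimately have "maximal_bound (dyadics \<inter> {..\<delta>}) (\<lambda>t w. m t w - x w) e"
      by (intro maximal_bound_mono[OF local_maximal_bound[OF u(2) \<delta>]]) simp
    with \<delta> show ?thesis
      unfolding maximal_bound_def by blast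
  qed
  have "\<exists>\<delta>>0. \<exists>G :: 'a \<Rightarrow> real. in_Lp G \<and> nrm G \<le> 1 / real (Suc k) \<and>
      (\<forall>t\<in>dyadics \<inter> {..\<delta>}. AE w in M. cmod (m t w - x w) \<le> G w)" for k
    by (rule ex) simp
  then obtain \<delta> G where G: "\<And>k. 0 < \<delta> k" "\<And>k. in_Lp (G k :: 'a \<Rightarrow> real)" "\<And>k. nrm (G k) \<le> 1 / real (Suc k)"
      "\<And>k. \<forall>t\<in>dyadics \<inter> {..\<delta> k}. AE w in M. cmod (m t w - x w) \<le> G k w"
    by metis
  have G0: "(\<lambda>k. nrm (G k)) \<longlonglongrightarrow> 0"
    by (rule tendsto_sandwich[OF _ _ tendsto_const LIMSEQ_Suc[OF lim_1_over_n]]) (use G(3) in auto)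
  have "AE w in M. ((\<lambda>t. m t w - x w) \<longlongrightarrow> 0) (at_right 0)"
  proof (rule AE_tendsto_zero_by_maximal[OF G(2) G0])
    fix k
    have "AE w in M. \<forall>t\<in>dyadics \<inter> {..\<delta> k}. cmod (m t w - x w) \<le> G k w"
      using G(4) by (intro AE_all_countable_set) (auto simp: countable_dyadics)
    with cont show "AE w in M. \<forall>e>0. \<forall>\<^sub>F t in at_right 0. cmod (m t w - x w) \<le> G k w + e"
    proof (eventually_elim, intro allI impI)
      fix w and e :: real
      assume *: "continuous_on {0<..} (\<lambda>t. m t w)" "\<forall>t\<in>dyadics \<inter> {..\<delta> k}. cmod (m t w - x w) \<le> G k w"
        and e: "0 < e"
      have "cmod (m t w - x w) \<le> G k w" if "0 < t" "t < \<delta> k" for t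
        by (rule le_from_dyadics[of "\<lambda>t. cmod (m t w - x w)" "\<delta> k"])
          (use *(2) that in \<open>auto intro!: continuous_intros *(1)\<close>)
      then have "cmod (m t w - x w) \<le> G k w + e" if "0 < t" "t < \<delta> k" for t
        using that e by fastforce
      then show "\<forall>\<^sub>F t in at_right 0. cmod (m t w - x w) \<le> G k w + e"
        using G(1)[of k] by (auto simp: eventually_at_right_field)
    qed
  qed
  then show ?thesis
    by eventually_elim (simp add: LIM_zero_iff)
qed

section \<open>Convergence at infinity and the limit as kernel component\<close>

lemma m_integer:
  "AE w in M. m (real (Suc n)) w = regular_contraction.avg (T 1) (Suc n) (m 1) w"
proof -
  \<comment> \<open>Each use of \<open>m_additive\<close> with second time 1 contributes one more
    term of the orbit of \<open>m 1\<close> under T 1.\<close>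
  have sum: "AE w in M. real (Suc n) *\<^sub>R m (real (Suc n)) w = (\<Sum>k<Suc n. T (real k * 1) (m 1) w)"
  proof (induction n)
    case 0
    show ?case
      using T_0[OF in_Lp_m[OF zero_less_one]] by eventually_elim simp
  next
    case (Suc n)
    have "AE w in M. (real (Suc n) + 1) *\<^sub>R m (real (Suc n) + 1) w
        = real (Suc n) *\<^sub>R m (real (Suc n)) w + 1 *\<^sub>R T (real (Suc n)) (m 1) w"
      by (rule m_additive) auto
    with Suc show ?case
    proof eventually_elim
      case (elim w)
      have "real (Suc (Suc n)) = real (Suc n) + 1"
        by simp
      then show ?case
        unfolding sum.lessThan_Suc[of _ "Suc n"] elim(1)[symmetric] using elim(2) by simp
    qed
  qed
  have "AE w in M. regular_contraction.avg (T 1) (Suc n) (m 1) w = mean 1 (Suc n) (m 1) w"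
    by (intro mean_eq_avg in_Lp_m) auto
  with sum show ?thesis
  proof eventually_elim
    case (elim w)
    have "mean 1 (Suc n) (m 1) w = (1 / real (Suc n)) *\<^sub>R (real (Suc n) *\<^sub>R m (real (Suc n)) w)"
      unfolding mean_def elim(1) ..
    with elim(2) show ?case
      by simp
  qed
qed

theorem m_AE_tendsto_infinity:
  assumes cont: "AE w in M. continuous_on {0<..} (\<lambda>t. m t w)"
  obtains y where "in_Lp y" "AE w in M. ((\<lambda>t. m t w) \<longlongrightarrow> y w) at_top"
proof -
  have m1: "in_Lp (m 1)"
    by (rule in_Lp_m) simp
  interpret S: regular_contraction M p "T 1"
    by (rule regular_contraction_T) simp
  obtain y where y: "in_Lp y" "AE w in M. (\<lambda>n. S.avg n (m 1) w) \<longlonglongrightarrow> y w"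
    by (rule S.pointwise_ergodic[OF m1])
  have "AE w in M. \<forall>n. m (real (Suc n)) w = S.avg (Suc n) (m 1) w"
    unfolding AE_all_countable by (intro allI m_integer)
  with y(2) have lim: "AE w in M. (\<lambda>n. m (real n) w) \<longlonglongrightarrow> y w"
  proof eventually_elim
    case (elim w)
    have "(\<lambda>n. m (real (Suc n)) w) \<longlonglongrightarrow> y w"
      using LIMSEQ_Suc[OF elim(1)] by (simp only: elim(2))
    then show ?case
      by (rule LIMSEQ_imp_Suc)
  qed
  \<comment> \<open>H n dominates the contribution of the fractional part of t when t lies between n
    and n + 1. These majorants vary with n, but their norms share one bound, so H n / n tends to
    zero almost everywhere.\<close>
  have "\<exists>H :: 'a \<Rightarrow> real. in_Lp H \<and> nrm H \<le> max_const * nrm x \<and>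
      (\<forall>s\<in>dyadics. AE w in M. cmod (T (real n) (m s) w) \<le> H w)" for n
    using maximal_bound_T[OF of_nat_0_le_iff[of n] countable_dyadics in_Lp_m[OF dyadics_pos] maximal_m]
    unfolding maximal_bound_def by blast
  then obtain H where H: "\<And>n. in_Lp (H n :: 'a \<Rightarrow> real)" "\<And>n. nrm (H n) \<le> max_const * nrm x"
      "\<And>n. \<forall>s\<in>dyadics. AE w in M. cmod (T (real n) (m s) w) \<le> H n w"
    by metis
  have Hlim: "AE w in M. (\<lambda>n. (1 / real n) *\<^sub>R H n w) \<longlonglongrightarrow> 0"
    by (rule AE_scaled_tendsto_zero[OF H(1,2)])
  have "AE w in M. \<forall>n. \<forall>s\<in>dyadics. cmod ((real (Suc n) + s) *\<^sub>R m (real (Suc n) + s) w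
      - real (Suc n) *\<^sub>R m (real (Suc n)) w) \<le> s * H (Suc n) w"
    unfolding AE_all_countable
  proof (intro allI AE_all_countable_set[OF countable_dyadics])
    fix n s assume s: "s \<in> dyadics"
    have n: "0 < real (Suc n)"
      by simp
    have "AE w in M. cmod (T (real (Suc n)) (m s) w) \<le> H (Suc n) w"
      using H(3)[of "Suc n"] s by blast
    with m_additive[OF n dyadics_pos[OF s]]
    show "AE w in M. cmod ((real (Suc n) + s) *\<^sub>R m (real (Suc n) + s) w
        - real (Suc n) *\<^sub>R m (real (Suc n)) w) \<le> s * H (Suc n) w"
    proof eventually_elim
      case (elim w)
      show ?case
        unfolding elim(1) using elim(2) dyadics_pos[OF s] by (simp add: mult_left_mono)
    qed
  qed
  with cont Hlim lim have "AE w in M. ((\<lambda>t. m t w) \<longlongrightarrow> y w) at_top"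
  proof eventually_elim
    case (elim w)
    \<comment> \<open>The estimate is known at dyadic s and extends to all s in (0,1) by continuity
      of the chosen representatives; s = 0 is trivial. The sign of H is not known, hence the
      absolute value.\<close>
    have inc: "cmod ((real (Suc n) + s) *\<^sub>R m (real (Suc n) + s) w - real (Suc n) *\<^sub>R m (real (Suc n)) w)
        \<le> \<bar>H (Suc n) w\<bar>" if s: "0 \<le> s" "s < 1" for n s
    proof (cases "s = 0")
      case False
      have "cmod ((real (Suc n) + s) *\<^sub>R m (real (Suc n) + s) w - real (Suc n) *\<^sub>R m (real (Suc n)) w)
          - s * H (Suc n) w \<le> 0"
      proof (rule le_from_dyadics[where b=1 and c=0 and t=s and \<phi>="\<lambda>s. cmod ((real (Suc n) + s) *\<^sub>R m (real (Suc n) + s) w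
            - real (Suc n) *\<^sub>R m (real (Suc n)) w) - s * H (Suc n) w"])
        have "continuous_on {0<..} (\<lambda>s. m (real (Suc n) + s) w)"
          by (rule continuous_on_compose2[OF elim(1)]) (auto intro!: continuous_intros)
        then show "continuous_on {0<..} (\<lambda>s. cmod ((real (Suc n) + s) *\<^sub>R m (real (Suc n) + s) w
            - real (Suc n) *\<^sub>R m (real (Suc n)) w) - s * H (Suc n) w)"
          by (intro continuous_intros)
        show "cmod ((real (Suc n) + s) *\<^sub>R m (real (Suc n) + s) w - real (Suc n) *\<^sub>R m (real (Suc n)) w)
          - s * H (Suc n) w \<le> 0" if "s \<in> dyadics" for s
          using elim(4) that by (simp del: of_nat_Suc)
      qed (use s False in auto)
      moreover have "s * H (Suc n) w \<le> s * \<bar>H (Suc n) w\<bar>" "s * \<bar>H (Suc n) w\<bar> \<le> 1 * \<bar>H (Suc n) w\<bar>"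
        using s by (intro mult_left_mono mult_right_mono; simp)+
      ultimately show ?thesis by linarith
    qed simp
    \<comment> \<open>With n the integer part of t, t (m t - m n) is the increment of t m t since
      time n, minus (t - n) m n. Divided by n these account for the first two terms; the third is
      convergence along the integers.\<close>
    define c where "c n = \<bar>(1 / real n) *\<^sub>R H n w\<bar> + cmod ((1 / real n) *\<^sub>R m (real n) w)
        + cmod (m (real n) w - y w)" for n
    have "(\<lambda>n. cmod (m (real n) w - y w)) \<longlonglongrightarrow> 0"
      using elim(3) by (intro tendsto_norm_zero LIM_zero)
    moreover have "(\<lambda>n. cmod ((1 / real n) *\<^sub>R m (real n) w)) \<longlonglongrightarrow> 0"
      using tendsto_norm[OF tendsto_scaleR[OF lim_1_over_n elim(3)]] by simp
    ultimately have "c \<longlonglongrightarrow> 0 + 0 + 0"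
      unfolding c_def by (intro tendsto_add tendsto_rabs_zero elim(2))
    then have "c \<longlonglongrightarrow> 0"
      by simp
    then have clim: "((\<lambda>t. c (nat \<lfloor>t\<rfloor>)) \<longlongrightarrow> 0) at_top"
      by (rule filterlim_compose) (intro filterlim_compose[OF filterlim_nat_sequentially] filterlim_floor_sequentially)
    have "\<forall>\<^sub>F t in at_top. norm (m t w - y w) \<le> c (nat \<lfloor>t\<rfloor>)"
      using eventually_ge_at_top[of "1::real"]
    proof eventually_elim
      case (elim t)
      obtain n where n: "nat \<lfloor>t\<rfloor> = Suc n"
        using elim by (cases "nat \<lfloor>t\<rfloor>") auto
      define s where "s = t - real (Suc n)"
      have s: "0 \<le> s" "s < 1"
        using elim n unfolding s_def by linarith+
      have ts: "t = real (Suc n) + s"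
        by (simp add: s_def)
      let ?a = "m t w" and ?b = "m (real (Suc n)) w" and ?N = "real (Suc n)"
      have "t *\<^sub>R (?a - ?b) = (t *\<^sub>R ?a - ?N *\<^sub>R ?b) - s *\<^sub>R ?b"
        by (simp add: s_def scaleR_diff_right scaleR_diff_left)
      then have "t * cmod (?a - ?b) = cmod ((t *\<^sub>R ?a - ?N *\<^sub>R ?b) - s *\<^sub>R ?b)"
        using elim by (metis abs_of_nonneg norm_scaleR order_trans zero_le_one)
      also have "\<dots> \<le> cmod (t *\<^sub>R ?a - ?N *\<^sub>R ?b) + s * cmod ?b"
        using norm_triangle_ineq4[of "t *\<^sub>R ?a - ?N *\<^sub>R ?b" "s *\<^sub>R ?b"] s(1) by simp
      also have "\<dots> \<le> \<bar>H (Suc n) w\<bar> + 1 * cmod ?b"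
        using inc[OF s, of n] s unfolding ts[symmetric] by (intro add_mono mult_right_mono) auto
      finally have "t * cmod (?a - ?b) \<le> \<bar>H (Suc n) w\<bar> + cmod ?b"
        by simp
      moreover have "?N * cmod (?a - ?b) \<le> t * cmod (?a - ?b)"
        using s(1) ts by (intro mult_right_mono) auto
      ultimately have "?N * cmod (?a - ?b) \<le> \<bar>H (Suc n) w\<bar> + cmod ?b"
        by linarith
      then have "cmod (?a - ?b) \<le> (\<bar>H (Suc n) w\<bar> + cmod ?b) / ?N"
        by (subst pos_le_divide_eq) (auto simp: mult.commute)
      then show ?case
        unfolding n c_def using norm_triangle_ineq[of "?a - ?b" "?b - y w"]
        by (simp add: add_divide_distrib abs_mult del: of_nat_Suc)
    qed
    then have "((\<lambda>t. m t w - y w) \<longlongrightarrow> 0) at_top"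
      by (rule Lim_null_comparison) (rule clim)
    then show ?case
      by (simp add: LIM_zero_iff)
  qed
  with y(1) show thesis
    by (rule that)
qed

text \<open>The majorant from \<open>maximal_m\<close> makes m N converge to y in norm as well. For
  invariance, T s (m N) then tends in norm to T s y, while pointwise it differs from m (s + N) by
  terms of order 1/N and so tends to y. For the range, y is close in norm to some m N, which is
  close to a Riemann mean, and x minus a Riemann mean lies in the range of A.\<close>

lemma limit_is_kernel_component:
  assumes y: "in_Lp y" and lim: "AE w in M. ((\<lambda>t. m t w) \<longlongrightarrow> y w) at_top"
  shows "y \<in> op_kernel (Lp_generator M p T)"
    and "(\<lambda>w. x w - y w) \<in> Lp_closure M p (op_range (Lp_generator M p T))"
proof -
  obtain G where G: "in_Lp (G :: 'a \<Rightarrow> real)" "\<And>t. t \<in> dyadics \<Longrightarrow> AE w in M. cmod (m t w) \<le> G w"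
    using maximal_m unfolding maximal_bound_def by blast
  define N where "N n = real (Suc n)" for n
  have N: "0 < N n" for n
    by (simp add: N_def)
  have N_top: "filterlim N at_top sequentially"
    unfolding N_def by (rule filterlim_compose[OF filterlim_real_sequentially filterlim_Suc])
  have mL: "in_Lp (m (N n))" for n
    by (rule in_Lp_m[OF N])
  have limN: "AE w in M. (\<lambda>n. m (N n) w) \<longlonglongrightarrow> y w"
    using lim by eventually_elim (rule filterlim_compose[OF _ N_top])
  have nlim: "(\<lambda>n. nrm (\<lambda>w. m (N n) w - y w)) \<longlonglongrightarrow> 0"
  proof (rule dominated_nrm_tendsto(2)[OF in_Lp_measurable[OF mL] in_Lp_measurable[OF y] G(1) _ limN])
    show "AE w in M. cmod (m (N n) w) \<le> G w" for n
      using G(2)[OF grid_in_dyadics[of "Suc n" 0]] by (simp add: N_def)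
  qed
  show "y \<in> op_kernel (Lp_generator M p T)"
  proof (rule fixed_in_op_kernel[OF y])
    fix s :: real assume s: "0 < s"
    then have s0: "0 \<le> s" by simp
    have lims: "(\<lambda>n. nrm (\<lambda>w. T s (m (N n)) w - T s y w)) \<longlonglongrightarrow> 0"
      by (rule tendsto_sandwich[OF _ _ tendsto_const nlim]) (auto intro!: always_eventually T_nrm_diff s0 mL y)
    have "AE w in M. \<forall>n. (s + N n) *\<^sub>R m (s + N n) w = s *\<^sub>R m s w + N n *\<^sub>R T s (m (N n)) w"
      unfolding AE_all_countable by (intro allI m_additive s N)
    with lim have "AE w in M. (\<lambda>n. T s (m (N n)) w) \<longlonglongrightarrow> y w"
    proof eventually_elim
      case (elim w)
      have eq: "T s (m (N n)) w = (s * (1 / N n) + 1) *\<^sub>R m (s + N n) w - (1 / N n) *\<^sub>R (s *\<^sub>R m s w)" for n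
      proof -
        have "N n *\<^sub>R T s (m (N n)) w = (s + N n) *\<^sub>R m (s + N n) w - s *\<^sub>R m s w"
          using elim(2) by simp
        then have "(1 / N n) *\<^sub>R (N n *\<^sub>R T s (m (N n)) w) = (1 / N n) *\<^sub>R ((s + N n) *\<^sub>R m (s + N n) w - s *\<^sub>R m s w)"
          by (rule arg_cong)
        then show ?thesis
          using N[of n] by (simp add: scaleR_diff_right add_divide_distrib)
      qed
      have "filterlim (\<lambda>n. s + N n) at_top sequentially"
        by (rule filterlim_tendsto_add_at_top[OF tendsto_const N_top])
      then have 1: "(\<lambda>n. m (s + N n) w) \<longlonglongrightarrow> y w"
        by (rule filterlim_compose[OF elim(1)])
      have 2: "(\<lambda>n. 1 / N n) \<longlonglongrightarrow> 0"
        unfolding N_def by (rule LIMSEQ_Suc[OF lim_1_over_n])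
      have "(\<lambda>n. (s * (1 / N n) + 1) *\<^sub>R m (s + N n) w - (1 / N n) *\<^sub>R (s *\<^sub>R m s w))
          \<longlonglongrightarrow> (s * 0 + 1) *\<^sub>R y w - 0 *\<^sub>R (s *\<^sub>R m s w)"
        by (intro tendsto_intros 1 2)
      then show ?case
        unfolding eq by simp
    qed
    then have "AE w in M. y w = T s y w"
      by (rule nrm_tendsto_AE_unique[OF T_in[OF s0 mL] T_in[OF s0 y] lims])
    then show "AE w in M. T s y w = y w"
      by eventually_elim simp
  qed
  show "(\<lambda>w. x w - y w) \<in> Lp_closure M p (op_range (Lp_generator M p T))"
    unfolding Lp_closure_def mem_Collect_eq
  proof (intro conjI allI impI)
    show "(\<lambda>w. x w - y w) \<in> Lp M p"
      unfolding in_Lp_iff[symmetric] by (intro in_Lp_diff x y)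
    fix e :: real assume e: "0 < e"
    have "\<forall>\<^sub>F n in sequentially. nrm (\<lambda>w. m (N n) w - y w) < e / 2"
      using order_tendstoD(2)[OF nlim, of "e / 2"] e by simp
    then obtain n where n: "nrm (\<lambda>w. m (N n) w - y w) < e / 2"
      by (auto simp: eventually_sequentially)
    have "\<forall>\<^sub>F k in sequentially. nrm (\<lambda>w. mean (N n / Suc k) (Suc k) x w - m (N n) w) < e / 2"
      using order_tendstoD(2)[OF mean_limit[OF N], of "e / 2" n] e by simp
    then obtain k where k: "nrm (\<lambda>w. mean (N n / Suc k) (Suc k) x w - m (N n) w) < e / 2"
      by (auto simp: eventually_sequentially)
    let ?A = "mean (N n / Suc k) (Suc k) x"
    have h: "0 < N n / Suc k"
      using N[of n] by simp
    have "nrm (\<lambda>w. x w - y w - (x w - ?A w)) = nrm (\<lambda>w. ?A w - y w)"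
      by simp
    also have "\<dots> \<le> nrm (\<lambda>w. ?A w - m (N n) w) + nrm (\<lambda>w. m (N n) w - y w)"
      by (intro nrm_triangle_diff in_Lp_mean less_imp_le[OF h] x mL y)
    also have "\<dots> < e"
      using n k by linarith
    finally show "\<exists>h\<in>op_range (Lp_generator M p T). nrm (\<lambda>w. x w - y w - h w) < e"
      by (rule bexI[OF _ diff_mean_in_range[OF h zero_less_Suc[of k]]])
  qed
qed

end

theorem corollary5p3:
  fixes M :: "'a measure" and p :: real
    and T :: "real \<Rightarrow> ('a \<Rightarrow> complex) \<Rightarrow> 'a \<Rightarrow> complex"
    and x :: "'a \<Rightarrow> complex"
    and m :: "real \<Rightarrow> 'a \<Rightarrow> complex"
  assumes "1 < p"
    and "Lp_C0_semigroup M p T"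
    and "\<And>t. t \<ge> 0 \<Longrightarrow> contractively_regular M p (T t)"
    and "x \<in> Lp M p"
    and "\<And>t. t > 0 \<Longrightarrow> represents_mean M p T t x (m t)"
    and "AE \<omega> in M. continuous_on {0<..} (\<lambda>t. m t \<omega>)"
  shows "AE \<omega> in M.
           ((\<lambda>t. m t \<omega>) \<longlongrightarrow> kernel_projection M p (Lp_generator M p T) x \<omega>) at_top \<and>
           ((\<lambda>t. m t \<omega>) \<longlongrightarrow> x \<omega>) (at_right 0)"
proof -
  interpret Lp_space M p
    using assms(1) by unfold_locales
  interpret semigroup_means M p T x m
    using assms by unfold_locales (auto simp: in_Lp_iff)
  obtain y where y: "in_Lp y" "AE w in M. ((\<lambda>t. m t w) \<longlongrightarrow> y w) at_top"
    by (rule m_AE_tendsto_infinity[OF assms(6)])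
  note comp = limit_is_kernel_component[OF y]
  let ?P = "kernel_projection M p (Lp_generator M p T) x"
  \<comment> \<open>The pointwise limit y witnesses that the choice defining the projection is not
    vacuous; uniqueness then identifies the chosen representative with y off a null set.\<close>
  have "?P \<in> op_kernel (Lp_generator M p T) \<and>
      (\<lambda>w. x w - ?P w) \<in> Lp_closure M p (op_range (Lp_generator M p T))"
    unfolding kernel_projection_def by (rule someI[where x=y]) (intro conjI comp)
  then have "AE w in M. ?P w = y w"
    using kernel_component_unique comp by blast
  with y(2) m_AE_tendsto_0[OF assms(6)] show ?thesis
    by eventually_elim simp
qed

end
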